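(* Let $a=3$ and $f=f_3$. Then $K=\{p_{fix}\}$. The stable set of $p_{fix}$ consists of three analytic curves; these three curves meet transversely at $p_{fix}$ and have no other pairwise intersections in $\mathbf{R}^2$. The same holds for the unstable set of $p_{fix}$: it consists of three analytic curves which meet transversely at $p_{fix}$ and have no other pairwise intersections in $\mathbf{R}^2$.
   Context: $f=f_3$ is the plane birational map $f(x,y)=\left(y\,\frac{x+3}{x-1},\,x+2\right)$, with inverse $f^{-1}(x,y)=\left(y-2,\ \frac{x(y-3)}{1+y}\right)$. Let $\overline{\mathbf{R}^2}=(\mathbf{R}\cup\{\infty\})\times(\mathbf{R}\cup\{\infty\})\cong S^1\times S^1$. The map $f$ extends continuously to $\overline{\mathbf{R}^2}\setminus I(f)$, $I(f)=\{(-3,\infty),(1,0)\}$, and $f^{-1}$ extends continuously to $\overline{\mathbf{R}^2}\setminus I(f^{-1})$, $I(f^{-1})=\{(0,-1),(\infty,3)\}$; forward and backward orbits are taken with respect to these extensions. The point $p_{fix}=(-1,1)$ is the unique fixed point of $f$ in $\mathbf{R}^2$. $K\subset\mathbf{R}^2$ is the set of points $p$ whose full orbit $(f^n(p))_{n\in\mathbf{Z}}$ is (well-defined and) bounded in $\mathbf{R}^2$. The stable set of $p_{fix}$ is the set of points $p$ with $f^n(p)\to p_{fix}$ as $n\to+\infty$; the unstable set is the set of points $p$ with $f^{-n}(p)\to p_{fix}$ as $n\to+\infty$.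
   Formalization: "Consists of three analytic curves" means: the stable (unstable) set is the union of three curves in the compactified plane minus points with undefined orbit; each curve is a half-branch ending at p_fix, analytic away from p_fix and C^1 up to it. *)

theory Defs
  imports "HOL-Analysis.Analysis"
begin

text \<open>The compactified line and plane. Points of the circle R + infinity are modelled as
  \<^typ>\<open>real option\<close>, with \<^term>\<open>None\<close> as the point at infinity.\<close>

type_synonym eplane = "real option \<times> real option"

abbreviation circle_top :: "real option topology" where
  "circle_top \<equiv> Alexandroff_compactification euclideanreal"

abbreviation eplane_top :: "eplane topology" where
  "eplane_top \<equiv> prod_topology circle_top circle_top"

definition fin :: "real \<times> real \<Rightarrow> eplane" where
  "fin p = (Some (fst p), Some (snd p))"

text \<open>The map x -> (a x + b) / (c x + d) on R + infinity; only used with a d - b c nonzero.\<close>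

definition emoebius :: "real \<Rightarrow> real \<Rightarrow> real \<Rightarrow> real \<Rightarrow> real option \<Rightarrow> real option" where
  "emoebius a b c d z = (case z of
      None \<Rightarrow> (if c = 0 then None else Some (a / c))
    | Some x \<Rightarrow> (if c * x + d = 0 then None else Some ((a * x + b) / (c * x + d))))"

text \<open>Multiplication on R + infinity. The products of 0 and infinity are the undefined ones; the
  value given to them here is never used, since orbits are required to avoid them.\<close>

definition emult :: "real option \<Rightarrow> real option \<Rightarrow> real option" where
  "emult z w = (case (z, w) of (Some x, Some y) \<Rightarrow> Some (x * y) | _ \<Rightarrow> None)"

definition f_ext :: "eplane \<Rightarrow> eplane" where
  "f_ext p = (emult (snd p) (emoebius 1 3 1 (-1) (fst p)), emoebius 1 2 0 1 (fst p))"

definition finv_ext :: "eplane \<Rightarrow> eplane" where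
  "finv_ext p = (emoebius 1 (-2) 0 1 (snd p), emult (fst p) (emoebius 1 (-3) 1 1 (snd p)))"

definition Ind_f :: "eplane set" where
  "Ind_f = {(Some (-3), None), (Some 1, Some 0)}"

definition Ind_finv :: "eplane set" where
  "Ind_finv = {(Some 0, Some (-1)), (None, Some 3)}"

definition pfix :: "real \<times> real" where
  "pfix = (-1, 1)"

text \<open>Points with a well-defined forward orbit under \<^term>\<open>g\<close>, a map undefined on \<^term>\<open>I\<close>.\<close>

definition orbit_defined :: "(eplane \<Rightarrow> eplane) \<Rightarrow> eplane set \<Rightarrow> eplane set" where
  "orbit_defined g I = {p. \<forall>n. (g ^^ n) p \<notin> I}"

definition K_set :: "(real \<times> real) set" where
  "K_set = {p. fin p \<in> orbit_defined f_ext Ind_f \<and> fin p \<in> orbit_defined finv_ext Ind_finv \<and>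
        (\<exists>B. bounded B \<and> (\<forall>n. (f_ext ^^ n) (fin p) \<in> fin ` B \<and> (finv_ext ^^ n) (fin p) \<in> fin ` B))}"

definition attracted_set :: "(eplane \<Rightarrow> eplane) \<Rightarrow> eplane set \<Rightarrow> eplane \<Rightarrow> eplane set" where
  "attracted_set g I q =
     {p \<in> orbit_defined g I. limitin eplane_top (\<lambda>n. (g ^^ n) p) q sequentially}"

definition stable_set :: "eplane set" where
  "stable_set = attracted_set f_ext Ind_f (fin pfix)"

definition unstable_set :: "eplane set" where
  "unstable_set = attracted_set finv_ext Ind_finv (fin pfix)"

definition real_analytic_at :: "(real \<Rightarrow> real) \<Rightarrow> real \<Rightarrow> bool" where
  "real_analytic_at u t \<longleftrightarrow>
     (\<exists>a. \<exists>r>0. \<forall>s. \<bar>s - t\<bar> < r \<longrightarrow> (\<lambda>n. a n * (s - t) ^ n) sums u s)"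

text \<open>\<^term>\<open>u\<close> is the coordinate expression near \<^term>\<open>t\<close> of a path \<^term>\<open>z\<close> in R + infinity,
  in one of the two analytic charts x and 1/x.\<close>

definition chart_rep :: "(real \<Rightarrow> real option) \<Rightarrow> real \<Rightarrow> (real \<Rightarrow> real) \<Rightarrow> bool" where
  "chart_rep z t u \<longleftrightarrow>
     (\<forall>\<^sub>F s in nhds t. z s = Some (u s)) \<or>
     (\<forall>\<^sub>F s in nhds t. emoebius 0 1 1 0 (z s) = Some (u s))"

definition regular_analytic_at :: "(real \<Rightarrow> eplane) \<Rightarrow> real \<Rightarrow> bool" where
  "regular_analytic_at c t \<longleftrightarrow>
     (\<exists>u v. chart_rep (fst \<circ> c) t u \<and> chart_rep (snd \<circ> c) t v \<and>
        real_analytic_at u t \<and> real_analytic_at v t \<and> (deriv u t \<noteq> 0 \<or> deriv v t \<noteq> 0))"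

text \<open>The path \<^term>\<open>c\<close> starts (at parameter 0) in the finite plane as a C1 path with one-sided
  initial velocity \<^term>\<open>w\<close>.\<close>

definition initial_velocity :: "(real \<Rightarrow> eplane) \<Rightarrow> real \<times> real \<Rightarrow> bool" where
  "initial_velocity c w \<longleftrightarrow>
     (\<exists>\<epsilon>>0. \<exists>\<gamma> \<gamma>'. (\<forall>s\<in>{0..<\<epsilon>}. c s = fin (\<gamma> s) \<and>
          (\<gamma> has_vector_derivative \<gamma>' s) (at s within {0..<\<epsilon>})) \<and>
        continuous_on {0..<\<epsilon>} \<gamma>' \<and> \<gamma>' 0 = w)"

text \<open>A simple analytic curve issuing from the point \<^term>\<open>q\<close> of the finite plane with nonzero
  tangent vector \<^term>\<open>w\<close>. The curve lives in the compactified plane and may cross infinity.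
  The third iterate of the map is tangent to the identity at its fixed point and each of its three
  characteristic lines is attracting on one side only; the stable set is therefore made of
  half-branches ending at the fixed point, whose formal expansions there diverge, so that
  analyticity is required away from the end point.\<close>

definition analytic_curve_from :: "real \<times> real \<Rightarrow> (real \<Rightarrow> eplane) \<Rightarrow> real \<times> real \<Rightarrow> bool" where
  "analytic_curve_from q c w \<longleftrightarrow>
     c 0 = fin q \<and> inj_on c {0..} \<and> (\<forall>t>0. regular_analytic_at c t) \<and>
     initial_velocity c w \<and> w \<noteq> 0"

text \<open>The set \<^term>\<open>W\<close> consists of three analytic curves which meet transversely at \<^term>\<open>q\<close> and
  have no other pairwise intersections in the finite plane. Here \<^term>\<open>D\<close> is the set of points
  with a well-defined orbit. The stable curves run through indeterminacy points (one through (1,0),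
  two through (-3,infinity)) and through the backward images of these; since the orbit of such a
  point is undefined, the countably many points outside \<^term>\<open>D\<close> are discarded when the union of
  the curves is compared with \<^term>\<open>W\<close>.\<close>

definition three_transverse_curves ::
    "eplane set \<Rightarrow> eplane set \<Rightarrow> real \<times> real \<Rightarrow> bool" where
  "three_transverse_curves W D q \<longleftrightarrow>
     (\<exists>(c :: nat \<Rightarrow> real \<Rightarrow> eplane) (w :: nat \<Rightarrow> real \<times> real).
        (\<forall>i<3. analytic_curve_from q (c i) (w i)) \<and>
        W = D \<inter> (\<Union>i<3. c i ` {0..}) \<and>
        (\<forall>i<3. \<forall>j<3. i \<noteq> j \<longrightarrow>
           span {w i, w j} = UNIV \<and>
           c i ` {0..} \<inter> c j ` {0..} \<inter> range fin = {fin q}))"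

text \<open>The maps above extend the birational map and its inverse, and the extensions are continuous
  off the indeterminacy points. The filter \<^term>\<open>nb z\<close> is the neighbourhood filter of
  \<^term>\<open>z\<close> in the circle.\<close>

lemma f_ext_fin: "x \<noteq> 1 \<Longrightarrow> f_ext (fin (x, y)) = fin (y * ((x + 3) / (x - 1)), x + 2)"
  by (auto simp: f_ext_def fin_def emoebius_def emult_def)

lemma finv_ext_fin: "y \<noteq> -1 \<Longrightarrow> finv_ext (fin (x, y)) = fin (y - 2, x * (y - 3) / (1 + y))"
  by (auto simp: finv_ext_def fin_def emoebius_def emult_def add.commute)

lemma finv_ext_f_ext:
  assumes "x \<noteq> 1" "x \<noteq> -3"
  shows "finv_ext (f_ext (fin (x, y))) = fin (x, y)"
proof -
  have "3 + x \<noteq> 0" using assms by auto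
  moreover have "finv_ext (f_ext (fin (x, y))) =
      fin (x, y * ((x + 3) / (x - 1)) * (x + 2 - 3) / (1 + (x + 2)))"
    using assms by (subst f_ext_fin) (auto simp: finv_ext_fin)
  moreover have "y * ((x + 3) / (x - 1)) * (x - 1) / (x + 3) = y"
    using assms \<open>3 + x \<noteq> 0\<close> by (simp add: add.commute)
  ultimately show ?thesis by (simp add: algebra_simps)
qed

definition nb :: "real option \<Rightarrow> real option filter" where
  "nb z = (case z of Some x \<Rightarrow> filtermap Some (nhds x)
     | None \<Rightarrow> sup (principal {None}) (filtermap Some at_infinity))"

lemma eventually_nb_Some: "eventually P (nb (Some x)) \<longleftrightarrow> (\<forall>\<^sub>F s in nhds x. P (Some s))"
  by (simp add: nb_def eventually_filtermap)

lemma eventually_nb_None: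
  "eventually P (nb None) \<longleftrightarrow> P None \<and> (\<forall>\<^sub>F s in at_infinity. P (Some s))"
  by (simp add: nb_def eventually_filtermap eventually_sup eventually_principal)

lemma openin_circle_top:
  "openin circle_top V \<longleftrightarrow> (\<forall>z\<in>V. eventually (\<lambda>w. w \<in> V) (nb z))"
proof
  assume "openin circle_top V"
  then consider U where "open U" "V = Some ` U"
    | C where "compact C" "V = insert None (Some ` (- C))"
    by (auto simp: openin_Alexandroff_compactification Compl_eq_Diff_UNIV)
  then show "\<forall>z\<in>V. eventually (\<lambda>w. w \<in> V) (nb z)"
  proof cases
    case 1
    then show ?thesis
      by (auto simp: eventually_nb_Some inj_image_mem_iff intro!: eventually_nhds_in_open)
  next
    case 2
    then obtain B where B: "\<And>x. x \<in> C \<Longrightarrow> \<bar>x\<bar> \<le> B"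
      using compact_imp_bounded[OF 2(1)] by (auto simp: bounded_iff)
    have "\<forall>\<^sub>F s in at_infinity. s \<in> - C"
      unfolding eventually_at_infinity using B
      by (intro exI[of _ "B + 1"]) force
    moreover have "\<forall>\<^sub>F s in nhds x. s \<in> - C" if "x \<in> - C" for x
      using that 2(1) by (intro eventually_nhds_in_open) (auto simp: compact_imp_closed)
    ultimately show ?thesis
      using 2(2) by (auto simp: eventually_nb_Some eventually_nb_None inj_image_mem_iff)
  qed
next
  assume R: "\<forall>z\<in>V. eventually (\<lambda>w. w \<in> V) (nb z)"
  define U where "U = {x. Some x \<in> V}"
  have "open U"
    unfolding open_subopen[of U]
  proof
    fix x assume "x \<in> U"
    then have "\<forall>\<^sub>F s in nhds x. s \<in> U" using R by (auto simp: U_def eventually_nb_Some)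
    then show "\<exists>T. open T \<and> x \<in> T \<and> T \<subseteq> U" by (auto simp: eventually_nhds)
  qed
  show "openin circle_top V"
  proof (cases "None \<in> V")
    case False
    then have "V = Some ` U" by (auto simp: U_def image_iff) (metis not_None_eq)
    then show ?thesis using \<open>open U\<close> by simp
  next
    case True
    then have "\<forall>\<^sub>F s in at_infinity. s \<in> U" using R by (auto simp: U_def eventually_nb_None)
    then obtain B where B: "\<And>s. B \<le> \<bar>s\<bar> \<Longrightarrow> s \<in> U"
      by (auto simp: eventually_at_infinity)
    have "bounded (- U)"
      unfolding bounded_iff using B by (intro exI[of _ B]) (auto, force)
    then have "compact (- U)" using \<open>open U\<close> by (simp add: compact_eq_bounded_closed closed_Compl)
    moreover have "V = insert None (Some ` (- (- U)))"
      using True by (auto simp: U_def image_iff) (metis not_None_eq)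
    ultimately show ?thesis
      using compact_imp_closed unfolding openin_Alexandroff_compactification
      by (intro disjI2 exI[of _ "- U"]) (simp add: Compl_eq_Diff_UNIV)
  qed
qed

lemma eventually_nb_imp_openin:
  assumes "eventually P (nb z)"
  shows "\<exists>A. openin circle_top A \<and> z \<in> A \<and> (\<forall>w\<in>A. P w)"
proof (cases z)
  case (Some x)
  then obtain U where "open U" "x \<in> U" "\<forall>s\<in>U. P (Some s)"
    using assms by (auto simp: eventually_nb_Some eventually_nhds)
  then show ?thesis using Some by (intro exI[of _ "Some ` U"]) auto
next
  case None
  then obtain B where B: "\<And>s. B \<le> \<bar>s\<bar> \<Longrightarrow> P (Some s)" and "P None"
    using assms by (auto simp: eventually_nb_None eventually_at_infinity)
  have "openin circle_top (insert None (Some ` (- {-\<bar>B\<bar>..\<bar>B\<bar>})))"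
    unfolding openin_Alexandroff_compactification
    by (intro disjI2 exI[of _ "{-\<bar>B\<bar>..\<bar>B\<bar>}"]) (simp add: Compl_eq_Diff_UNIV)
  moreover have "\<forall>w\<in>insert None (Some ` (- {-\<bar>B\<bar>..\<bar>B\<bar>})). P w"
    using B \<open>P None\<close> by force
  ultimately show ?thesis using None by blast
qed

lemma continuous_map_eplane_circle:
  assumes "\<And>p. p \<in> S \<Longrightarrow> filterlim g (nb (g p)) (nb (fst p) \<times>\<^sub>F nb (snd p))"
  shows "continuous_map (subtopology eplane_top S) circle_top g"
  unfolding continuous_map_def
proof (intro conjI allI impI)
  show "g \<in> topspace (subtopology eplane_top S) \<rightarrow> topspace circle_top"
    by (simp add: UNIV_option_conv[symmetric])
  fix V assume V: "openin circle_top V"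
  let ?T = "{p \<in> topspace (subtopology eplane_top S). g p \<in> V}"
  have "\<exists>T. openin (subtopology eplane_top S) T \<and> p \<in> T \<and> T \<subseteq> ?T" if "p \<in> ?T" for p
  proof -
    have p: "p \<in> S" "g p \<in> V" using that by auto
    then have "\<forall>\<^sub>F q in nb (fst p) \<times>\<^sub>F nb (snd p). g q \<in> V"
      using assms[OF p(1)] V by (auto simp: openin_circle_top filterlim_iff)
    then obtain P Q where PQ: "eventually P (nb (fst p))" "eventually Q (nb (snd p))"
        "\<And>z w. P z \<Longrightarrow> Q w \<Longrightarrow> g (z, w) \<in> V"
      by (auto simp: eventually_prod_filter)
    obtain A where A: "openin circle_top A" "fst p \<in> A" "\<forall>w\<in>A. P w"
      using eventually_nb_imp_openin[OF PQ(1)] by auto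
    obtain B where B: "openin circle_top B" "snd p \<in> B" "\<forall>w\<in>B. Q w"
      using eventually_nb_imp_openin[OF PQ(2)] by auto
    have "openin eplane_top (A \<times> B)" using A B by (simp add: openin_prod_Times_iff)
    then have "openin (subtopology eplane_top S) ((A \<times> B) \<inter> S)"
      by (auto simp: openin_subtopology)
    moreover have "p \<in> (A \<times> B) \<inter> S" using A B p by (cases p) auto
    moreover have "(A \<times> B) \<inter> S \<subseteq> ?T"
      using PQ(3) A B openin_subset[OF A(1)] openin_subset[OF B(1)] by auto
    ultimately show ?thesis by blast
  qed
  then show "openin (subtopology eplane_top S) ?T"
    by (subst openin_subopen) blast
qed

lemma filterlim_nb_finite:
  assumes "(\<phi> \<longlongrightarrow> l) F" "eventually (\<lambda>s. g s = Some (\<phi> s)) F"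
  shows "filterlim g (nb (Some l)) F"
  unfolding filterlim_iff eventually_nb_Some
proof (intro allI impI)
  fix P assume "\<forall>\<^sub>F s in nhds l. P (Some s)"
  then have "\<forall>\<^sub>F s in F. P (Some (\<phi> s))"
    using assms(1) by (auto simp: filterlim_iff)
  with assms(2) show "\<forall>\<^sub>F s in F. P (g s)" by eventually_elim simp
qed

lemma filterlim_nb_None:
  fixes g :: "'a \<Rightarrow> real option"
  assumes "\<And>B. eventually (\<lambda>s. \<forall>x. g s = Some x \<longrightarrow> B < \<bar>x\<bar>) F"
  shows "filterlim g (nb None) F"
  unfolding filterlim_iff eventually_nb_None
proof (intro allI impI)
  fix P :: "real option \<Rightarrow> bool"
  assume P: "P None \<and> (\<forall>\<^sub>F s in at_infinity. P (Some s))"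
  then obtain B where B: "\<And>s. B \<le> \<bar>s\<bar> \<Longrightarrow> P (Some s)"
    by (auto simp: eventually_at_infinity)
  show "\<forall>\<^sub>F s in F. P (g s)"
    using assms[of B]
  proof eventually_elim
    case (elim s)
    then show ?case using B P by (cases "g s") (auto simp: less_imp_le)
  qed
qed

lemma filterlim_nb_at_None:
  "filterlim g F (nb None) \<longleftrightarrow>
     (\<forall>P. eventually P F \<longrightarrow> P (g None)) \<and> filterlim (\<lambda>s. g (Some s)) F at_infinity"
  by (auto simp: filterlim_iff eventually_nb_None)

lemma filterlim_nb_at_Some:
  "filterlim g F (nb (Some x)) \<longleftrightarrow> filterlim (\<lambda>s. g (Some s)) F (nhds x)"
  by (auto simp: filterlim_iff eventually_nb_Some)

lemma nb_mem: "eventually P (nb z) \<Longrightarrow> P z"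
  by (cases z) (auto simp: eventually_nb_Some eventually_nb_None dest: eventually_nhds_x_imp_x)

lemma emoebius_nb:
  assumes "a * d - b * c \<noteq> 0"
  shows "filterlim (emoebius a b c d) (nb (emoebius a b c d z)) (nb z)"
proof (cases z)
  case (Some x)
  show ?thesis
  proof (cases "c * x + d = 0")
    case False
    have t: "((\<lambda>s. (a * s + b) / (c * s + d)) \<longlongrightarrow> (a * x + b) / (c * x + d)) (nhds x)"
      using False by (intro tendsto_intros filterlim_ident) auto
    have "((\<lambda>s. c * s + d) \<longlongrightarrow> c * x + d) (nhds x)"
      by (intro tendsto_intros filterlim_ident)
    then have "\<forall>\<^sub>F s in nhds x. c * s + d \<noteq> 0"
      using False by (rule tendsto_imp_eventually_ne)
    then have e: "\<forall>\<^sub>F s in nhds x. emoebius a b c d (Some s) = Some ((a * s + b) / (c * s + d))"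
      by eventually_elim (simp add: emoebius_def)
    show ?thesis
      using filterlim_nb_finite[OF t e] False Some
      by (simp add: filterlim_nb_at_Some) (simp add: emoebius_def)
  next
    case True
    then have n: "a * x + b \<noteq> 0"
    proof -
      have "a * (c * x + d) - c * (a * x + b) \<noteq> 0" using assms by (simp add: algebra_simps)
      then show ?thesis using True by auto
    qed
    have "filterlim (\<lambda>s. emoebius a b c d (Some s)) (nb None) (nhds x)"
    proof (rule filterlim_nb_None)
      fix B :: real
      define e where "e = \<bar>a * x + b\<bar> / 2"
      define B' where "B' = \<bar>B\<bar> + 1"
      have "e > 0" "B' > 0" using n by (auto simp: e_def B'_def)
      have "((\<lambda>s. \<bar>a * s + b\<bar>) \<longlongrightarrow> \<bar>a * x + b\<bar>) (nhds x)"
        by (intro tendsto_intros filterlim_ident)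
      moreover have "e < \<bar>a * x + b\<bar>" using n by (simp add: e_def)
      ultimately have 1: "\<forall>\<^sub>F s in nhds x. e < \<bar>a * s + b\<bar>" by (rule order_tendstoD)
      have "((\<lambda>s. \<bar>c * s + d\<bar>) \<longlongrightarrow> \<bar>c * x + d\<bar>) (nhds x)"
        by (intro tendsto_intros filterlim_ident)
      moreover have "\<bar>c * x + d\<bar> < e / B'" using True \<open>e > 0\<close> \<open>B' > 0\<close> by simp
      ultimately have 2: "\<forall>\<^sub>F s in nhds x. \<bar>c * s + d\<bar> < e / B'" by (rule order_tendstoD)
      from 1 2 show "\<forall>\<^sub>F s in nhds x. \<forall>y. emoebius a b c d (Some s) = Some y \<longrightarrow> B < \<bar>y\<bar>"
      proof eventually_elim
        case (elim s)
        show ?case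
        proof (intro allI impI)
          fix y assume "emoebius a b c d (Some s) = Some y"
          then have nz: "c * s + d \<noteq> 0" and y: "y = (a * s + b) / (c * s + d)"
            by (auto simp: emoebius_def split: if_splits)
          have "B' * \<bar>c * s + d\<bar> < e" using elim(2) \<open>B' > 0\<close> by (simp add: field_simps)
          then have "B' * \<bar>c * s + d\<bar> < \<bar>a * s + b\<bar>" using elim(1) by linarith
          then have "B' < \<bar>y\<bar>" using nz by (simp add: y abs_divide field_simps)
          then show "B < \<bar>y\<bar>" by (simp add: B'_def)
        qed
      qed
    qed
    then show ?thesis using True Some by (simp add: filterlim_nb_at_Some) (simp add: emoebius_def)
  qed
next
  case None
  show ?thesis
  proof (cases "c = 0")
    case True
    then have "a \<noteq> 0" "d \<noteq> 0" using assms by auto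
    have "filterlim (\<lambda>s. emoebius a b c d (Some s)) (nb None) at_infinity"
    proof (rule filterlim_nb_None)
      fix B :: real
      show "\<forall>\<^sub>F s in at_infinity. \<forall>y. emoebius a b c d (Some s) = Some y \<longrightarrow> B < \<bar>y\<bar>"
        unfolding eventually_at_infinity
      proof (intro exI allI impI)
        fix s y :: real
        assume s: "((\<bar>B\<bar> + 1) * \<bar>d\<bar> + \<bar>b\<bar>) / \<bar>a\<bar> \<le> norm s"
          and "emoebius a b c d (Some s) = Some y"
        then have y: "y = (a * s + b) / d" using True \<open>d \<noteq> 0\<close> by (auto simp: emoebius_def)
        have "(\<bar>B\<bar> + 1) * \<bar>d\<bar> + \<bar>b\<bar> \<le> \<bar>a * s\<bar>"
          using s \<open>a \<noteq> 0\<close> by (simp add: field_simps abs_mult)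
        then have "(\<bar>B\<bar> + 1) * \<bar>d\<bar> \<le> \<bar>a * s + b\<bar>" by linarith
        then have "\<bar>B\<bar> + 1 \<le> \<bar>y\<bar>" using \<open>d \<noteq> 0\<close> by (simp add: y abs_divide field_simps)
        then show "B < \<bar>y\<bar>" by linarith
      qed
    qed
    moreover have "emoebius a b c d None = None" using True by (simp add: emoebius_def)
    ultimately show ?thesis
      unfolding None filterlim_nb_at_None by (auto simp: eventually_nb_None)
  next
    case False
    have i: "filterlim (\<lambda>s. c * s + d) at_infinity at_infinity"
      using False
      by (intro tendsto_add_filterlim_at_infinity'[OF _ tendsto_const]
          tendsto_mult_filterlim_at_infinity[OF tendsto_const] filterlim_ident)
    have "((\<lambda>s. a / c + (b - a * d / c) / (c * s + d)) \<longlongrightarrow> a / c + 0) at_infinity"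
      by (intro tendsto_add tendsto_const tendsto_divide_0[OF tendsto_const i])
    then have t: "((\<lambda>s. a / c + (b - a * d / c) / (c * s + d)) \<longlongrightarrow> a / c) at_infinity" by simp
    have "\<forall>\<^sub>F s in at_infinity. c * s + d \<noteq> 0"
      using i eventually_not_equal_at_infinity[of 0] by (auto simp: filterlim_iff)
    then have "\<forall>\<^sub>F s in at_infinity.
        emoebius a b c d (Some s) = Some (a / c + (b - a * d / c) / (c * s + d))"
    proof eventually_elim
      case (elim s)
      have "a / c + (b - a * d / c) / (c * s + d) =
          (a / c * (c * s + d) + (b - a * d / c)) / (c * s + d)"
        using elim by (simp add: add_divide_distrib)
      also have "a / c * (c * s + d) + (b - a * d / c) = a * s + b"
        using False by (simp add: distrib_left)
      finally show ?case using elim by (simp add: emoebius_def)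
    qed
    from filterlim_nb_finite[OF t this]
    have "filterlim (\<lambda>s. emoebius a b c d (Some s)) (nb (emoebius a b c d None)) at_infinity"
      using False by (simp add: emoebius_def)
    then show ?thesis
      unfolding None filterlim_nb_at_None by (intro conjI allI impI) (erule nb_mem)
  qed
qed

lemma emult_commute: "emult z w = emult w z"
  by (auto simp: emult_def split: option.splits)

lemma emult_nb_None:
  assumes "w \<noteq> Some 0"
  shows "filterlim (\<lambda>q. emult (fst q) (snd q)) (nb None) (nb None \<times>\<^sub>F nb w)"
proof (rule filterlim_nb_None)
  fix B :: real
  define e where "e = (case w of None \<Rightarrow> 1 | Some y \<Rightarrow> \<bar>y\<bar> / 2)"
  have "e > 0" using assms by (auto simp: e_def split: option.splits)
  have 1: "eventually (\<lambda>z. \<forall>x. z = Some x \<longrightarrow> (\<bar>B\<bar> + 1) / e \<le> \<bar>x\<bar>) (nb None)"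
    unfolding eventually_nb_None by (auto simp: eventually_at_infinity)
  have 2: "eventually (\<lambda>z. \<forall>y. z = Some y \<longrightarrow> e < \<bar>y\<bar>) (nb w)"
  proof (cases w)
    case None
    show ?thesis unfolding None eventually_nb_None
      by (auto simp: eventually_at_infinity intro!: exI[of _ "e + 1"])
  next
    case (Some y)
    have "((\<lambda>s. \<bar>s\<bar>) \<longlongrightarrow> \<bar>y\<bar>) (nhds y)" by (intro tendsto_intros filterlim_ident)
    moreover have "e < \<bar>y\<bar>" using Some assms by (simp add: e_def)
    ultimately have "\<forall>\<^sub>F s in nhds y. e < \<bar>s\<bar>" by (rule order_tendstoD)
    then show ?thesis by (simp add: Some eventually_nb_Some)
  qed
  have "B < \<bar>x * y\<bar>" if "(\<bar>B\<bar> + 1) / e \<le> \<bar>x\<bar>" "e < \<bar>y\<bar>" for x y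
  proof -
    have "(\<bar>B\<bar> + 1) / e * e \<le> \<bar>x\<bar> * \<bar>y\<bar>" using that \<open>e > 0\<close> by (intro mult_mono) auto
    then show ?thesis using \<open>e > 0\<close> by (simp add: abs_mult)
  qed
  then show "\<forall>\<^sub>F s in nb None \<times>\<^sub>F nb w.
      \<forall>x. emult (fst s) (snd s) = Some x \<longrightarrow> B < \<bar>x\<bar>"
    unfolding eventually_prod_filter
    using 1 2
    by (intro exI[of _ "\<lambda>z. \<forall>x. z = Some x \<longrightarrow> (\<bar>B\<bar> + 1) / e \<le> \<bar>x\<bar>"]
        exI[of _ "\<lambda>z. \<forall>y. z = Some y \<longrightarrow> e < \<bar>y\<bar>"])
      (auto simp: emult_def split: option.splits)
qed

lemma emult_nb:
  assumes "\<not> (z = None \<and> w = Some 0)" "\<not> (z = Some 0 \<and> w = None)"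
  shows "filterlim (\<lambda>q. emult (fst q) (snd q)) (nb (emult z w)) (nb z \<times>\<^sub>F nb w)"
proof -
  consider "z = None" | "w = None" | x y where "z = Some x" "w = Some y"
    by (cases z; cases w) auto
  then show ?thesis
  proof cases
    case 1
    then show ?thesis using emult_nb_None[of w] assms by (simp add: emult_def)
  next
    case 2
    have "filterlim (\<lambda>q. emult (fst q) (snd q)) (nb None) (nb w \<times>\<^sub>F nb z)"
      using emult_nb_None[of z] assms 2 by auto
    from filterlim_compose[OF this filterlim_Pair[OF filterlim_snd filterlim_fst]]
    have "filterlim (\<lambda>q. emult (snd q) (fst q)) (nb None) (nb z \<times>\<^sub>F nb w)" by simp
    moreover have "emult z w = None" using 2 by (simp add: emult_def split: option.splits)
    ultimately show ?thesis by (simp add: emult_commute)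
  next
    case 3
    have "((\<lambda>q. fst q * snd q) \<longlongrightarrow> x * y) (nhds x \<times>\<^sub>F nhds y)"
      by (rule tendsto_mult[OF filterlim_fst filterlim_snd])
    from filterlim_nb_finite[OF this, of "\<lambda>q. Some (fst q * snd q)"]
    have "filterlim (\<lambda>q. emult (Some (fst q)) (Some (snd q))) (nb (Some (x * y)))
        (nhds x \<times>\<^sub>F nhds y)" by (simp add: emult_def)
    then show ?thesis
      using 3 by (simp add: nb_def prod_filtermap1 prod_filtermap2 filterlim_filtermap emult_def)
  qed
qed

lemma continuous_map_f_ext:
  "continuous_map (subtopology eplane_top (- Ind_f)) eplane_top f_ext"
proof -
  have "continuous_map (subtopology eplane_top (- Ind_f)) circle_top
      (\<lambda>p. emult (snd p) (emoebius 1 3 1 (-1) (fst p)))"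
  proof (rule continuous_map_eplane_circle)
    fix p assume p: "p \<in> - Ind_f"
    have 1: "filterlim (\<lambda>q. emoebius 1 3 1 (-1) (fst q)) (nb (emoebius 1 3 1 (-1) (fst p)))
        (nb (fst p) \<times>\<^sub>F nb (snd p))"
      by (rule filterlim_compose[OF emoebius_nb filterlim_fst]) simp
    have 2: "filterlim (\<lambda>q. emult (fst q) (snd q)) (nb (emult (snd p) (emoebius 1 3 1 (-1) (fst p))))
        (nb (snd p) \<times>\<^sub>F nb (emoebius 1 3 1 (-1) (fst p)))"
      using p by (intro emult_nb; cases p)
        (auto simp: Ind_f_def emoebius_def split: option.splits if_splits)
    show "filterlim (\<lambda>p. emult (snd p) (emoebius 1 3 1 (-1) (fst p)))
        (nb (emult (snd p) (emoebius 1 3 1 (-1) (fst p)))) (nb (fst p) \<times>\<^sub>F nb (snd p))"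
      using filterlim_compose[OF 2 filterlim_Pair[OF filterlim_snd 1]] by simp
  qed
  moreover have "continuous_map (subtopology eplane_top (- Ind_f)) circle_top
      (\<lambda>p. emoebius 1 2 0 1 (fst p))"
    by (rule continuous_map_eplane_circle, rule filterlim_compose[OF emoebius_nb filterlim_fst]) simp
  ultimately show ?thesis
    by (simp add: continuous_map_pairwise o_def f_ext_def)
qed

lemma continuous_map_finv_ext:
  "continuous_map (subtopology eplane_top (- Ind_finv)) eplane_top finv_ext"
proof -
  have "continuous_map (subtopology eplane_top (- Ind_finv)) circle_top
      (\<lambda>p. emult (fst p) (emoebius 1 (-3) 1 1 (snd p)))"
  proof (rule continuous_map_eplane_circle)
    fix p assume p: "p \<in> - Ind_finv"
    have 1: "filterlim (\<lambda>q. emoebius 1 (-3) 1 1 (snd q)) (nb (emoebius 1 (-3) 1 1 (snd p)))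
        (nb (fst p) \<times>\<^sub>F nb (snd p))"
      by (rule filterlim_compose[OF emoebius_nb filterlim_snd]) simp
    have 2: "filterlim (\<lambda>q. emult (fst q) (snd q)) (nb (emult (fst p) (emoebius 1 (-3) 1 1 (snd p))))
        (nb (fst p) \<times>\<^sub>F nb (emoebius 1 (-3) 1 1 (snd p)))"
      using p by (intro emult_nb; cases p)
        (auto simp: Ind_finv_def emoebius_def split: option.splits if_splits)
    show "filterlim (\<lambda>p. emult (fst p) (emoebius 1 (-3) 1 1 (snd p)))
        (nb (emult (fst p) (emoebius 1 (-3) 1 1 (snd p)))) (nb (fst p) \<times>\<^sub>F nb (snd p))"
      using filterlim_compose[OF 2 filterlim_Pair[OF filterlim_fst 1]] by simp
  qed
  moreover have "continuous_map (subtopology eplane_top (- Ind_finv)) circle_top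
      (\<lambda>p. emoebius 1 (-2) 0 1 (snd p))"
    by (rule continuous_map_eplane_circle, rule filterlim_compose[OF emoebius_nb filterlim_snd]) simp
  ultimately show ?thesis
    by (simp add: continuous_map_pairwise o_def finv_ext_def)
qed

end

theory Submission
  imports Defs "HOL-Complex_Analysis.Complex_Analysis" "HOL-Real_Asymp.Real_Asymp"
begin

text \<open>With \<open>x = 2 v\<^sub>n - 1\<close> and \<open>y = 2 v\<^sub>n\<^sub>-\<^sub>1 + 1\<close> the map becomes the recurrence
  \<open>v\<^sub>n\<^sub>+\<^sub>1 (v\<^sub>n - 1) = v\<^sub>n + v\<^sub>n\<^sub>-\<^sub>1 + v\<^sub>n v\<^sub>n\<^sub>-\<^sub>1\<close> with fixed point 0. Sign and growth arguments show that 0 is its only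
  bounded two-sided solution.

  The third iterate is tangent to the identity at the fixed point, and a solution tending to 0
  eventually has the periodic sign pattern (+, -, -). For the pairs of negative terms,
  \<open>(-1 / (x - 1), -1 / (x + 1))\<close> is an approximate orbit under \<open>x \<mapsto> x + 3\<close>; its backward
  iterates converge on a complex half plane to an exact, hence analytic, invariant curve. Three forward
  steps expand the difference of two solutions with the same sum of consecutive terms, so that every
  solution tending to 0 lies on this curve or is 0. A cone field keeps the curve monotone as long as its
  coordinates exceed -1, which permits normalising it to reach -1 at parameter 0.

  Backward iteration continues the curve. It meets the critical lines \<open>v = 1\<close> and \<open>v = -1\<close>
  transversally, through an indeterminacy point, at one parameter for each of the residues modulo 3;
  beyond that parameter it remains in a region that is invariant under backward steps, so the curve
  stays regular and simple, and the three continued curves meet in the finite plane only at the fixed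
  point. The involution \<open>(x, y) \<mapsto> (-y, -x)\<close> conjugates the map with its inverse and turns the
  stable curves into the unstable ones.\<close>

section \<open>The inverse step near the origin\<close>

text \<open>The linear part of the recurrence, v_{n+1} = -v_n - v_{n-1}, has order three, so there
  is no hyperbolicity from which to build a stable manifold: attraction is due to the quadratic
  terms and the solutions decay only like 1/x. A backward triple step at parameter x multiplies
  errors by about 1 + 6/x; over steps of length 3 this accumulates to a factor of order x^2, so an
  approximate curve is useful only if its residual decays faster than x^-3. The one chosen here has
  residual of order x^-4. The complex half plane serves twice: uniform limits stay holomorphic, and
  Cauchy's estimate turns bounds on values into bounds on derivatives, on which monotonicity,
  uniqueness and the tangent vectors rest. Globally the obstacle is that the inverse map contracts
  the lines \<open>v = 1\<close> and \<open>v = -1\<close> to points. The image of a curve that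
  crosses such a line stays regular only if the crossing is transversal, so the signs of all
  derivatives have to be carried along until the last of these lines has been passed.\<close>

definition bk :: "'a::field \<Rightarrow> 'a \<Rightarrow> 'a" where
  "bk p q = (p * q - p - q) / (1 + p)"

text \<open>\<open>bk p q\<close> is the term in front of p, q, so that a, b, c, d, e are
  consecutive terms and the pair \<open>(d, e)\<close> is pulled back to \<open>(a, b)\<close>. The
  field is left open: complex numbers serve the construction, real numbers the dynamics.\<close>

definition back3 :: "'a::field \<times> 'a \<Rightarrow> 'a \<times> 'a" where
  "back3 s = (let c = bk (fst s) (snd s); b = bk c (fst s) in (bk b c, b))"

text \<open>In this implicit form every term is linear or bilinear and no denominator remains; the
  product containing \<open>bk p q\<close> itself is absorbed by an a priori bound.\<close>

lemma bk_eq: "1 + p \<noteq> 0 \<Longrightarrow> bk p q = p * q - p - q - bk p q * p"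
  for p q :: "'a::field"
  by (simp add: bk_def field_simps)

lemma bound_add: "norm x \<le> X \<Longrightarrow> norm y \<le> Y \<Longrightarrow> norm (x + y) \<le> X + Y"
  for x y :: "'a::real_normed_vector"
  by (rule norm_triangle_mono)

lemma bound_diff: "norm x \<le> X \<Longrightarrow> norm y \<le> Y \<Longrightarrow> norm (x - y) \<le> X + Y"
  for x y :: "'a::real_normed_vector"
  using norm_triangle_ineq4[of x y] by linarith

lemma bound_mult: "norm x \<le> X \<Longrightarrow> norm y \<le> Y \<Longrightarrow> norm (x * y) \<le> X * Y"
  for x y :: "'a::real_normed_algebra"
  by (meson norm_mult_ineq norm_ge_zero mult_mono order_trans)

lemma bound_2mult: "norm x \<le> X \<Longrightarrow> norm (2 * x) \<le> 2 * X"
  for x :: "'a::real_normed_field"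
  by (simp add: norm_mult)

text \<open>Structural rules: \<open>intro bounds\<close> descends through an expression, so the
  numerical bounds stated below follow the expressions term by term.\<close>

lemmas bounds = bound_add bound_diff bound_2mult bound_mult

lemma bound_of_near:
  fixes x w :: "'a::real_normed_vector"
  assumes "norm w \<le> h" "norm (x + w) \<le> e"
  shows "norm x \<le> h + e"
  using assms norm_triangle_ineq4[of "x + w" w] by simp

lemma norm_one_plus_ge:
  fixes p :: "'a::real_normed_field"
  assumes "norm p \<le> 1/10"
  shows "norm (1 + p) \<ge> 9/10"
  using norm_diff_ineq[of 1 p] assms by simp

text \<open>The linear part sends (-w, -w) to c = 2 w, b = -w, a = -w, and all else is quadratic, so
  every step adds an error of order \<open>h^2\<close>. The constants 14, 25, 44 are the sums of
  these contributions, rounded up. In the application w = 1/y and h = 1/Re y.\<close>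

lemma back3_near:
  fixes d e w :: "'a::real_normed_field"
  assumes h: "0 < h" "h \<le> 1/1000" and w: "norm w \<le> h"
    and d: "norm (d + w) \<le> 5 * h^2" and e: "norm (e + w) \<le> 5 * h^2"
  defines "c \<equiv> bk d e"
  defines "b \<equiv> bk c d"
  defines "a \<equiv> bk b c"
  shows "norm (c - 2 * w) \<le> 14 * h^2" "norm (b + w) \<le> 25 * h^2" "norm (a + w) \<le> 44 * h^2"
    "1 + d \<noteq> 0" "1 + c \<noteq> 0" "1 + b \<noteq> 0"
proof -
  have hh: "h^2 \<le> h / 1000" using h by (simp add: power2_eq_square)
  have hp: "0 < h^2" using h by simp
  have nd: "norm d \<le> 101/100 * h" using bound_of_near[OF w d] hh h by simp
  have ne: "norm e \<le> 101/100 * h" using bound_of_near[OF w e] hh h by simp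
  have d1: "norm (1 + d) \<ge> 9/10" using nd h by (intro norm_one_plus_ge) simp
  then show d0: "1 + d \<noteq> 0" by auto
  have q: "x / y \<le> 10/9 * x'" if "y \<ge> 9/10" "0 \<le> x" "x \<le> x'" for x y x' :: real
  proof -
    have "x / y \<le> x / (9/10)" using that by (intro divide_left_mono) auto
    then show ?thesis using that by simp
  qed
  have "norm (d * e - d - e) \<le> (101/100 * h) * (101/100 * h) + 101/100 * h + 101/100 * h"
    by (intro bounds nd ne)
  then have "norm (d * e - d - e) \<le> 21/10 * h" using hh[unfolded power2_eq_square] h by linarith
  then have nc: "norm c \<le> 7/3 * h" using q[OF d1 norm_ge_zero]
    unfolding c_def bk_def norm_divide by fastforce
  have ce: "c - 2 * w = d * e - (d + w) - (e + w) - c * d"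
    using bk_eq[OF d0, of e] unfolding c_def[symmetric] by (simp add: algebra_simps)
  have "norm (c - 2 * w) \<le> (101/100 * h) * (101/100 * h) + 5 * h^2 + 5 * h^2 + (7/3 * h) * (101/100 * h)"
    unfolding ce by (intro bounds nd ne nc d e)
  then show c: "norm (c - 2 * w) \<le> 14 * h^2" using hp by (simp add: power2_eq_square)
  have c1: "norm (1 + c) \<ge> 9/10" using nc h by (intro norm_one_plus_ge) simp
  then show c0: "1 + c \<noteq> 0" by auto
  have "norm (c * d - (c - 2 * w) - (d + w) - w) \<le> (7/3 * h) * (101/100 * h) + 14 * h^2 + 5 * h^2 + h"
    by (intro bounds nd ne nc d e w c)
  moreover have "norm (c * d - (c - 2 * w) - (d + w) - w) = norm (c * d - c - d)" by (rule arg_cong) simp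
  ultimately have "norm (c * d - c - d) \<le> 11/10 * h"
    using hh[unfolded power2_eq_square] h unfolding power2_eq_square by linarith
  then have nb: "norm b \<le> 5/4 * h" using q[OF c1 norm_ge_zero] h
    unfolding b_def bk_def norm_divide by fastforce
  have be: "b + w = c * d - (c - 2 * w) - (d + w) - b * c"
    using bk_eq[OF c0, of d] unfolding b_def[symmetric] by (simp add: algebra_simps)
  have "norm (b + w) \<le> (7/3 * h) * (101/100 * h) + 14 * h^2 + 5 * h^2 + (5/4 * h) * (7/3 * h)"
    unfolding be by (intro bounds nd ne nc d e c nb)
  then show b: "norm (b + w) \<le> 25 * h^2" using hp by (simp add: power2_eq_square)
  have b1: "norm (1 + b) \<ge> 9/10" using nb h by (intro norm_one_plus_ge) simp
  then show b0: "1 + b \<noteq> 0" by auto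
  have "norm (b * c - (b + w) - (c - 2 * w) - w) \<le> (5/4 * h) * (7/3 * h) + 25 * h^2 + 14 * h^2 + h"
    by (intro bounds nd ne nc d e w c b nb)
  moreover have "norm (b * c - (b + w) - (c - 2 * w) - w) = norm (b * c - b - c)" by (rule arg_cong) simp
  ultimately have "norm (b * c - b - c) \<le> 11/10 * h"
    using hh[unfolded power2_eq_square] h unfolding power2_eq_square by linarith
  then have na: "norm a \<le> 5/4 * h" using q[OF b1 norm_ge_zero] h
    unfolding a_def bk_def norm_divide by fastforce
  have ae: "a + w = b * c - (b + w) - (c - 2 * w) - a * b"
    using bk_eq[OF b0, of c] unfolding a_def[symmetric] by (simp add: algebra_simps)
  have "norm (a + w) \<le> (5/4 * h) * (7/3 * h) + 25 * h^2 + 14 * h^2 + (5/4 * h) * (5/4 * h)"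
    unfolding ae by (intro bounds nd ne nc d e c nb na b)
  then show "norm (a + w) \<le> 44 * h^2" using hp by (simp add: power2_eq_square)
qed

text \<open>All the relations between consecutive terms are bilinear, so a difference of two orbits
  satisfies a linear relation whose coefficients are the means of the two orbits.\<close>

lemma mean_bound:
  fixes x y u :: "'a::real_normed_field"
  assumes "norm (x - u) \<le> e" "norm (y - u) \<le> e"
  shows "norm ((x + y) / 2 - u) \<le> e"
proof -
  have "(x + y) / 2 - u = ((x - u) + (y - u)) / 2" by (simp add: field_simps)
  moreover have "norm ((x - u) + (y - u)) \<le> e + e" by (intro bounds assms)
  ultimately show ?thesis by (simp only: norm_divide) simp
qed

text \<open>Since the linear part has order three, the differences \<open>da - dd\<close> and
  \<open>db - de\<close> have no terms of order 0 in h. Their leading terms are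
  \<open>6 * (w * de)\<close> and \<open>6 * (w * dd)\<close>; the 7 leaves room for the terms of
  order \<open>h^2\<close>.\<close>

lemma back3_lipschitz:
  fixes d e d' e' w :: "'a::real_normed_field"
  assumes h: "0 < h" "h \<le> 1/1000" and w: "norm w \<le> h"
    and d: "norm (d + w) \<le> 5 * h^2" and e: "norm (e + w) \<le> 5 * h^2"
    and d': "norm (d' + w) \<le> 5 * h^2" and e': "norm (e' + w) \<le> 5 * h^2"
    and M: "norm (d - d') \<le> M" "norm (e - e') \<le> M"
  shows "norm (fst (back3 (d, e)) - fst (back3 (d', e'))) \<le> (1 + 7 * h) * M"
    "norm (snd (back3 (d, e)) - snd (back3 (d', e'))) \<le> (1 + 7 * h) * M"
proof -
  define c b a where "c = bk d e" and "b = bk c d" and "a = bk b c"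
  define c' b' a' where "c' = bk d' e'" and "b' = bk c' d'" and "a' = bk b' c'"
  note near = back3_near[OF h w d e, folded c_def, folded b_def, folded a_def]
  note near' = back3_near[OF h w d' e', folded c'_def, folded b'_def, folded a'_def]
  have c: "c = d * e - d - e - c * d" using bk_eq[OF near(4), of e] by (simp add: c_def)
  have c': "c' = d' * e' - d' - e' - c' * d'" using bk_eq[OF near'(4), of e'] by (simp add: c'_def)
  have b: "b = c * d - c - d - b * c" using bk_eq[OF near(5), of d] by (simp add: b_def)
  have b': "b' = c' * d' - c' - d' - b' * c'" using bk_eq[OF near'(5), of d'] by (simp add: b'_def)
  have a: "a = b * c - b - c - a * b" using bk_eq[OF near(6), of c] by (simp add: a_def)
  have a': "a' = b' * c' - b' - c' - a' * b'" using bk_eq[OF near'(6), of c'] by (simp add: a'_def)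
  \<comment> \<open>Deviations of the means from the linear values -w, 2 w, -w; these deviations are
    of order \<open>h^2\<close>.\<close>
  define ma mb mc md me where "ma = (a + a') / 2 + w" and "mb = (b + b') / 2 + w"
    and "mc = (c + c') / 2 - 2 * w" and "md = (d + d') / 2 + w" and "me = (e + e') / 2 + w"
  define da db dc dd de where "da = a - a'" and "db = b - b'"
    and "dc = c - c'" and "dd = d - d'" and "de = e - e'"
  have hh: "h^2 \<le> h / 1000" using h by (simp add: power2_eq_square)
  have hp: "0 < h^2" using h by simp
  have M0: "0 \<le> M" using M norm_ge_zero order_trans by blast
  have Mh: "h * h * M \<le> h * M / 1000" "0 \<le> h * M" "0 \<le> h * h * M" "h * M \<le> M / 1000"
      "h * h * h * M \<le> h * h * M / 1000"
    using mult_right_mono[OF hh M0] h M0 mult_right_mono[OF h(2) M0]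
      mult_right_mono[OF hh, of "h * M"]
    by (simp_all add: power2_eq_square mult.assoc)
  have mb1: "norm md \<le> 5 * h^2" "norm me \<le> 5 * h^2" "norm mc \<le> 14 * h^2" "norm mb \<le> 25 * h^2"
      "norm ma \<le> 44 * h^2"
    using mean_bound[of d "-w" _ d'] mean_bound[of e "-w" _ e'] mean_bound[of c "2*w" _ c']
      mean_bound[of b "-w" _ b'] mean_bound[of a "-w" _ a'] d d' e e' near near'
    unfolding ma_def mb_def mc_def md_def me_def by auto
  have nm: "norm (md - w) \<le> 11/10 * h" "norm (me - w) \<le> 11/10 * h" "norm (mc + 2 * w) \<le> 22/10 * h"
      "norm (mb - w) \<le> 11/10 * h" "norm (ma - w) \<le> 11/10 * h"
    using bound_diff[OF mb1(1) w] bound_diff[OF mb1(2) w] bound_add[OF mb1(3) bound_2mult[OF w]]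
      bound_diff[OF mb1(4) w] bound_diff[OF mb1(5) w] hh h by auto
  have ndd: "norm dd \<le> M" and nde: "norm de \<le> M" using M by (auto simp: dd_def de_def)
  have id_c: "dc = (md - w) * de + (me - w) * dd - dd - de - (mc + 2 * w) * dd - (md - w) * dc"
    using c c' unfolding md_def me_def mc_def da_def db_def dc_def dd_def de_def
    by (simp add: field_simps) algebra
  have id_b: "db - de = 2 * ((mc + 2*w) * dd) + 2 * ((md - w) * dc) - (mb - w) * dc - (mc + 2*w) * db
      - (me - w) * dd - (md - w) * de"
    using c c' b b' unfolding mb_def md_def me_def mc_def da_def db_def dc_def dd_def de_def
    by (simp add: field_simps) algebra
  have id_a: "da - dd = 2 * ((mb - w) * dc) + 2 * ((mc + 2*w) * db) - (ma - w) * db - (mb - w) * da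
      - (mc + 2*w) * dd - (md - w) * dc"
    using c c' b b' a a' unfolding ma_def mb_def md_def me_def mc_def da_def db_def dc_def dd_def de_def
    by (simp add: field_simps) algebra
  \<comment> \<open>Bootstrap: the unknown norm also occurs on the right, but with a factor of order
    h, and can be absorbed. The crude bound is then inserted into the next identity.\<close>
  have "norm dc \<le> 11/10 * h * M + 11/10 * h * M + M + M + 22/10 * h * M + 11/10 * h * norm dc"
    by (subst id_c) (intro bounds nm ndd nde order_refl)
  moreover have "h * norm dc \<le> 1/1000 * norm dc" using h by (intro mult_right_mono) auto
  ultimately have ndc: "norm dc \<le> 21/10 * M" using Mh M0 by (simp add: algebra_simps)
  have "dc + dd + de = (md - w) * de + (me - w) * dd - (mc + 2 * w) * dd - (md - w) * dc"
    using id_c by (simp add: algebra_simps)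
  moreover have "norm ((md - w) * de + (me - w) * dd - (mc + 2 * w) * dd - (md - w) * dc) \<le>
      11/10 * h * M + 11/10 * h * M + 22/10 * h * M + 11/10 * h * (21/10 * M)"
    by (intro bounds nm ndd nde ndc)
  ultimately have nec: "norm (dc + dd + de) \<le> 7 * (h * M)" using Mh(2) by (simp add: mult_ac)
  have "norm (2 * ((mc + 2*w) * dd) + 2 * ((md - w) * dc) - (mb - w) * dc - (mc + 2*w) * db
      - (me - w) * dd - (md - w) * de) \<le> 2 * (22/10 * h * M) + 2 * (11/10 * h * (21/10 * M))
      + 11/10 * h * (21/10 * M) + 22/10 * h * norm db + 11/10 * h * M + 11/10 * h * M"
    by (intro bounds nm ndd nde ndc order_refl)
  then have ndb0: "norm (db - de) \<le> 14 * (h * M) + 22/10 * h * norm db"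
    unfolding id_b using Mh(2) by (simp add: mult_ac)
  have "norm db \<le> M + norm (db - de)"
    using norm_triangle_ineq[of de "db - de"] nde by simp
  moreover have "h * norm db \<le> 1/1000 * norm db" using h by (intro mult_right_mono) auto
  ultimately have ndb: "norm db \<le> 11/10 * M" using Mh M0 ndb0 by (simp add: algebra_simps)
  have "h * norm db \<le> h * (11/10 * M)" using h ndb by (intro mult_left_mono) auto
  then have neb: "norm (db - de) \<le> 17 * (h * M)" using ndb0 Mh(2) by (simp add: mult_ac)
  \<comment> \<open>Apart from the leading term, every product now has a factor w against a quantity
    already known to be of order h M, or a mean of order \<open>h^2\<close>.\<close>
  have eqb: "db - de = 6 * (w * dd) - w * (dc + dd + de) - 2 * (w * (db - de))
      + 2 * (mc * dd) + 2 * (md * dc) - mb * dc - mc * db - me * dd - md * de"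
    using id_b by (simp add: algebra_simps)
  have Nb: "norm (6 * (w * dd) - w * (dc + dd + de) - 2 * (w * (db - de))
      + 2 * (mc * dd) + 2 * (md * dc) - mb * dc - mc * db - me * dd - md * de) \<le>
      6 * (h * M) + h * (7 * (h * M)) + 2 * (h * (17 * (h * M))) + 2 * (14 * h^2 * M)
      + 2 * (5 * h^2 * (21/10 * M)) + 25 * h^2 * (21/10 * M) + 14 * h^2 * (11/10 * M)
      + 5 * h^2 * M + 5 * h^2 * M"
    by (intro bounds mb1 ndd nde ndc w nec neb ndb order_refl)
      (use bound_mult[OF w ndd] in \<open>simp add: norm_mult\<close>)
  have fb: "norm (db - de) \<le> 6 * (h * M) + 300 * (h * h * M)"
    by (rule ord_eq_le_trans[OF arg_cong[OF eqb, of norm] order_trans[OF Nb]])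
      (use Mh(3) in \<open>simp add: power2_eq_square mult_ac\<close>)
  show "norm (snd (back3 (d, e)) - snd (back3 (d', e'))) \<le> (1 + 7 * h) * M"
  proof -
    have "norm db \<le> M + norm (db - de)"
      using norm_triangle_ineq[of de "db - de"] nde by simp
    then have "norm db \<le> (1 + 7 * h) * M" using fb Mh by (simp add: distrib_right)
    then show ?thesis by (simp add: db_def b_def b'_def c_def c'_def back3_def Let_def)
  qed
  have "norm (2 * ((mb - w) * dc) + 2 * ((mc + 2*w) * db) - (ma - w) * db - (mb - w) * da
      - (mc + 2*w) * dd - (md - w) * dc) \<le> 2 * (11/10 * h * (21/10 * M)) + 2 * (22/10 * h * (11/10 * M))
      + 11/10 * h * (11/10 * M) + 11/10 * h * norm da + 22/10 * h * M + 11/10 * h * (21/10 * M)"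
    by (intro bounds nm ndd nde ndc ndb order_refl)
  then have nda0: "norm (da - dd) \<le> 16 * (h * M) + 11/10 * h * norm da"
    unfolding id_a using Mh(2) by (simp add: mult_ac)
  have "norm da \<le> M + norm (da - dd)"
    using norm_triangle_ineq[of dd "da - dd"] ndd by simp
  moreover have "h * norm da \<le> 1/1000 * norm da" using h by (intro mult_right_mono) auto
  ultimately have nda: "norm da \<le> 11/10 * M" using Mh M0 nda0 by (simp add: algebra_simps)
  have "h * norm da \<le> h * (11/10 * M)" using h nda by (intro mult_left_mono) auto
  then have nea: "norm (da - dd) \<le> 18 * (h * M)" using nda0 Mh(2) by (simp add: mult_ac)
  have eqa: "da - dd = 6 * (w * de) - w * (dc + dd + de) + 5 * (w * (db - de)) + w * (da - dd)
      + 2 * (mb * dc) + 2 * (mc * db) - ma * db - mb * da - mc * dd - md * dc"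
    using id_a by (simp add: algebra_simps)
  have Na: "norm (6 * (w * de) - w * (dc + dd + de) + 5 * (w * (db - de)) + w * (da - dd)
      + 2 * (mb * dc) + 2 * (mc * db) - ma * db - mb * da - mc * dd - md * dc) \<le>
      6 * (h * M) + h * (7 * (h * M)) + 5 * (h * (17 * (h * M))) + h * (18 * (h * M))
      + 2 * (25 * h^2 * (21/10 * M)) + 2 * (14 * h^2 * (11/10 * M)) + 44 * h^2 * (11/10 * M)
      + 25 * h^2 * (11/10 * M) + 14 * h^2 * M + 5 * h^2 * (21/10 * M)"
    by (intro bounds mb1 ndd nde ndc w nec neb ndb nea nda order_refl)
      (use bound_mult[OF w nde] bound_mult[OF w neb] in \<open>simp_all add: norm_mult\<close>)
  have fa: "norm (da - dd) \<le> 6 * (h * M) + 500 * (h * h * M)"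
    by (rule ord_eq_le_trans[OF arg_cong[OF eqa, of norm] order_trans[OF Na]])
      (use Mh(3) in \<open>simp add: power2_eq_square mult_ac\<close>)
  show "norm (fst (back3 (d, e)) - fst (back3 (d', e'))) \<le> (1 + 7 * h) * M"
  proof -
    have "norm da \<le> M + norm (da - dd)"
      using norm_triangle_ineq[of dd "da - dd"] ndd by simp
    then have "norm da \<le> (1 + 7 * h) * M" using fa Mh by (simp add: distrib_right)
    then show ?thesis
      by (simp add: da_def a_def a'_def b_def b'_def c_def c'_def back3_def Let_def)
  qed
qed

section \<open>Approximation of the stable curve on a half plane\<close>

text \<open>The shifts by 1 come from matching the terms of order y^-3. With -1/y in both components
  the residual has order y^-3, too large to be summed against the growth of errors under backward
  steps.\<close>

definition ap :: "'a::field \<Rightarrow> 'a \<times> 'a" where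
  "ap y = (- 1 / (y - 1), - 1 / (y + 1))"

text \<open>The three backward steps are carried out exactly on rational functions; numerator and
  denominator of each residual differ in degree by 4.\<close>

lemma ap_residual:
  fixes y :: complex and X :: real
  assumes X: "1000 \<le> X" "X \<le> norm y"
  shows "norm (fst (back3 (ap (y + 3))) - fst (ap y)) \<le> 10 / X^4"
    "norm (snd (back3 (ap (y + 3))) - snd (ap y)) \<le> 10 / X^4"
proof -
  define Y where "Y = norm y"
  have Y: "1000 \<le> Y" using X by (simp add: Y_def)
  have k: "99/100 * Y \<le> norm (y + of_nat k)" if "k \<le> 10" for k
  proof -
    have "norm y - norm (of_nat k :: complex) \<le> norm (y + of_nat k)" by (rule norm_diff_ineq)
    then show ?thesis using that Y unfolding norm_of_nat Y_def[symmetric] by linarith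
  qed
  have y1: "99/100 * Y \<le> norm (y + 1)" and y2: "99/100 * Y \<le> norm (y + 2)"
    and y4: "99/100 * Y \<le> norm (y + 4)" using k[of 1] k[of 2] k[of 4] by auto
  have ym: "99/100 * Y \<le> norm (y - 1)"
    using norm_triangle_ineq2[of y 1] Y unfolding Y_def[symmetric] norm_one by linarith
  have nz: "y + 1 \<noteq> 0" "y + 2 \<noteq> 0" "y + 4 \<noteq> 0" "y - 1 \<noteq> 0" "y \<noteq> 0"
    using y1 y2 y4 ym Y unfolding Y_def by (auto simp del: norm_le_zero_iff)
  \<comment> \<open>\<open>Q\<close> and \<open>R\<close> are the numerators of 1 + c and 1 + b,
    hence the denominators that the second and the third backward step introduce.\<close>
  define Q where "Q = y * y + 7 * y + 11"
  define R where "R = y * y * y + 8 * (y * y) + 17 * y + 5"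
  have Y2: "1000 * Y \<le> Y * Y" and Y3: "1000 * (Y * Y) \<le> Y * Y * Y"
    using Y by (auto intro!: mult_right_mono)
  have "Y * Y - (7 * Y + 11) \<le> norm Q"
  proof -
    have "norm (7 * y + 11) \<le> 7 * Y + 11"
      by (rule bound_add) (auto simp: norm_mult Y_def)
    then show ?thesis
      using norm_diff_ineq[of "y * y" "7 * y + 11"] by (simp add: Q_def norm_mult Y_def add.assoc)
  qed
  then have Q: "98/100 * (Y * Y) \<le> norm Q" using Y Y2 by linarith
  have "Y * Y * Y - (8 * (Y * Y) + 17 * Y + 5) \<le> norm R"
  proof -
    have "norm (8 * (y * y) + 17 * y + 5) \<le> 8 * (Y * Y) + 17 * Y + 5"
      by (intro bound_add) (auto simp: norm_mult Y_def)
    then show ?thesis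
      using norm_diff_ineq[of "y * y * y" "8 * (y * y) + 17 * y + 5"]
      by (simp add: R_def norm_mult Y_def add.assoc)
  qed
  then have R: "98/100 * (Y * Y * Y) \<le> norm R" using Y Y2 Y3 by linarith
  have "0 < Y * Y" "0 < Y * Y * Y" using Y by auto
  then have QR: "Q \<noteq> 0" "R \<noteq> 0" using Q R by auto
  have c: "bk (- 1 / (y + 2)) (- 1 / (y + 4)) = (2 * y + 7) / ((y + 4) * (y + 1))"
  proof -
    have "1 + - 1 / (y + 2) = (y + 1) / (y + 2)" using nz by (simp add: field_simps)
    with nz show ?thesis unfolding bk_def
      apply (simp add: divide_simps)
      apply (simp add: algebra_simps)
      done
  qed
  have b: "bk ((2 * y + 7) / ((y + 4) * (y + 1))) (- 1 / (y + 2)) = - (y * y + 8 * y + 17) / ((y + 2) * Q)"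
  proof -
    have "1 + (2 * y + 7) / ((y + 4) * (y + 1)) = Q / ((y + 4) * (y + 1))"
      using nz
      apply (simp add: divide_simps)
      apply (simp add: algebra_simps Q_def)
      done
    with nz QR show ?thesis unfolding bk_def
      apply (simp add: divide_simps)
      apply (simp add: Q_def algebra_simps)
      done
  qed
  have a: "bk (- (y * y + 8 * y + 17) / ((y + 2) * Q)) ((2 * y + 7) / ((y + 4) * (y + 1))) =
      - (y^4 + 14 * y^3 + 75 * y^2 + 192 * y + 205) / ((y + 1) * (y + 4) * R)"
  proof -
    have "1 + - (y * y + 8 * y + 17) / ((y + 2) * Q) = R / ((y + 2) * Q)"
      using nz QR
      apply (simp add: divide_simps)
      apply (simp add: Q_def R_def algebra_simps)
      done
    with nz QR show ?thesis unfolding bk_def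
      apply (simp add: divide_simps)
      apply (simp add: Q_def R_def algebra_simps eval_nat_numeral)
      done
  qed
  have e: "back3 (ap (y + 3)) = (- (y^4 + 14 * y^3 + 75 * y^2 + 192 * y + 205) / ((y + 1) * (y + 4) * R),
      - (y * y + 8 * y + 17) / ((y + 2) * Q))"
  proof -
    have "y + 3 - 1 = y + 2" "y + 3 + 1 = y + 4" by simp_all
    then show ?thesis unfolding back3_def ap_def Let_def fst_conv snd_conv by (simp only: c b a)
  qed
  have s: "snd (back3 (ap (y + 3))) - snd (ap y) = 5 / ((y + 1) * (y + 2) * Q)"
  proof -
    have ne: "(y + 2) * Q \<noteq> 0" "y + 1 \<noteq> 0" using nz QR by auto
    have "- (y * y + 8 * y + 17) / ((y + 2) * Q) + 1 / (y + 1) = 5 / ((y + 1) * (y + 2) * Q)"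
      unfolding add_frac_eq[OF ne]
      by (intro arg_cong2[where f="(/)"]) (simp_all add: Q_def algebra_simps)
    then show ?thesis unfolding e by (simp add: ap_def)
  qed
  have f: "fst (back3 (ap (y + 3))) - fst (ap y) =
      (5 * (y * y) + 80 * y + 225) / ((y - 1) * (y + 1) * (y + 4) * R)"
  proof -
    have ne: "(y + 1) * (y + 4) * R \<noteq> 0" "y - 1 \<noteq> 0" using nz QR by auto
    have "- (y^4 + 14 * y^3 + 75 * y^2 + 192 * y + 205) / ((y + 1) * (y + 4) * R) + 1 / (y - 1) =
        (5 * (y * y) + 80 * y + 225) / ((y - 1) * (y + 1) * (y + 4) * R)"
      unfolding add_frac_eq[OF ne]
      by (intro arg_cong2[where f="(/)"]) (simp_all add: R_def algebra_simps eval_nat_numeral)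
    then show ?thesis unfolding e by (simp add: ap_def)
  qed
  have X4: "10 / Y^4 \<le> 10 / X^4"
    using X Y by (intro divide_left_mono power_mono mult_pos_pos) (auto simp: Y_def)
  have "(99/100 * Y) * (99/100 * Y) * (98/100 * (Y * Y)) \<le> norm ((y + 1) * (y + 2) * Q)"
    unfolding norm_mult using y1 y2 Q Y by (intro mult_mono) auto
  then have "norm (5 / ((y + 1) * (y + 2) * Q)) \<le> 5 / ((99/100 * Y) * (99/100 * Y) * (98/100 * (Y * Y)))"
    unfolding norm_divide using Y by (intro frac_le) auto
  also have "\<dots> \<le> 10 / Y^4" using Y by (simp add: divide_simps power4_eq_xxxx)
  finally show "norm (snd (back3 (ap (y + 3))) - snd (ap y)) \<le> 10 / X^4" using X4 unfolding s by linarith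
  have n: "norm (5 * (y * y) + 80 * y + 225) \<le> 6 * (Y * Y)"
  proof -
    have "norm (5 * (y * y) + 80 * y + 225) \<le> 5 * (Y * Y) + 80 * Y + 225"
      by (intro bound_add) (auto simp: norm_mult Y_def)
    then show ?thesis using Y Y2 by linarith
  qed
  have "(99/100 * Y) * (99/100 * Y) * (99/100 * Y) * (98/100 * (Y * Y * Y)) \<le>
      norm ((y - 1) * (y + 1) * (y + 4) * R)"
    unfolding norm_mult using y1 y4 ym R Y by (intro mult_mono) auto
  then have "norm ((5 * (y * y) + 80 * y + 225) / ((y - 1) * (y + 1) * (y + 4) * R)) \<le>
      6 * (Y * Y) / ((99/100 * Y) * (99/100 * Y) * (99/100 * Y) * (98/100 * (Y * Y * Y)))"
    unfolding norm_divide using Y n by (intro frac_le) auto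
  also have "\<dots> \<le> 10 / Y^4" using Y by (simp add: divide_simps power4_eq_xxxx)
  finally show "norm (fst (back3 (ap (y + 3))) - fst (ap y)) \<le> 10 / X^4" using X4 unfolding f by linarith
qed

definition tube :: "complex \<Rightarrow> (complex \<times> complex) set" where
  "tube y = {s. norm (fst s - fst (ap y)) \<le> 100 / Re y ^ 3 \<and> norm (snd s - snd (ap y)) \<le> 100 / Re y ^ 3}"

text \<open>The state at y + 3 is compared with -1/y, so that the single w = 1/y fits
  \<open>back3_near\<close>; the centres 1/(y + 2) and 1/(y + 4) differ from 1/y by at most
  4/X^2.\<close>

lemma tube_near:
  assumes "1000 \<le> Re y" "s \<in> tube (y + 3)"
  shows "norm (fst s + 1 / y) \<le> 5 * (1 / Re y)^2" "norm (snd s + 1 / y) \<le> 5 * (1 / Re y)^2"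
    "norm (1 / y) \<le> 1 / Re y"
proof -
  define X where "X = Re y"
  have X: "1000 \<le> X" using assms by (simp add: X_def)
  have ny: "X \<le> norm y" "X \<le> norm (y + 2)" "X \<le> norm (y + 4)"
    using complex_Re_le_cmod[of y] complex_Re_le_cmod[of "y + 2"] complex_Re_le_cmod[of "y + 4"]
    by (auto simp: X_def)
  have nz: "y \<noteq> 0" "y + 2 \<noteq> 0" "y + 4 \<noteq> 0" using ny X by auto
  have w: "norm (1 / y) \<le> 1 / X" using ny X by (simp add: norm_divide frac_le)
  then show "norm (1 / y) \<le> 1 / Re y" by (simp add: X_def)
  have 3: "100 / (X + 3) ^ 3 \<le> 1 / X^2"
  proof -
    have "100 / (X + 3) ^ 3 \<le> 100 / X ^ 3" using X by (intro divide_left_mono power_mono) auto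
    also have "\<dots> \<le> 1 / X^2" using X by (simp add: divide_simps power3_eq_cube power2_eq_square)
    finally show ?thesis .
  qed
  have 2: "norm (2 / (y * (y + 2))) \<le> 2 / X^2" "norm (4 / (y * (y + 4))) \<le> 4 / X^2"
    unfolding norm_divide norm_mult power2_eq_square using ny X
    by (auto intro!: frac_le mult_mono)
  have sh: "y + 3 - 1 = y + 2" "y + 3 + 1 = y + 4" by simp_all
  have "fst (ap (y + 3)) + 1 / y = 2 / (y * (y + 2))" "snd (ap (y + 3)) + 1 / y = 4 / (y * (y + 4))"
    unfolding ap_def fst_conv snd_conv sh add_frac_eq[OF nz(2,1)] add_frac_eq[OF nz(3,1)]
    by (simp_all add: algebra_simps)
  then have "norm (fst s - fst (ap (y + 3)) + (fst (ap (y + 3)) + 1 / y)) \<le> 100 / (X + 3) ^ 3 + 2 / X^2"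
     "norm (snd s - snd (ap (y + 3)) + (snd (ap (y + 3)) + 1 / y)) \<le> 100 / (X + 3) ^ 3 + 4 / X^2"
    using assms(2) 2 by (auto intro!: bound_add simp: tube_def X_def)
  then have "norm (fst s + 1 / y) \<le> 100 / (X + 3) ^ 3 + 2 / X^2" "norm (snd s + 1 / y) \<le> 100 / (X + 3) ^ 3 + 4 / X^2"
    by (simp_all add: algebra_simps)
  moreover have "0 \<le> 1 / X^2" "2 / X^2 = 2 * (1 / X^2)" "4 / X^2 = 4 * (1 / X^2)"
      "5 * (1 / Re y)^2 = 5 * (1 / X^2)" by (simp_all add: X_def power_one_over)
  ultimately show "norm (fst s + 1 / y) \<le> 5 * (1 / Re y)^2" "norm (snd s + 1 / y) \<le> 5 * (1 / Re y)^2"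
    using 3 by linarith+
qed

lemma tube_lipschitz:
  assumes "1000 \<le> Re y" "s \<in> tube (y + 3)" "t \<in> tube (y + 3)"
    and "norm (fst s - fst t) \<le> M" "norm (snd s - snd t) \<le> M"
  shows "norm (fst (back3 s) - fst (back3 t)) \<le> (1 + 7 / Re y) * M"
    "norm (snd (back3 s) - snd (back3 t)) \<le> (1 + 7 / Re y) * M"
proof -
  have "0 < 1 / Re y" "1 / Re y \<le> 1 / 1000" using assms(1) by (auto simp: field_simps)
  from back3_lipschitz[OF this tube_near(3)[OF assms(1,2)] tube_near(1,2)[OF assms(1,2)]
      tube_near(1,2)[OF assms(1,3)] assms(4,5)]
  show "norm (fst (back3 s) - fst (back3 t)) \<le> (1 + 7 / Re y) * M"
    "norm (snd (back3 s) - snd (back3 t)) \<le> (1 + 7 / Re y) * M" by simp_all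
qed

lemma ap_in_tube: "1000 \<le> Re y \<Longrightarrow> ap y \<in> tube y"
  by (simp add: tube_def)

text \<open>From X + 3 to X the cubic width grows by a factor of about 1 + 9/X, which exceeds the
  Lipschitz factor 1 + 7/X; the surplus of about 200/X^4 absorbs the residual 10/X^4.\<close>

lemma back3_tube:
  assumes y: "1000 \<le> Re y" and s: "s \<in> tube (y + 3)"
  shows "back3 s \<in> tube y"
proof -
  define X where "X = Re y"
  have X: "1000 \<le> X" using y by (simp add: X_def)
  have M: "norm (fst s - fst (ap (y + 3))) \<le> 100 / (X + 3)^3" "norm (snd s - snd (ap (y + 3))) \<le> 100 / (X + 3)^3"
    using s by (auto simp: tube_def X_def)
  note 1 = tube_lipschitz[OF y s ap_in_tube M, folded X_def]
  have 2: "(1 + 7 / X) * (100 / (X + 3)^3) + 10 / X^4 \<le> 100 / X^3"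
  proof -
    have "(X + 7) * X^3 * 1000 + 100 * (X + 3)^3 \<le> 1000 * X * (X + 3)^3"
    proof -
      have "0 \<le> 1900 * X^3 + 26100 * X^2 + 24300 * X - 2700"
        using X zero_le_power[of X 3] zero_le_power[of X 2] by linarith
      also have "\<dots> = 1000 * X * (X + 3)^3 - ((X + 7) * X^3 * 1000 + 100 * (X + 3)^3)"
        by (simp add: power2_eq_square power3_eq_cube algebra_simps)
      finally show ?thesis by linarith
    qed
    then have "((X + 7) * X^3 * 1000 + 100 * (X + 3)^3) / (10 * X^4 * (X + 3)^3) \<le>
        (1000 * X * (X + 3)^3) / (10 * X^4 * (X + 3)^3)"
      using X by (intro divide_right_mono) auto
    moreover have "((X + 7) * X^3 * 1000 + 100 * P) / (10 * X^4 * P) = (1 + 7 / X) * (100 / P) + 10 / X^4"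
        "(1000 * X * P) / (10 * X^4 * P) = 100 / X^3" if "P > 0" for P
      using X that by (simp_all add: field_simps power4_eq_xxxx power3_eq_cube)
    note this(1,2)[of "(X + 3)^3"]
    ultimately show ?thesis using X by simp
  qed
  have r: "norm (fst (back3 (ap (y + 3))) - fst (ap y)) \<le> 10 / X^4"
    "norm (snd (back3 (ap (y + 3))) - snd (ap y)) \<le> 10 / X^4"
    using ap_residual[of X y] X complex_Re_le_cmod[of y] by (auto simp: X_def)
  have "1000 \<le> Re (y + 3)" using y by simp
  from bound_add[OF 1(1)[OF this] r(1)] bound_add[OF 1(2)[OF this] r(2)] 2 show ?thesis
    by (simp add: tube_def X_def)
qed

section \<open>Backward iterates of the approximate curve\<close>

primrec psi :: "nat \<Rightarrow> complex \<Rightarrow> complex \<times> complex" where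
  "psi 0 y = ap y"
| "psi (Suc m) y = back3 (psi m (y + 3))"

lemma psi_tube: "1000 \<le> Re y \<Longrightarrow> psi m y \<in> tube y"
  by (induction m arbitrary: y) (simp_all add: ap_in_tube back3_tube)

text \<open>The exponent 5/2 compensates the Lipschitz factor 1 + 7/X of a backward step of length 3.\<close>

lemma psi_Suc_diff:
  assumes "1000 \<le> Re y"
  shows "norm (fst (psi (Suc m) y) - fst (psi m y)) \<le> 10 * Re y powr (-5/2) * (Re y + 3 * m) powr (-3/2) \<and>
    norm (snd (psi (Suc m) y) - snd (psi m y)) \<le> 10 * Re y powr (-5/2) * (Re y + 3 * m) powr (-3/2)"
  using assms
proof (induction m arbitrary: y)
  case 0
  define X where "X = Re y"
  have X: "1000 \<le> X" using 0 by (simp add: X_def)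
  have "X powr (-5/2) * X powr (-3/2) = 1 / X^4"
    using X by (simp add: powr_add[symmetric] powr_minus_divide powr_numeral)
  then have "10 * X powr (-5/2) * X powr (-3/2) = 10 / X^4" by simp
  then show ?case using ap_residual[of X y] X complex_Re_le_cmod[of y] by (auto simp: X_def)
next
  case (Suc m)
  define X where "X = Re y"
  have X: "1000 \<le> X" using Suc.prems by (simp add: X_def)
  have p: "(1 + 7 / X) * (X + 3) powr (-5/2) \<le> X powr (-5/2)"
  proof -
    define t where "t = 1 / X"
    have t: "0 < t" "t \<le> 1/1000" using X by (auto simp: t_def field_simps)
    \<comment> \<open>The squared form of 1 + 7 t \<le> (1 + 3 t)^(5/2), a polynomial inequality; it
      holds because 7 < 15/2.\<close>
    have "(1 + 7 * t)^2 \<le> (1 + 3 * t)^5"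
    proof -
      have "0 \<le> t + (41 + 270 * t + 405 * t^2 + 243 * t^3) * t^2" using t by simp
      also have "\<dots> = (1 + 3 * t)^5 - (1 + 7 * t)^2" by (simp add: algebra_simps eval_nat_numeral)
      finally show ?thesis by simp
    qed
    then have "((1 + 7 * t)^2) powr (1/2) \<le> ((1 + 3 * t)^5) powr (1/2)"
      using t by (intro powr_mono2) auto
    moreover have "((1 + 7 * t)^2) powr (1/2) = 1 + 7 * t"
      using t by (simp add: powr_half_sqrt)
    moreover have "((1 + 3 * t)^5) powr (1/2) = (1 + 3 * t) powr (5/2)"
    proof -
      have "((1 + 3 * t)^5) powr (1/2) = ((1 + 3 * t) powr 5) powr (1/2)" using t by simp
      then show ?thesis unfolding powr_powr by simp
    qed
    ultimately have "1 + 7 * t \<le> (1 + 3 * t) powr (5/2)" by simp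
    moreover have "X + 3 = X * (1 + 3 * t)" using X by (simp add: t_def field_simps)
    then have "(X + 3) powr (-5/2) = X powr (-5/2) * (1 + 3 * t) powr (-5/2)"
      using X t by (simp add: powr_mult)
    moreover have "(1 + 3 * t) powr (-5/2) * (1 + 3 * t) powr (5/2) = 1"
      using t by (simp add: powr_add[symmetric])
    ultimately show ?thesis
    proof -
      assume a: "1 + 7 * t \<le> (1 + 3 * t) powr (5/2)"
        and b: "(X + 3) powr (-5/2) = X powr (-5/2) * (1 + 3 * t) powr (-5/2)"
        and c: "(1 + 3 * t) powr (-5/2) * (1 + 3 * t) powr (5/2) = 1"
      have "(1 + 7 * t) * (X + 3) powr (-5/2) \<le> (1 + 3 * t) powr (5/2) * (X + 3) powr (-5/2)"
        using a by (intro mult_right_mono) auto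
      also have "\<dots> = X powr (-5/2)" using c unfolding b by (simp add: algebra_simps)
      finally show ?thesis by (simp add: t_def)
    qed
  qed
  define Z where "Z = (X + real (3 * Suc m)) powr (-3/2)"
  have y3: "1000 \<le> Re (y + 3)" using Suc.prems by simp
  have e: "10 * Re (y + 3) powr (-5/2) * (Re (y + 3) + 3 * m) powr (-3/2) = 10 * (X + 3) powr (-5/2) * Z"
    by (simp add: X_def Z_def algebra_simps)
  have "(1 + 7 / X) * (10 * (X + 3) powr (-5/2) * Z) = 10 * Z * ((1 + 7 / X) * (X + 3) powr (-5/2))"
    by (simp add: algebra_simps)
  also have "\<dots> \<le> 10 * Z * X powr (-5/2)" using p by (intro mult_left_mono) (auto simp: Z_def)
  finally have l: "(1 + 7 / X) * (10 * (X + 3) powr (-5/2) * Z) \<le> 10 * X powr (-5/2) * Z"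
    by (simp add: algebra_simps)
  note IH = Suc.IH[OF y3, unfolded e]
  have "psi (Suc m) (y + 3) \<in> tube (y + 3)" "psi m (y + 3) \<in> tube (y + 3)"
    using psi_tube y3 by blast+
  from tube_lipschitz[OF Suc.prems this conjunct1[OF IH] conjunct2[OF IH]] l
  show ?case unfolding psi.simps(2)[of "Suc m" y] psi.simps(2)[of m y] X_def[symmetric] Z_def[symmetric]
    by (meson order_trans)
qed
lemma psi_denominators:
  assumes "1000 \<le> Re y" "s \<in> tube (y + 3)"
  shows "1 + fst s \<noteq> 0" "1 + bk (fst s) (snd s) \<noteq> 0" "1 + bk (bk (fst s) (snd s)) (fst s) \<noteq> 0"
proof -
  have "0 < 1 / Re y" "1 / Re y \<le> 1 / 1000" using assms(1) by (auto simp: field_simps)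
  from back3_near(4-6)[OF this tube_near(3)[OF assms(1,2)] tube_near(1,2)[OF assms(1,2)]]
  show "1 + fst s \<noteq> 0" "1 + bk (fst s) (snd s) \<noteq> 0" "1 + bk (bk (fst s) (snd s)) (fst s) \<noteq> 0" .
qed

lemma psi_holomorphic:
  "(\<lambda>y. fst (psi m y)) holomorphic_on {y. 1000 < Re y} \<and> (\<lambda>y. snd (psi m y)) holomorphic_on {y. 1000 < Re y}"
proof (induction m)
  case 0
  have "y \<noteq> 1" "y + 1 \<noteq> 0" if "1000 < Re y" for y
    using that by (auto simp: complex_eq_iff)
  then show ?case by (auto simp: ap_def intro!: holomorphic_intros)
next
  case (Suc m)
  have "(\<lambda>y. fst (psi m (y + 3))) holomorphic_on {y. 1000 < Re y}"
    by (rule holomorphic_on_compose_gen[of "\<lambda>y. y + 3", OF _ conjunct1[OF Suc], unfolded o_def])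
      (auto intro!: holomorphic_intros)
  moreover have "(\<lambda>y. snd (psi m (y + 3))) holomorphic_on {y. 1000 < Re y}"
    by (rule holomorphic_on_compose_gen[of "\<lambda>y. y + 3", OF _ conjunct2[OF Suc], unfolded o_def])
      (auto intro!: holomorphic_intros)
  moreover note den = psi_denominators[OF less_imp_le psi_tube[of "_ + 3" m]]
  ultimately show ?case
    unfolding psi.simps back3_def Let_def fst_conv snd_conv
    using den unfolding bk_def by (intro conjI holomorphic_intros) auto
qed

lemma psi_real: "x \<in> \<real> \<Longrightarrow> fst (psi m x) \<in> \<real> \<and> snd (psi m x) \<in> \<real>"
  by (induction m arbitrary: x) (auto simp: ap_def back3_def bk_def Let_def)

lemma psi_uniformly_convergent:
  assumes "g = fst \<or> g = snd"
  shows "\<exists>L. uniform_limit {y. 1000 < Re y} (\<lambda>m y. g (psi m y)) L sequentially"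
proof -
  define U where "U = {y. 1000 < Re y}"
  define f where "f = (\<lambda>m y. g (psi (Suc m) y) - g (psi m y))"
  define M where "M = (\<lambda>m. 10 * (real m) powr (-3/2))"
  have "uniform_limit U (\<lambda>n y. \<Sum>i<n. f i y) (\<lambda>y. \<Sum>i. f i y) sequentially"
  \<comment> \<open>At n = 0 the majorant vanishes, since \<open>0 powr x = 0\<close>; hence the
    test in its eventual form.\<close>
  proof (rule Weierstrass_m_test_ev)
    show "summable M" unfolding M_def by (intro summable_mult) (simp add: summable_real_powr_iff)
    show "\<forall>\<^sub>F n in sequentially. \<forall>y\<in>U. norm (f n y) \<le> M n"
      using eventually_gt_at_top[of 0]
    proof eventually_elim
      case (elim n)
      show ?case
      proof
        fix y assume "y \<in> U"
        then have y: "1000 < Re y" by (simp add: U_def)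
        have "norm (f n y) \<le> 10 * Re y powr (-5/2) * (Re y + 3 * n) powr (-3/2)"
          using psi_Suc_diff[of y n] y assms unfolding f_def by auto
        also have "\<dots> \<le> 10 * 1 * real n powr (-3/2)"
        proof -
          have "Re y powr (-5/2) \<le> 1" using powr_mono[of "-5/2" 0 "Re y"] y by simp
          moreover have "(Re y + real (3 * n)) powr (-3/2) \<le> real n powr (-3/2)"
            using y elim by (intro powr_mono2') auto
          ultimately show ?thesis by (intro mult_mono) auto
        qed
        finally show "norm (f n y) \<le> M n" by (simp add: M_def)
      qed
    qed
  qed
  then have "uniform_limit U (\<lambda>n y. g (psi 0 y) + (\<Sum>i<n. f i y)) (\<lambda>y. g (psi 0 y) + (\<Sum>i. f i y)) sequentially"
    by (intro uniform_limit_intros)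
  moreover have "g (psi 0 y) + (\<Sum>i<n. f i y) = g (psi n y)" for n y
    using sum_lessThan_telescope[of "\<lambda>i. g (psi i y)" n] by (simp only: f_def) simp
  ultimately show ?thesis unfolding U_def by auto
qed

section \<open>The holomorphic limit curve and its asymptotics\<close>

definition fst_curve :: "complex \<Rightarrow> complex" where
  "fst_curve y = lim (\<lambda>m. fst (psi m y))"

definition snd_curve :: "complex \<Rightarrow> complex" where
  "snd_curve y = lim (\<lambda>m. snd (psi m y))"

lemma curve_uniform_limit:
  "uniform_limit {y. 1000 < Re y} (\<lambda>m y. fst (psi m y)) fst_curve sequentially"
  "uniform_limit {y. 1000 < Re y} (\<lambda>m y. snd (psi m y)) snd_curve sequentially"
proof -
  have *: "uniform_limit {y. 1000 < Re y} h (\<lambda>y. lim (\<lambda>m. h m y)) sequentially"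
    if "uniform_limit {y. 1000 < Re y} h L sequentially" for h :: "nat \<Rightarrow> complex \<Rightarrow> complex" and L
    using that by (rule uniform_limit_cong'[THEN iffD1, rotated -1])
      (auto intro!: limI[symmetric] tendsto_uniform_limitI[OF that])
  show "uniform_limit {y. 1000 < Re y} (\<lambda>m y. fst (psi m y)) fst_curve sequentially"
    "uniform_limit {y. 1000 < Re y} (\<lambda>m y. snd (psi m y)) snd_curve sequentially"
    using psi_uniformly_convergent[of fst] psi_uniformly_convergent[of snd] *
    unfolding fst_curve_def[abs_def] snd_curve_def[abs_def] by blast+
qed

lemma curve_tendsto:
  assumes "1000 < Re y"
  shows "(\<lambda>m. fst (psi m y)) \<longlonglongrightarrow> fst_curve y" "(\<lambda>m. snd (psi m y)) \<longlonglongrightarrow> snd_curve y"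
  using curve_uniform_limit[THEN tendsto_uniform_limitI] assms by auto

lemma open_half: "open {y. 1000 < Re y}"
  by (rule open_halfspace_Re_gt)

lemma curve_holomorphic:
  "fst_curve holomorphic_on {y. 1000 < Re y}" "snd_curve holomorphic_on {y. 1000 < Re y}"
proof -
  have *: "\<exists>d>0. cball x d \<subseteq> {y. 1000 < Re y} \<and> uniform_limit (cball x d) h l sequentially"
    if "uniform_limit {y. 1000 < Re y} h l sequentially" "x \<in> {y. 1000 < Re y}"
    for h :: "nat \<Rightarrow> complex \<Rightarrow> complex" and l x
    using open_contains_cball[THEN iffD1, OF open_half] that uniform_limit_on_subset by blast
  show "fst_curve holomorphic_on {y. 1000 < Re y}"
    by (rule holomorphic_uniform_sequence[OF open_half conjunct1[OF psi_holomorphic]])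
      (rule *[OF curve_uniform_limit(1)])
  show "snd_curve holomorphic_on {y. 1000 < Re y}"
    by (rule holomorphic_uniform_sequence[OF open_half conjunct2[OF psi_holomorphic]])
      (rule *[OF curve_uniform_limit(2)])
qed

lemma curve_tube:
  assumes "1000 < Re y"
  shows "(fst_curve y, snd_curve y) \<in> tube y"
proof -
  have "norm (fst_curve y - fst (ap y)) \<le> 100 / Re y ^ 3"
    by (rule Lim_bounded[where M = 0, OF tendsto_norm[OF tendsto_diff[OF curve_tendsto(1)[OF assms] tendsto_const]]])
      (use psi_tube[of y] assms in \<open>auto simp: tube_def\<close>)
  moreover have "norm (snd_curve y - snd (ap y)) \<le> 100 / Re y ^ 3"
    by (rule Lim_bounded[where M = 0, OF tendsto_norm[OF tendsto_diff[OF curve_tendsto(2)[OF assms] tendsto_const]]])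
      (use psi_tube[of y] assms in \<open>auto simp: tube_def\<close>)
  ultimately show ?thesis by (simp add: tube_def)
qed

lemma curve_back3:
  assumes y: "1000 < Re y"
  shows "(fst_curve y, snd_curve y) = back3 (fst_curve (y + 3), snd_curve (y + 3))"
proof -
  have y3: "1000 < Re (y + 3)" using y by simp
  note t = curve_tendsto[OF y3] and d = psi_denominators[OF less_imp_le[OF y] curve_tube[OF y3]]
  have "(\<lambda>m. fst (psi (Suc m) y)) \<longlonglongrightarrow> fst (back3 (fst_curve (y + 3), snd_curve (y + 3)))"
    "(\<lambda>m. snd (psi (Suc m) y)) \<longlonglongrightarrow> snd (back3 (fst_curve (y + 3), snd_curve (y + 3)))"
    unfolding psi.simps back3_def Let_def fst_conv snd_conv bk_def
    using d unfolding bk_def fst_conv snd_conv by (intro tendsto_intros t; simp)+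
  from LIMSEQ_unique[OF this(1) LIMSEQ_Suc[OF curve_tendsto(1)[OF y]]]
    LIMSEQ_unique[OF this(2) LIMSEQ_Suc[OF curve_tendsto(2)[OF y]]]
  show ?thesis by (simp add: prod_eq_iff)
qed

lemma curve_real:
  assumes "1000 < x"
  shows "fst_curve (of_real x) \<in> \<real>" "snd_curve (of_real x) \<in> \<real>"
proof -
  have x: "1000 < Re (of_real x)" using assms by simp
  show "fst_curve (of_real x) \<in> \<real>"
    by (rule Lim_in_closed_set[OF closed_complex_Reals _ _ curve_tendsto(1)[OF x]]) (auto simp: psi_real)
  show "snd_curve (of_real x) \<in> \<real>"
    by (rule Lim_in_closed_set[OF closed_complex_Reals _ _ curve_tendsto(2)[OF x]]) (auto simp: psi_real)
qed

text \<open>Cauchy's estimate on the unit disc around y, applied to the difference from the explicit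
  leading term. Closeness on the real axis alone would not control derivatives.\<close>

lemma curve_deriv:
  assumes y: "1001 < Re y" and g: "(g, g0) = (fst_curve, \<lambda>y. - 1 / (y - 1)) \<or> (g, g0) = (snd_curve, \<lambda>y. - 1 / (y + 1))"
  shows "norm (deriv g y - deriv g0 y) \<le> 100 / (Re y - 1) ^ 3"
proof -
  define r where "r = (\<lambda>y. g y - g0 y)"
  have ne: "z - 1 \<noteq> 0" "z + 1 \<noteq> 0" if "1000 < Re z" for z using that by (auto simp: complex_eq_iff)
  have hg: "g holomorphic_on {y. 1000 < Re y}" "g0 holomorphic_on {y. 1000 < Re y}"
    using g curve_holomorphic ne by (auto intro!: holomorphic_intros)
  have yin: "y \<in> {y. 1000 < Re y}" using y by simp
  have hr: "r holomorphic_on {y. 1000 < Re y}" unfolding r_def by (intro holomorphic_intros hg)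
  have sub: "Re y - 1 \<le> Re z" if "norm (y - z) \<le> 1" for z
    using complex_Re_le_cmod[of "y - z"] that by simp
  then have cb: "cball y 1 \<subseteq> {y. 1000 < Re y}" using y by (fastforce simp: dist_norm)
  have "norm ((deriv ^^ 1) r y) \<le> fact 1 * (100 / (Re y - 1)^3) / 1 ^ 1"
  proof (rule Cauchy_inequality)
    show "r holomorphic_on ball y 1" using hr cb by (meson ball_subset_cball holomorphic_on_subset order_trans)
    show "continuous_on (cball y 1) r"
      using hr cb by (meson holomorphic_on_imp_continuous_on holomorphic_on_subset)
    fix z assume z: "norm (y - z) = 1"
    then have z1: "Re y - 1 \<le> Re z" using sub by simp
    then have "norm (r z) \<le> 100 / Re z ^ 3"
      using curve_tube[of z] y g by (auto simp: tube_def r_def ap_def)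
    also have "\<dots> \<le> 100 / (Re y - 1)^3" using z1 y by (intro divide_left_mono power_mono) auto
    finally show "norm (r z) \<le> 100 / (Re y - 1)^3" .
  qed simp
  moreover have "deriv r y = deriv g y - deriv g0 y"
    unfolding r_def using hg yin open_half by (intro deriv_diff) (auto simp: holomorphic_on_imp_differentiable_at)
  ultimately show ?thesis by simp
qed

text \<open>Analyticity expressed by a holomorphic extension: closure under arithmetic and
  composition is then inherited from complex analysis, and power series are needed only once, in
  \<open>ranal_imp_real_analytic_at\<close>.\<close>

definition ranal :: "(real \<Rightarrow> real) \<Rightarrow> real \<Rightarrow> bool" where
  "ranal u t \<longleftrightarrow> (\<exists>g. g analytic_on {of_real t :: complex} \<and> (\<forall>\<^sub>F s in nhds t. g (of_real s) = of_real (u s)))"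

lemma ranal_curve:
  assumes "1000 < x"
  shows "ranal (\<lambda>x. Re (fst_curve (of_real x))) x" "ranal (\<lambda>x. Re (snd_curve (of_real x))) x"
proof -
  have e: "\<forall>\<^sub>F s in nhds x. 1000 < s" using eventually_nhds_in_open[of "{1000<..}" x] assms by simp
  have an: "fst_curve analytic_on {of_real x}" "snd_curve analytic_on {of_real x}"
    using assms curve_holomorphic open_half by (auto simp: analytic_at)
  show "ranal (\<lambda>x. Re (fst_curve (of_real x))) x"
    unfolding ranal_def by (rule exI, rule conjI[OF an(1)], rule eventually_mono[OF e]) (auto simp: curve_real)
  show "ranal (\<lambda>x. Re (snd_curve (of_real x))) x"
    unfolding ranal_def by (rule exI, rule conjI[OF an(2)], rule eventually_mono[OF e]) (auto simp: curve_real)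
qed

lemma curve_real_deriv:
  assumes x: "1001 < x"
  shows "((\<lambda>x. Re (fst_curve (of_real x))) has_real_derivative Re (deriv fst_curve (of_real x))) (at x)"
    "((\<lambda>x. Re (snd_curve (of_real x))) has_real_derivative Re (deriv snd_curve (of_real x))) (at x)"
    "\<bar>Re (deriv fst_curve (of_real x)) - 1 / (x - 1)^2\<bar> \<le> 100 / (x - 1)^3"
    "\<bar>Re (deriv snd_curve (of_real x)) - 1 / (x + 1)^2\<bar> \<le> 100 / (x - 1)^3"
proof -
  have xin: "complex_of_real x \<in> {y. 1000 < Re y}" using x by simp
  have f: "(h has_field_derivative deriv h (of_real x)) (at (of_real x))" if "h holomorphic_on {y. 1000 < Re y}" for h
    using holomorphic_derivI[OF that open_half xin] .
  show "((\<lambda>x. Re (fst_curve (of_real x))) has_real_derivative Re (deriv fst_curve (of_real x))) (at x)"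
    by (rule has_field_derivative_Re[OF has_vector_derivative_real_field]) (rule f[OF curve_holomorphic(1)])
  show "((\<lambda>x. Re (snd_curve (of_real x))) has_real_derivative Re (deriv snd_curve (of_real x))) (at x)"
    by (rule has_field_derivative_Re[OF has_vector_derivative_real_field]) (rule f[OF curve_holomorphic(2)])
  have d1: "deriv (\<lambda>y. - 1 / (y - 1)) (complex_of_real x) = of_real (1 / (x - 1)^2)"
  proof (rule DERIV_imp_deriv)
    have "complex_of_real x - 1 \<noteq> 0" using x by (auto simp: complex_eq_iff)
    then show "((\<lambda>y. - 1 / (y - 1)) has_field_derivative of_real (1 / (x - 1)^2)) (at (complex_of_real x))"
      by (auto intro!: derivative_eq_intros simp: power2_eq_square)
  qed
  have d2: "deriv (\<lambda>y. - 1 / (y + 1)) (complex_of_real x) = of_real (1 / (x + 1)^2)"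
  proof (rule DERIV_imp_deriv)
    have "complex_of_real x + 1 \<noteq> 0" using x by (auto simp: complex_eq_iff)
    then show "((\<lambda>y. - 1 / (y + 1)) has_field_derivative of_real (1 / (x + 1)^2)) (at (complex_of_real x))"
      by (auto intro!: derivative_eq_intros simp: power2_eq_square)
  qed
  have xx: "1001 < Re (complex_of_real x)" using x by simp
  show "\<bar>Re (deriv fst_curve (of_real x)) - 1 / (x - 1)^2\<bar> \<le> 100 / (x - 1)^3"
    using order_trans[OF abs_Re_le_cmod curve_deriv[OF xx, of fst_curve "\<lambda>y. - 1 / (y - 1)"]] unfolding d1 by simp
  show "\<bar>Re (deriv snd_curve (of_real x)) - 1 / (x + 1)^2\<bar> \<le> 100 / (x - 1)^3"
    using order_trans[OF abs_Re_le_cmod curve_deriv[OF xx, of snd_curve "\<lambda>y. - 1 / (y + 1)"]] unfolding d2 by simp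
qed

lemma asymptotic_curve:
  obtains a b a' b' :: "real \<Rightarrow> real" and R :: real
  where "1000 < R"
    and "\<And>x. R < x \<Longrightarrow> ranal a x \<and> ranal b x"
    and "\<And>x. R < x \<Longrightarrow> (a has_real_derivative a' x) (at x) \<and> (b has_real_derivative b' x) (at x)"
    and "\<And>x. R < x \<Longrightarrow> \<bar>a x + 1 / (x - 1)\<bar> \<le> 100 / x^3 \<and> \<bar>b x + 1 / (x + 1)\<bar> \<le> 100 / x^3"
    and "\<And>x. R < x \<Longrightarrow> \<bar>a' x - 1 / (x - 1)^2\<bar> \<le> 100 / (x - 1)^3 \<and> \<bar>b' x - 1 / (x + 1)^2\<bar> \<le> 100 / (x - 1)^3"
    and "\<And>x. R < x \<Longrightarrow> (a x, b x) = back3 (a (x + 3), b (x + 3))"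
proof
  define a b where "a = (\<lambda>x. Re (fst_curve (of_real x)))" and "b = (\<lambda>x. Re (snd_curve (of_real x)))"
  show "1000 < (1001::real)" by simp
  fix x :: real assume x: "1001 < x"
  show "ranal a x \<and> ranal b x" using ranal_curve x by (simp add: a_def b_def)
  show "(a has_real_derivative Re (deriv fst_curve (of_real x))) (at x) \<and> (b has_real_derivative Re (deriv snd_curve (of_real x))) (at x)"
    "\<bar>Re (deriv fst_curve (of_real x)) - 1 / (x - 1)^2\<bar> \<le> 100 / (x - 1)^3 \<and> \<bar>Re (deriv snd_curve (of_real x)) - 1 / (x + 1)^2\<bar> \<le> 100 / (x - 1)^3"
    using curve_real_deriv[OF x] by (simp_all add: a_def b_def)
  have r: "fst_curve (of_real z) = of_real (a z)" "snd_curve (of_real z) = of_real (b z)" if "1000 < z" for z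
    using curve_real[OF that] by (auto simp: a_def b_def)
  have t: "norm (fst_curve (of_real x) - (- 1 / (of_real x - 1))) \<le> 100 / x^3"
     "norm (snd_curve (of_real x) - (- 1 / (of_real x + 1))) \<le> 100 / x^3"
    using curve_tube[of "of_real x"] x by (auto simp: tube_def ap_def)
  have "fst_curve (of_real x) - (- 1 / (of_real x - 1)) = of_real (a x + 1 / (x - 1))"
    "snd_curve (of_real x) - (- 1 / (of_real x + 1)) = of_real (b x + 1 / (x + 1))"
    using r[of x] x by simp_all
  then show "\<bar>a x + 1 / (x - 1)\<bar> \<le> 100 / x^3 \<and> \<bar>b x + 1 / (x + 1)\<bar> \<le> 100 / x^3"
    using t by (metis norm_of_real)
  have bko: "bk (of_real p) (of_real q) = complex_of_real (bk p q)" for p q by (simp add: bk_def)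
  have "(of_real (a x), of_real (b x)) = back3 (complex_of_real (a (x + 3)), complex_of_real (b (x + 3)))"
    using curve_back3[of "of_real x"] r[of x] r[of "x + 3"] x by simp
  then show "(a x, b x) = back3 (a (x + 3), b (x + 3))"
    by (simp add: back3_def Let_def bko)
qed

section \<open>Monotonicity of the stable curve\<close>

lemma bk_has_derivative:
  fixes p q :: "real \<Rightarrow> real"
  assumes "(p has_real_derivative p') (at x within S)" "(q has_real_derivative q') (at x within S)" "1 + p x \<noteq> 0"
  shows "((\<lambda>x. bk (p x) (q x)) has_real_derivative
    ((q x - 1 - bk (p x) (q x)) * p' + (p x - 1) * q') / (1 + p x)) (at x within S)"
proof -
  have "((\<lambda>x. bk (p x) (q x)) has_real_derivative
    ((p x * q' + p' * q x - p' - q') * (1 + p x) - (p x * q x - p x - q x) * p') / ((1 + p x) * (1 + p x))) (at x within S)"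
    unfolding bk_def using assms(3) by (auto intro!: derivative_eq_intros assms(1,2))
  moreover have "((p x * q' + p' * q x - p' - q') * (1 + p x) - (p x * q x - p x - q x) * p') / ((1 + p x) * (1 + p x)) =
      ((q x - 1 - bk (p x) (q x)) * p' + (p x - 1) * q') / (1 + p x)"
    unfolding bk_def using assms(3) by (simp add: divide_simps) (simp add: algebra_simps)
  ultimately show ?thesis by simp
qed

lemma ranal_bk:
  assumes "ranal p x" "ranal q x" "1 + p x \<noteq> 0"
  shows "ranal (\<lambda>x. bk (p x) (q x)) x"
proof -
  obtain g h where g: "g analytic_on {of_real x :: complex}" "\<forall>\<^sub>F s in nhds x. g (of_real s) = of_real (p s)"
    and h: "h analytic_on {of_real x :: complex}" "\<forall>\<^sub>F s in nhds x. h (of_real s) = of_real (q s)"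
    using assms by (auto simp: ranal_def)
  have "g (of_real x) = of_real (p x)" using eventually_nhds_x_imp_x[OF g(2)] .
  then have "1 + g (of_real x) = of_real (1 + p x)" by simp
  then have n: "1 + g (of_real x) \<noteq> 0" using assms(3) of_real_eq_0_iff by metis
  show ?thesis unfolding ranal_def
  proof (intro exI conjI)
    show "(\<lambda>z. bk (g z) (h z)) analytic_on {of_real x}"
      unfolding bk_def using n by (intro analytic_intros g h) auto
    show "\<forall>\<^sub>F s in nhds x. bk (g (of_real s)) (h (of_real s)) = of_real (bk (p s) (q s))"
      using g(2) h(2) by eventually_elim (simp add: bk_def)
  qed
qed

lemma ranal_cong:
  assumes "ranal p x" "\<forall>\<^sub>F s in nhds x. p s = q s"
  shows "ranal q x"
proof -
  obtain g where g: "g analytic_on {of_real x :: complex}" "\<forall>\<^sub>F s in nhds x. g (of_real s) = of_real (p s)"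
    using assms by (auto simp: ranal_def)
  have "\<forall>\<^sub>F s in nhds x. g (of_real s) = of_real (q s)"
    using g(2) assms(2) by eventually_elim simp
  with g(1) show ?thesis by (auto simp: ranal_def)
qed

lemma ranal_shift:
  assumes "ranal p (x + c)"
  shows "ranal (\<lambda>x. p (x + c)) x"
proof -
  obtain g where g: "g analytic_on {of_real (x + c) :: complex}" "\<forall>\<^sub>F s in nhds (x + c). g (of_real s) = of_real (p s)"
    using assms by (auto simp: ranal_def)
  have "(\<lambda>z. g (z + of_real c)) analytic_on {of_real x}"
    by (rule analytic_on_compose_gen[unfolded o_def, of "\<lambda>z. z + of_real c" _ g "{of_real (x + c)}"])
      (use g in \<open>auto intro!: analytic_intros\<close>)
  moreover have "filterlim (\<lambda>s. s + c) (nhds (x + c)) (nhds x)"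
    by (intro tendsto_intros filterlim_ident)
  then have "\<forall>\<^sub>F s in nhds x. g (of_real (s + c)) = of_real (p (s + c))"
    by (rule eventually_compose_filterlim[OF g(2)])
  ultimately show ?thesis unfolding ranal_def by (intro exI) auto
qed

lemma deriv_shift:
  fixes p :: "real \<Rightarrow> real"
  assumes "(p has_real_derivative p') (at (x + c))"
  shows "((\<lambda>x. p (x + c)) has_real_derivative p') (at x)"
  using assms DERIV_shift by blast

text \<open>Up to sign and a factor 1/(1 + p), the left side is the coefficient of p' in the
  derivative of \<open>bk p q\<close>; the closed form reveals its sign, which depends on q
  only.\<close>

lemma bk_slope:
  fixes p q :: "'a::field"
  assumes "1 + p \<noteq> 0"
  shows "1 + bk p q - q = (1 - 2 * q) / (1 + p)"
  using assms by (simp add: bk_def field_simps)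

lemma one_plus_bk:
  fixes p q :: "'a::field"
  assumes "1 + p \<noteq> 0"
  shows "1 + bk p q = (1 + p * q - q) / (1 + p)"
  using assms by (simp add: bk_def field_simps)

section \<open>Signs and an invariant cone along three backward steps\<close>

context
  fixes d e c b a :: real
  assumes d: "-1 < d" "d < 0" and e: "-1 < e" "e < 0"
    and c: "c = bk d e" and b: "b = bk c d" and a: "a = bk b c"
begin

lemma bk_pos: "0 < c" "- d < c"
proof -
  have "0 < d * e" using d e by (simp add: mult_neg_neg)
  then show "0 < c" using d e unfolding c bk_def by (intro divide_pos_pos) auto
  have "c + d = (d * e - e + d * d) / (1 + d)" unfolding c bk_def using d by (simp add: field_simps)
  moreover have "0 < d * e - e + d * d" using e \<open>0 < d * e\<close> zero_le_square[of d] by linarith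
  then have "0 < (d * e - e + d * d) / (1 + d)" using d by simp
  ultimately show "- d < c" by simp
qed

lemma bk2_neg: "b < 0"
proof -
  have "d * (1 - d) + c * (1 - d) > 0" using bk_pos d mult_pos_pos[of "c + d" "1 - d"] by (simp add: algebra_simps)
  then have "c * d - c - d < 0" using d mult_neg_neg[of d d] by (simp add: algebra_simps)
  then show ?thesis using bk_pos unfolding b bk_def by (intro divide_neg_pos) auto
qed

lemma bk2_gt: "c \<le> 1 \<Longrightarrow> -1 < b"
proof -
  assume "c \<le> 1"
  then have "0 \<le> - d * (1 - c)" using d by (intro mult_nonneg_nonneg) auto
  then have "0 < (1 + c * d - d) / (1 + c)" using bk_pos by (intro divide_pos_pos) (auto simp: algebra_simps)
  then show ?thesis using one_plus_bk[of c d] bk_pos b by simp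
qed

lemma bk3_neg: "-1 < b \<Longrightarrow> a < 0"
proof -
  assume b1: "-1 < b"
  have be: "- b * (1 + c) = c + d * (1 - c)" unfolding b bk_def using bk_pos by (simp add: field_simps)
  have "- b * (1 - c) < c"
  proof (cases "c \<ge> 1")
    case True
    then have "- b * (1 - c) \<le> 0" using bk2_neg mult_nonpos_nonpos[of b "1 - c"] by simp
    then show ?thesis using bk_pos by linarith
  next
    case False
    then have "d * (1 - c) < 0" using d by (intro mult_neg_pos) auto
    then have "- b * (1 + c) < c" using be by simp
    moreover have "0 < - b * c" using bk2_neg bk_pos by (simp add: mult_neg_pos)
    ultimately show ?thesis by (simp add: algebra_simps)
  qed
  then have "b * c - b - c < 0" by (simp add: algebra_simps)
  then show "a < 0" unfolding a bk_def using b1 by (intro divide_neg_pos) auto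
qed

context
  fixes d' e' c' b' a' :: real
  assumes d': "0 < d'" and e': "0 < e'"
    and c': "c' = ((e - 1 - c) * d' + (d - 1) * e') / (1 + d)"
    and b': "b' = ((d - 1 - b) * c' + (c - 1) * d') / (1 + c)"
    and a': "a' = ((c - 1 - a) * b' + (b - 1) * c') / (1 + b)"
begin

text \<open>The cone is the open quadrant of positive velocities. The lower bound on
  \<open>- c'\<close> is kept because c' has to outweigh a term of the opposite sign in
  \<open>cone_b\<close>.\<close>

lemma cone_c: "c' < 0" "(1 - 2 * e) / (1 + d)^2 * d' \<le> - c'"
proof -
  have s: "1 + c - e = (1 - 2 * e) / (1 + d)" using bk_slope[of d e] d c by simp
  have "- c' = (1 + c - e) / (1 + d) * d' + (1 - d) * e' / (1 + d)"
    unfolding c' minus_divide_left times_divide_eq_left add_divide_distrib[symmetric]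
    by (rule arg_cong2[where f="(/)"]) (simp_all add: algebra_simps)
  moreover have "(1 + c - e) / (1 + d) * d' = (1 - 2 * e) / (1 + d)^2 * d'"
    unfolding s by (simp add: power2_eq_square)
  moreover have "0 < (1 - d) * e' / (1 + d)" using d e' by simp
  moreover have "0 < (1 - 2 * e) / (1 + d)^2 * d'" using d e d' by simp
  ultimately show "c' < 0" "(1 - 2 * e) / (1 + d)^2 * d' \<le> - c'" by linarith+
qed

text \<open>For c < 1 the term with \<open>- c'\<close> must beat \<open>(1 - c) * d'\<close>.
  Inserting the bound of \<open>cone_c\<close> and the slope formula leaves (1 - c^2)(1 + d)^2 < (1
  - 2 d)(1 - 2 e), where the left side is at most 1 and the right side exceeds 1.\<close>

lemma cone_b: "0 < b'"
proof -
  have s: "1 + b - d = (1 - 2 * d) / (1 + c)" using bk_slope[of c d] bk_pos b by simp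
  have sp: "0 < 1 + b - d" unfolding s using d bk_pos by simp
  have "(1 - c) * d' < (1 + b - d) * (- c')"
  proof (cases "c < 1")
    case False
    then have "(1 - c) * d' \<le> 0" using d' by (simp add: mult_nonpos_nonneg)
    moreover have "0 < (1 + b - d) * (- c')" using sp cone_c by (intro mult_pos_pos) auto
    ultimately show ?thesis by linarith
  next
    case True
    have d1: "0 < (1 + d)^2" using d by simp
    have "(1 - c) * (1 + c) * (1 + d)^2 \<le> 1 * 1"
    proof (intro mult_mono)
      show "(1 - c) * (1 + c) \<le> 1" by (simp add: algebra_simps)
      show "(1 + d)^2 \<le> 1" using d by (intro power_le_one) auto
    qed auto
    also have "\<dots> < (1 - 2 * d) * (1 - 2 * e)"
      using d e mult_neg_neg[of d e] by (simp add: algebra_simps)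
    finally have "(1 - c) * (1 + c) * (1 + d)^2 < (1 - 2 * d) * (1 - 2 * e)" .
    then have "1 - c < (1 - 2 * d) / (1 + c) * ((1 - 2 * e) / (1 + d)^2)"
      using bk_pos d1 by (simp add: pos_less_divide_eq mult.assoc)
    then have "(1 - c) * d' < (1 + b - d) * ((1 - 2 * e) / (1 + d)^2) * d'"
      using d' unfolding s by (intro mult_strict_right_mono) auto
    also have "\<dots> \<le> (1 + b - d) * (- c')"
      by (subst mult.assoc) (rule mult_left_mono[OF cone_c(2) less_imp_le[OF sp]])
    finally show ?thesis .
  qed
  then have "0 < (d - 1 - b) * c' + (c - 1) * d'" by (simp add: algebra_simps)
  then show ?thesis unfolding b' using bk_pos by simp
qed

text \<open>For c \<ge> 1/2 no term has the wrong sign. Otherwise b' is bounded by c' through its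
  own formula, and the claim reduces to (1 - 2 c)(1 - 2 d) < (1 - b^2)(1 + c)^2.\<close>

lemma cone_a: "-1 < b \<Longrightarrow> 0 < a'"
proof -
  assume b1: "-1 < b"
  have s: "1 + a - c = (1 - 2 * c) / (1 + b)" using bk_slope[of b c] b1 a by simp
  have "0 < (c - 1 - a) * b' + (b - 1) * c'"
  proof (cases "c < 1/2")
    case False
    then have "0 \<le> c - 1 - a" using s b1 divide_nonpos_pos[of "1 - 2 * c" "1 + b"] by simp
    then have "0 \<le> (c - 1 - a) * b'" using cone_b by simp
    moreover have "0 < (b - 1) * c'" using bk2_neg cone_c by (intro mult_neg_neg) auto
    ultimately show ?thesis by simp
  next
    case True
    have s2: "1 + b - d = (1 - 2 * d) / (1 + c)" using bk_slope[of c d] bk_pos b by simp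
    have cp: "1 + c > 0" using bk_pos by simp
    have "(1 + c) * b' = (d - 1 - b) * c' + (c - 1) * d'" unfolding b' using cp by simp
    then have "(1 + c) * b' = (1 + b - d) * (- c') - (1 - c) * d'" by (simp add: algebra_simps)
    then have "(1 + c) * b' \<le> (1 + b - d) * (- c')" using True d' by simp
    then have "(1 + c) * b' * (1 + c) \<le> (1 + b - d) * (- c') * (1 + c)" using cp by (intro mult_right_mono) auto
    also have "\<dots> = (1 + b - d) * (1 + c) * (- c')" by (simp add: mult_ac)
    also have "(1 + b - d) * (1 + c) = 1 - 2 * d" using s2 cp by simp
    finally have "(1 + c) * b' * (1 + c) \<le> (1 - 2 * d) * (- c')" .
    then have k1: "(1 + c)^2 * b' \<le> (1 - 2 * d) * (- c')" by (simp add: power2_eq_square mult_ac)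
    \<comment> \<open>With this q, (1 - b)(1 + c) = 1 + 2 c - q and (1 + b)(1 + c) = 1 + q, so b
      disappears from the inequality.\<close>
    define q where "q = - d * (1 - c)"
    have q: "0 < q" "q < - d"
      using mult_neg_pos[OF d(2), of "1 - c"] True mult_neg_pos[OF d(2) bk_pos(1)]
      by (auto simp: q_def algebra_simps)
    have "q * q \<le> (- d) * 1" using q d by (intro mult_mono) auto
    moreover have "0 < c * q" using bk_pos q by simp
    moreover have "0 < c * (- d)" using bk_pos d by (intro mult_pos_pos) auto
    ultimately have "0 < 4 * c + 2 * d + 2 * (c * q) + 4 * (c * (- d)) - q * q" using bk_pos d by linarith
    also have "\<dots> = (1 + 2 * c - q) * (1 + q) - (1 - 2 * c) * (1 - 2 * d)"
      by (simp add: q_def algebra_simps)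
    finally have k2: "(1 - 2 * c) * (1 - 2 * d) < (1 + 2 * c - q) * (1 + q)" by simp
    have "(1 - b) * (1 + c) = 1 + 2 * c - q" "(1 + b) * (1 + c) = 1 + q"
      unfolding b bk_def q_def using cp by (simp_all add: field_simps)
    then have "(1 + 2 * c - q) * (1 + q) = (1 - b) * (1 + b) * (1 + c)^2"
      by (simp add: power2_eq_square mult_ac flip: \<open>(1 - b) * (1 + c) = 1 + 2 * c - q\<close>)
    then have "(1 - 2 * c) * (1 - 2 * d) * b' < (1 - b) * (1 + b) * ((1 + c)^2 * b')"
      using k2 cone_b by (simp add: mult.assoc[symmetric])
    also have "\<dots> \<le> (1 - b) * (1 + b) * ((1 - 2 * d) * (- c'))"
      using k1 b1 bk2_neg by (intro mult_left_mono) auto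
    finally have "(1 - 2 * d) * ((1 - 2 * c) * b') < (1 - 2 * d) * ((1 - b) * (1 + b) * (- c'))"
      by (simp add: mult_ac)
    then have "(1 - 2 * c) * b' < (1 - b) * (1 + b) * (- c')"
      by (rule mult_left_less_imp_less) (use d in auto)
    then have "(1 - 2 * c) / (1 + b) * b' < (1 - b) * (- c')"
      using b1 by (simp add: pos_divide_less_eq mult_ac)
    then show ?thesis unfolding s[symmetric] by (simp add: algebra_simps)
  qed
  then show "0 < a'" unfolding a' using b1 by simp
qed

end

end

text \<open>As long as the pairs stay in the square (-1, 0)^2, the positive terms between them grow
  by at least their square at each backward triple step and yet remain below 1. Hence the curve must
  leave the square at a finite parameter.\<close>

lemma bk_growth:
  fixes a b c :: real
  assumes "-1 < a" "a < 0" "-1 < b" "b < 0" "0 < c" "a = bk b c"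
  shows "c + c^2 \<le> bk a b" "c < 1"
proof -
  have ae: "a * (1 + b) = b * c - b - c" using assms unfolding assms(6) bk_def by simp
  have "0 < 1 + a" using assms by simp
  then have "0 < (1 + a) * (1 + b)" using assms by simp
  then have "c * (1 - b) < 1" using ae by (simp add: algebra_simps)
  moreover have "0 < c * (- b)" using assms by (intro mult_pos_pos) auto
  ultimately show "c < 1" by (simp add: algebra_simps)
  define z where "z = bk a b"
  have z0: "0 < z" unfolding z_def using bk_pos(1)[OF assms(1-4)] by blast
  have ab: "0 < a * b" using assms by (simp add: mult_neg_neg)
  have ze: "z * (1 + a) = a * b - a - b" using assms by (simp add: z_def bk_def)
  have c1: "c \<le> - a - b" using ae \<open>0 < c * (- b)\<close> ab by (simp add: algebra_simps)
  have d3: "z - c = 2 * (a * b) - z * a - b * c" using ze ae by (simp add: algebra_simps)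
  then have "c \<le> z" using ab mult_neg_pos[OF assms(4,5)] mult_pos_neg[OF z0 assms(2)] by linarith
  then have "c * (- a) \<le> z * (- a)" using assms by (intro mult_right_mono) auto
  moreover have "c * c \<le> c * (- a - b)" using c1 assms by (intro mult_left_mono) auto
  ultimately show "c + c^2 \<le> bk a b"
    unfolding z_def[symmetric] using d3 ab by (simp add: power2_eq_square algebra_simps)
qed

text \<open>The local stable curve, normalised so that its first coordinate reaches -1 at parameter 0.\<close>

locale stable_curve =
  fixes a b a' b' :: "real \<Rightarrow> real"
  assumes a0: "a 0 = -1"
    and a_range: "\<And>x. 0 < x \<Longrightarrow> -1 < a x \<and> a x < 0"
    and b_range: "\<And>x. 0 \<le> x \<Longrightarrow> -1 < b x \<and> b x < 0"
    and ab_ranal: "\<And>x. 0 \<le> x \<Longrightarrow> ranal a x \<and> ranal b x"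
    and a_deriv: "\<And>x. 0 \<le> x \<Longrightarrow> (a has_real_derivative a' x) (at x)"
    and b_deriv: "\<And>x. 0 \<le> x \<Longrightarrow> (b has_real_derivative b' x) (at x)"
    and ab'_pos: "\<And>x. 0 \<le> x \<Longrightarrow> 0 < a' x \<and> 0 < b' x"
    and ab_back3: "\<And>x. 0 \<le> x \<Longrightarrow> (a x, b x) = back3 (a (x + 3), b (x + 3))"
    and a_asymp: "((\<lambda>x. x * a x) \<longlongrightarrow> -1) at_top" "((\<lambda>x. x^2 * a' x) \<longlongrightarrow> 1) at_top"
    and b_asymp: "((\<lambda>x. x * b x) \<longlongrightarrow> -1) at_top" "((\<lambda>x. x^2 * b' x) \<longlongrightarrow> 1) at_top"

lemma squeeze_asymp:
  fixes u v w k :: "real \<Rightarrow> real"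
  assumes "\<forall>\<^sub>F x in at_top. \<bar>u x - v x\<bar> \<le> w x" "((\<lambda>x. k x * v x) \<longlongrightarrow> l) at_top" "((\<lambda>x. k x * w x) \<longlongrightarrow> 0) at_top"
    "\<forall>\<^sub>F x in at_top. 0 \<le> k x"
  shows "((\<lambda>x. k x * u x) \<longlongrightarrow> l) at_top"
proof -
  have "((\<lambda>x. k x * (u x - v x)) \<longlongrightarrow> 0) at_top"
  proof (rule Lim_null_comparison[OF _ assms(3)])
    show "\<forall>\<^sub>F x in at_top. norm (k x * (u x - v x)) \<le> k x * w x"
      using assms(1,4) by eventually_elim (simp add: abs_mult mult_left_mono)
  qed
  from tendsto_add[OF this assms(2)] show ?thesis by (simp add: algebra_simps)
qed

text \<open>The asymptotic curve is pulled back until its pair leaves (-1, 0)^2. At the limiting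
  parameter Z the signs of both components are still strict and the second is still above -1, so the
  exit can only occur through first component -1; then Z is moved to 0.\<close>

theorem stable_curve_exists: "\<exists>a b a' b'. stable_curve a b a' b'"
proof -
  obtain \<alpha> \<beta> \<alpha>' \<beta>' :: "real \<Rightarrow> real" and R :: real where R: "1000 < R"
    and an: "\<And>x. R < x \<Longrightarrow> ranal \<alpha> x \<and> ranal \<beta> x"
    and der: "\<And>x. R < x \<Longrightarrow> (\<alpha> has_real_derivative \<alpha>' x) (at x) \<and> (\<beta> has_real_derivative \<beta>' x) (at x)"
    and bd: "\<And>x. R < x \<Longrightarrow> \<bar>\<alpha> x + 1 / (x - 1)\<bar> \<le> 100 / x^3 \<and> \<bar>\<beta> x + 1 / (x + 1)\<bar> \<le> 100 / x^3"
    and bd': "\<And>x. R < x \<Longrightarrow> \<bar>\<alpha>' x - 1 / (x - 1)^2\<bar> \<le> 100 / (x - 1)^3 \<and> \<bar>\<beta>' x - 1 / (x + 1)^2\<bar> \<le> 100 / (x - 1)^3"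
    and feq: "\<And>x. R < x \<Longrightarrow> (\<alpha> x, \<beta> x) = back3 (\<alpha> (x + 3), \<beta> (x + 3))"
    by (rule asymptotic_curve) blast
  have evR: "\<forall>\<^sub>F x in at_top. R < x" by (rule eventually_gt_at_top)
  have "\<forall>\<^sub>F x::real in at_top. 100 / x^3 < 1 / (x + 1) \<and> 100 / x^3 < 1 / (x - 1) \<and>
      1 / (x - 1) + 100 / x^3 < 1 \<and> 1 / (x + 1) + 100 / x^3 < 1 \<and>
      100 / (x - 1)^3 < 1 / (x - 1)^2 \<and> 100 / (x - 1)^3 < 1 / (x + 1)^2"
    by (intro eventually_conj; real_asymp)
  with evR have "\<forall>\<^sub>F x in at_top. -1 < \<alpha> x \<and> \<alpha> x < 0 \<and> -1 < \<beta> x \<and> \<beta> x < 0 \<and> 0 < \<alpha>' x \<and> 0 < \<beta>' x \<and> R < x"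
  proof eventually_elim
    case (elim x)
    show ?case using bd[OF elim(1)] bd'[OF elim(1)] elim by linarith
  qed
  then obtain R' where R': "\<And>x. R' \<le> x \<Longrightarrow>
      -1 < \<alpha> x \<and> \<alpha> x < 0 \<and> -1 < \<beta> x \<and> \<beta> x < 0 \<and> 0 < \<alpha>' x \<and> 0 < \<beta>' x \<and> R < x"
    unfolding eventually_at_top_linorder by blast
  \<comment> \<open>The number of triple steps that carry x beyond R'. This makes E total; divisions
    by zero may spoil it far to the left, but only parameters from Z on are kept.\<close>
  define n where "n = (\<lambda>x::real. nat (\<lfloor>(R' - x) / 3\<rfloor> + 1))"
  define E where "E = (\<lambda>x. (back3 ^^ n x) (\<alpha> (x + 3 * n x), \<beta> (x + 3 * n x)))"
  define A B where "A = (\<lambda>x. fst (E x))" and "B = (\<lambda>x. snd (E x))"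
  have n0: "n x = 0" if "R' < x" for x
  proof -
    have "(R' - x) / 3 < 0" using that by simp
    then have "\<lfloor>(R' - x) / 3\<rfloor> + 1 \<le> 0" by linarith
    then show ?thesis by (simp only: n_def nat_0_iff)
  qed
  have nS: "n x = Suc (n (x + 3))" if "x \<le> R'" for x
  proof -
    have "0 \<le> \<lfloor>(R' - x) / 3\<rfloor>" using that by (simp add: zero_le_floor)
    moreover have "(R' - x) / 3 = (R' - (x + 3)) / 3 + 1" by (simp add: field_simps)
    then have "\<lfloor>(R' - x) / 3\<rfloor> = \<lfloor>(R' - (x + 3)) / 3\<rfloor> + 1" by linarith
    ultimately show ?thesis by (simp add: n_def nat_add_distrib)
  qed
  have E0: "E x = (\<alpha> x, \<beta> x)" if "R' < x" for x using n0[OF that] by (simp add: E_def)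
  have ES: "E x = back3 (E (x + 3))" for x
  proof (cases "x \<le> R'")
    case True
    then show ?thesis using nS[OF True] by (simp add: E_def algebra_simps)
  next
    case False
    then show ?thesis using E0[of x] E0[of "x + 3"] feq[of x] R'[of x] by simp
  qed
  define N where "N = (\<lambda>x. -1 < A x \<and> A x < 0 \<and> -1 < B x \<and> B x < 0)"
  define c where "c = (\<lambda>x. bk (A (x + 3)) (B (x + 3)))"
  have Bx: "B x = bk (c x) (A (x + 3))" and Ax: "A x = bk (B x) (c x)" for x
    using ES[of x] by (simp_all add: A_def B_def c_def back3_def Let_def)
  define good where "good = (\<lambda>x. \<exists>p q. ranal A x \<and> ranal B x \<and> (A has_real_derivative p) (at x) \<and>
      (B has_real_derivative q) (at x) \<and> 0 < p \<and> 0 < q)"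
  have good_step: "good x" if x: "good (x + 3)" "N (x + 3)" "-1 < B x" for x
  proof -
    obtain d' e' where d': "ranal A (x + 3)" "ranal B (x + 3)" "(A has_real_derivative d') (at (x + 3))"
      "(B has_real_derivative e') (at (x + 3))" "0 < d'" "0 < e'"
      using x(1) unfolding good_def by blast
    have N3: "-1 < A (x + 3)" "A (x + 3) < 0" "-1 < B (x + 3)" "B (x + 3) < 0" using x(2) by (auto simp: N_def)
    have cp: "0 < c x" using bk_pos(1)[OF N3 c_def[THEN fun_cong] Bx Ax] .
    define c' where "c' = ((B (x + 3) - 1 - c x) * d' + (A (x + 3) - 1) * e') / (1 + A (x + 3))"
    define q where "q = ((A (x + 3) - 1 - B x) * c' + (c x - 1) * d') / (1 + c x)"
    define p where "p = ((c x - 1 - A x) * q + (B x - 1) * c') / (1 + B x)"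
    have dc: "(c has_real_derivative c') (at x)"
      unfolding c_def c'_def
      by (rule bk_has_derivative[OF deriv_shift[OF d'(3)] deriv_shift[OF d'(4)]]) (use N3 in auto)
    have "((\<lambda>x. bk (c x) (A (x + 3))) has_real_derivative q) (at x)"
      unfolding q_def Bx by (rule bk_has_derivative[OF dc deriv_shift[OF d'(3)]]) (use cp in auto)
    then have dB: "(B has_real_derivative q) (at x)" using Bx by presburger
    have "((\<lambda>x. bk (B x) (c x)) has_real_derivative p) (at x)"
      unfolding p_def Ax by (rule bk_has_derivative[OF dB dc]) (use x(3) in auto)
    then have dA: "(A has_real_derivative p) (at x)" using Ax by presburger
    have rc: "ranal c x" unfolding c_def
      by (rule ranal_bk[OF ranal_shift[OF d'(1)] ranal_shift[OF d'(2)]]) (use N3 in auto)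
    have "ranal (\<lambda>x. bk (c x) (A (x + 3))) x"
      by (rule ranal_bk[OF rc ranal_shift[OF d'(1)]]) (use cp in auto)
    then have rB: "ranal B x" using Bx by presburger
    have "ranal (\<lambda>x. bk (B x) (c x)) x" by (rule ranal_bk[OF rB rc]) (use x(3) in auto)
    then have rA: "ranal A x" using Ax by presburger
    note cone = N3 c_def[THEN fun_cong] Bx Ax d'(5,6) c'_def q_def p_def
    show ?thesis unfolding good_def using rA rB dA dB cone_a[OF cone x(3)] cone_b[OF cone] by blast
  qed
  have goodR: "good x" if "R' < x" for x
  proof -
    have ev: "\<forall>\<^sub>F s in nhds x. R' < s" using eventually_nhds_in_open[of "{R'<..}" x] that by simp
    have e: "\<forall>\<^sub>F s in nhds x. \<alpha> s = A s" "\<forall>\<^sub>F s in nhds x. \<beta> s = B s"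
      using ev by (eventually_elim, simp add: A_def B_def E0)+
    have x: "R < x" "0 < \<alpha>' x" "0 < \<beta>' x" using R'[of x] that by auto
    have "ranal A x" "ranal B x" using ranal_cong an[OF x(1)] e by blast+
    moreover have "(A has_real_derivative \<alpha>' x) (at x)" "(B has_real_derivative \<beta>' x) (at x)"
      using DERIV_cong_ev[OF refl e(1) refl] DERIV_cong_ev[OF refl e(2) refl] der[OF x(1)] by blast+
    ultimately show ?thesis unfolding good_def using x by blast
  qed
  define S where "S = {x. \<forall>w\<ge>x. N w}"
  have good_S: "good x" if "x \<in> S" for x
  proof -
    have "good (x + 3 * real m) \<Longrightarrow> good x" for m
    proof (induction m)
      case (Suc m)
      have "N (x + 3 * real m)" "N (x + 3 * real m + 3)" using that by (auto simp: S_def)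
      then have "good (x + 3 * real m)"
        using Suc.prems good_step[of "x + 3 * real m"] by (simp add: N_def algebra_simps)
      then show ?case by (rule Suc.IH)
    qed simp
    moreover obtain m :: nat where "R' - x < 3 * real m"
      using reals_Archimedean3[of 3] by (metis mult.commute zero_less_numeral)
    ultimately show ?thesis using goodR[of "x + 3 * real m"] by simp
  qed
  have RS: "R' + 1 \<in> S" unfolding S_def using R' E0 by (auto simp: N_def A_def B_def)
  have c_props: "0 < c x" "c x < 1" "c x + (c x)^2 \<le> c (x - 3)" if "N x" "N (x + 3)" for x
  proof -
    have N3: "-1 < A (x + 3)" "A (x + 3) < 0" "-1 < B (x + 3)" "B (x + 3) < 0" using that by (auto simp: N_def)
    show cp: "0 < c x" using bk_pos(1)[OF N3 c_def[THEN fun_cong] Bx Ax] .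
    show "c x < 1" "c x + (c x)^2 \<le> c (x - 3)"
      using bk_growth[of "A x" "B x" "c x"] that(1) cp Ax[of x] by (auto simp: N_def c_def)
  qed
  \<comment> \<open>Otherwise c would increase at least linearly along 0, -3, -6, ..., contradicting
    c < 1.\<close>
  have bdd: "bdd_below S"
  proof (rule ccontr)
    assume "\<not> bdd_below S"
    then have "\<exists>y\<in>S. y < x" for x unfolding bdd_below_def by (meson not_le)
    then have all: "N x" for x unfolding S_def by (metis (mono_tags, lifting) less_imp_le mem_Collect_eq)
    have gr: "c 0 + real k * (c 0)^2 \<le> c (0 - 3 * real k)" for k
    proof (induction k)
      case (Suc k)
      have "c 0 \<le> c (0 - 3 * real k)"
      proof -
        have "0 \<le> real k * (c 0)^2" by simp
        then show ?thesis using Suc by linarith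
      qed
      then have "(c 0)^2 \<le> (c (0 - 3 * real k))^2" using c_props(1)[of 0] all by (intro power_mono) (auto simp: less_imp_le)
      moreover have "c (0 - 3 * real k) + (c (0 - 3 * real k))^2 \<le> c (0 - 3 * real k - 3)"
        using c_props(3) all by blast
      moreover have "c (0 - 3 * real k - 3) = c (0 - 3 * real (Suc k))" by (rule arg_cong) simp
      moreover have "c 0 + real (Suc k) * (c 0)^2 = c 0 + real k * (c 0)^2 + (c 0)^2" by (simp add: distrib_right)
      ultimately show ?case using Suc by linarith
    qed simp
    have c0: "0 < c 0" by (rule c_props(1)[OF all all])
    then have "0 < (c 0)^2" by simp
    then obtain k :: nat where k: "1 < real k * (c 0)^2" using reals_Archimedean3 by blast
    have "c (0 - 3 * real k) < 1" by (rule c_props(2)[OF all all])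
    then show False using gr[of k] k c0 by linarith
  qed
  define Z where "Z = Inf S"
  have ZN: "N w" if "Z < w" for w
  proof -
    have "S \<noteq> {}" using RS by auto
    then obtain x where x: "x \<in> S" "x < w" using cInf_lessD[of S w] \<open>Z < w\<close>[unfolded Z_def] by auto
    then have "x \<le> w" by simp
    with x(1) show ?thesis unfolding S_def by blast
  qed
  have ZS: "w \<in> S" if "Z < w" for w
    unfolding S_def using ZN that less_le_trans by blast
  have N3: "-1 < A (Z + 3)" "A (Z + 3) < 0" "-1 < B (Z + 3)" "B (Z + 3) < 0" using ZN[of "Z + 3"] by (auto simp: N_def)
  note step = N3 c_def[THEN fun_cong] Bx Ax
  have cp: "0 < c Z" using bk_pos(1)[OF step] .
  have cont: "isCont A w" "isCont B w" if wZ: "Z < w" for w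
  proof -
    obtain p q where "(A has_real_derivative p) (at w)" "(B has_real_derivative q) (at w)"
      using good_S[OF ZS[OF wZ]] unfolding good_def by blast
    then show "isCont A w" "isCont B w" by (auto intro: DERIV_isCont)
  qed
  have cA3: "isCont (\<lambda>x. A (x + 3)) Z" and cB3: "isCont (\<lambda>x. B (x + 3)) Z"
    by (rule isCont_o2[of Z "\<lambda>x. x + 3"], simp, rule cont, simp)+
  have cc: "isCont c Z" unfolding c_def bk_def using N3 by (intro continuous_intros cA3 cB3) auto
  have "isCont (\<lambda>x. bk (c x) (A (x + 3))) Z" unfolding bk_def using cp by (intro continuous_intros cA3 cc) auto
  then have cB: "isCont B Z" using Bx by presburger
  have right: "at_right Z \<noteq> bot" by simp
  have evr: "\<forall>\<^sub>F x in at_right Z. N x" using eventually_at_right_less[of Z] by eventually_elim (rule ZN)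
  have tr: "(h \<longlongrightarrow> h Z) (at_right Z)" if "isCont h Z" for h :: "real \<Rightarrow> real"
    using that by (simp add: isCont_def filterlim_at_split)
  \<comment> \<open>This is (1 + A)(1 + B) \<ge> 0 with A eliminated. The product form is used
    because B Z > -1, which would permit a division, is what the bound is meant to give.\<close>
  have "c Z * (1 - B Z) \<le> 1"
  proof (rule tendsto_upperbound[OF _ _ right])
    show "((\<lambda>x. c x * (1 - B x)) \<longlongrightarrow> c Z * (1 - B Z)) (at_right Z)" by (intro tendsto_intros tr cc cB)
    show "\<forall>\<^sub>F x in at_right Z. c x * (1 - B x) \<le> 1"
      using evr
    proof eventually_elim
      case (elim x)
      then have p: "0 < 1 + A x" "0 < 1 + B x" by (auto simp: N_def)
      have "1 + A x = (1 + B x * c x - c x) / (1 + B x)"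
        unfolding Ax[of x] using elim by (intro one_plus_bk) (simp add: N_def)
      with p have "0 < 1 + B x * c x - c x" by (simp add: zero_less_divide_iff)
      then show ?case by (simp add: algebra_simps)
    qed
  qed
  moreover have B0: "B Z < 0" using bk2_neg[OF step] .
  moreover have "0 < c Z * (- B Z)" using cp B0 by (intro mult_pos_pos) auto
  ultimately have "c Z \<le> 1" by (simp add: algebra_simps)
  then have B1: "-1 < B Z" using bk2_gt[OF step] by simp
  have "isCont (\<lambda>x. bk (B x) (c x)) Z" unfolding bk_def using B1 by (intro continuous_intros cB cc) auto
  then have cA: "isCont A Z" using Ax by presburger
  have A0: "A Z < 0" using bk3_neg[OF step B1] .
  have "-1 \<le> A Z"
    by (rule tendsto_lowerbound[OF tr[OF cA] _ right]) (use evr in \<open>auto elim!: eventually_mono simp: N_def\<close>)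
  \<comment> \<open>If A Z exceeded -1, all the strict inequalities of N would persist on a
    neighbourhood of Z, to the left of the infimum.\<close>
  moreover have "\<not> -1 < A Z"
  proof
    assume A1: "-1 < A Z"
    have "\<forall>\<^sub>F x in nhds Z. -1 < A x" "\<forall>\<^sub>F x in nhds Z. A x < 0" "\<forall>\<^sub>F x in nhds Z. -1 < B x" "\<forall>\<^sub>F x in nhds Z. B x < 0"
      using order_tendstoD[OF cA[unfolded isCont_def tendsto_at_iff_tendsto_nhds]]
        order_tendstoD[OF cB[unfolded isCont_def tendsto_at_iff_tendsto_nhds]] A0 A1 B0 B1 by blast+
    then have "\<forall>\<^sub>F x in nhds Z. N x" unfolding N_def by eventually_elim auto
    then obtain r where r: "0 < r" "\<And>x. \<bar>x - Z\<bar> < r \<Longrightarrow> N x"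
      by (auto simp: eventually_nhds_metric dist_real_def)
    have "Z - r / 2 \<in> S" unfolding S_def
    proof clarify
      fix w assume "Z - r / 2 \<le> w"
      then show "N w" using r ZN[of w] by (cases "Z < w") auto
    qed
    then have "Z \<le> Z - r / 2" unfolding Z_def using bdd by (rule cInf_lower)
    then show False using r by simp
  qed
  ultimately have AZ: "A Z = -1" by simp
  have goodZ: "good w" if "Z \<le> w" for w
  proof (cases "Z < w")
    case True then show ?thesis using good_S ZS by blast
  next
    case False
    then have "w = Z" using that by simp
    then show ?thesis using good_step[of Z] good_S[OF ZS[of "Z + 3"]] ZN[of "Z + 3"] B1 by simp
  qed
  define A' B' where "A' = deriv A" and "B' = deriv B"
  have dAB: "(A has_real_derivative A' w) (at w)" "(B has_real_derivative B' w) (at w)" "0 < A' w" "0 < B' w"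
    "ranal A w" "ranal B w" if wZ: "Z \<le> w" for w
  proof -
    obtain p q where pq: "ranal A w" "ranal B w" "(A has_real_derivative p) (at w)"
        "(B has_real_derivative q) (at w)" "0 < p" "0 < q"
      using goodZ[OF wZ] unfolding good_def by blast
    then have "A' w = p" "B' w = q" by (auto simp: A'_def B'_def DERIV_imp_deriv)
    with pq show "(A has_real_derivative A' w) (at w)" "(B has_real_derivative B' w) (at w)" "0 < A' w" "0 < B' w"
      "ranal A w" "ranal B w" by simp_all
  qed
  have evA: "\<forall>\<^sub>F x in at_top. R' < x" by (rule eventually_gt_at_top)
  have A'_eq: "A' x = \<alpha>' x" "B' x = \<beta>' x" if "R' < x" for x
  proof -
    have ev: "\<forall>\<^sub>F s in nhds x. R' < s" using eventually_nhds_in_open[of "{R'<..}" x] that by simp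
    have e: "\<forall>\<^sub>F s in nhds x. \<alpha> s = A s" "\<forall>\<^sub>F s in nhds x. \<beta> s = B s"
      using ev by (eventually_elim, simp add: A_def B_def E0)+
    have x: "R < x" using R'[of x] that by auto
    show "A' x = \<alpha>' x" "B' x = \<beta>' x" unfolding A'_def B'_def
      using DERIV_cong_ev[OF refl e(1) refl] DERIV_cong_ev[OF refl e(2) refl] der[OF x] by (blast intro: DERIV_imp_deriv)+
  qed
  have top: "filterlim (\<lambda>x. x + Z) at_top at_top" by real_asymp
  have shift: "\<forall>\<^sub>F x in at_top. P (x + Z)" if "\<forall>\<^sub>F x in at_top. P x" for P :: "real \<Rightarrow> bool"
    using eventually_compose_filterlim[OF that top] .
  have "\<forall>\<^sub>F x in at_top. \<bar>A x - - 1 / (x - 1)\<bar> \<le> 100 / x^3 \<and> \<bar>B x - - 1 / (x + 1)\<bar> \<le> 100 / x^3 \<and>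
      \<bar>A' x - 1 / (x - 1)^2\<bar> \<le> 100 / (x - 1)^3 \<and> \<bar>B' x - 1 / (x + 1)^2\<bar> \<le> 100 / (x - 1)^3"
    using evA
  proof eventually_elim
    case (elim x)
    show ?case using bd[of x] bd'[of x] R'[of x] elim A'_eq[of x] E0[of x] by (simp add: A_def B_def)
  qed
  from shift[OF this]
  have ev: "\<forall>\<^sub>F x in at_top. \<bar>A (x + Z) - - 1 / (x + Z - 1)\<bar> \<le> 100 / (x + Z)^3"
    "\<forall>\<^sub>F x in at_top. \<bar>B (x + Z) - - 1 / (x + Z + 1)\<bar> \<le> 100 / (x + Z)^3"
    "\<forall>\<^sub>F x in at_top. \<bar>A' (x + Z) - 1 / (x + Z - 1)^2\<bar> \<le> 100 / (x + Z - 1)^3"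
    "\<forall>\<^sub>F x in at_top. \<bar>B' (x + Z) - 1 / (x + Z + 1)^2\<bar> \<le> 100 / (x + Z - 1)^3"
    by (eventually_elim, simp)+
  have pos: "\<forall>\<^sub>F x::real in at_top. 0 \<le> x" by (rule eventually_ge_at_top)
  have pos2: "\<forall>\<^sub>F x::real in at_top. 0 \<le> x^2" by simp
  have "stable_curve (\<lambda>x. A (x + Z)) (\<lambda>x. B (x + Z)) (\<lambda>x. A' (x + Z)) (\<lambda>x. B' (x + Z))"
  proof
    show "A (0 + Z) = - 1" using AZ by simp
    show "- 1 < A (x + Z) \<and> A (x + Z) < 0" if "0 < x" for x using ZN[of "x + Z"] that by (simp add: N_def)
    show "- 1 < B (x + Z) \<and> B (x + Z) < 0" if "0 \<le> x" for x
      using ZN[of "x + Z"] that B0 B1 by (cases "x = 0") (auto simp: N_def)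
    fix x :: real assume x: "0 \<le> x"
    then have xZ: "Z \<le> x + Z" by simp
    show "ranal (\<lambda>x. A (x + Z)) x \<and> ranal (\<lambda>x. B (x + Z)) x"
      using dAB(5,6)[OF xZ] ranal_shift by blast
    show "((\<lambda>x. A (x + Z)) has_real_derivative A' (x + Z)) (at x)"
      "((\<lambda>x. B (x + Z)) has_real_derivative B' (x + Z)) (at x)"
      using dAB(1,2)[OF xZ] deriv_shift by blast+
    show "0 < A' (x + Z) \<and> 0 < B' (x + Z)" using dAB(3,4)[OF xZ] by simp
    show "(A (x + Z), B (x + Z)) = back3 (A (x + 3 + Z), B (x + 3 + Z))"
    proof -
      have "x + Z + 3 = x + 3 + Z" by simp
      then have "E (x + Z) = back3 (E (x + 3 + Z))" using ES[of "x + Z"] by (simp only:)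
      then show ?thesis by (simp add: A_def B_def)
    qed
  next
    show "((\<lambda>x. x * A (x + Z)) \<longlongrightarrow> -1) at_top"
      by (rule squeeze_asymp[OF ev(1) _ _ pos]; real_asymp)
    show "((\<lambda>x. x * B (x + Z)) \<longlongrightarrow> -1) at_top"
      by (rule squeeze_asymp[OF ev(2) _ _ pos]; real_asymp)
    show "((\<lambda>x. x^2 * A' (x + Z)) \<longlongrightarrow> 1) at_top"
      by (rule squeeze_asymp[OF ev(3) _ _ pos2]; real_asymp)
    show "((\<lambda>x. x^2 * B' (x + Z)) \<longlongrightarrow> 1) at_top"
      by (rule squeeze_asymp[OF ev(4) _ _ pos2]; real_asymp)
  qed
  then show ?thesis by blast
qed

section \<open>Uniqueness of the stable curve near the fixed point\<close>

text \<open>Three forward steps as polynomial relations: nothing has to be known about denominators,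
  and differences of two solutions become linear relations.\<close>

definition steps3 :: "real \<Rightarrow> real \<Rightarrow> real \<Rightarrow> real \<Rightarrow> real \<Rightarrow> bool" where
  "steps3 a b c d e \<longleftrightarrow> c * (b - 1) = a + b + a * b \<and> d * (c - 1) = b + c + b * c \<and> e * (d - 1) = c + d + c * d"

text \<open>To first order the next term is u = -(a + b), and after three steps the pair returns to
  itself, so all discrepancies are of order u^2.\<close>

lemma steps3_near:
  assumes "steps3 a b c d e" "a \<le> 0" "b \<le> 0" and u: "u = - (a + b)" "0 < u" "u \<le> 1/1000"
  shows "\<bar>a\<bar> \<le> u" "\<bar>b\<bar> \<le> u" "\<bar>c\<bar> \<le> 11/10 * u" "\<bar>d\<bar> \<le> 11/10 * u" "\<bar>e\<bar> \<le> 11/10 * u"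
    "\<bar>c - u\<bar> \<le> 3 * (u * u)" "\<bar>d - a\<bar> \<le> 5 * (u * u)" "\<bar>e - b\<bar> \<le> 6 * (u * u)"
proof -
  have uu: "0 < u * u" "u * u \<le> u / 1000" using u by (auto simp: mult_le_cancel_left)
  have q: "\<bar>y\<bar> \<le> 102/100 * B" if "y * z = w" "\<bar>w\<bar> \<le> B" "z \<le> - (99/100)" for y z w B :: real
  proof -
    have "\<bar>y\<bar> * (99/100) \<le> \<bar>y\<bar> * \<bar>z\<bar>" using that by (intro mult_left_mono) auto
    also have "\<dots> \<le> B" using that by (simp add: abs_mult[symmetric])
    finally show ?thesis using abs_ge_zero[of w] that(2) by linarith
  qed
  have c: "c * (b - 1) = a + b + a * b" and d: "d * (c - 1) = b + c + b * c" and e: "e * (d - 1) = c + d + c * d"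
    using assms(1) by (auto simp: steps3_def)
  show na: "\<bar>a\<bar> \<le> u" and nb: "\<bar>b\<bar> \<le> u" using assms by auto
  have m: "\<bar>x * y\<bar> \<le> k * l * (u * u)" if "\<bar>x\<bar> \<le> k * u" "\<bar>y\<bar> \<le> l * u" for x y k l :: real
  proof -
    have "0 \<le> k * u" using that(1) abs_ge_zero order_trans by blast
    then have "\<bar>x * y\<bar> \<le> (k * u) * (l * u)" unfolding abs_mult using that by (intro mult_mono) auto
    then show ?thesis by (simp add: mult_ac)
  qed
  have na1: "\<bar>a\<bar> \<le> 1 * u" and nb1: "\<bar>b\<bar> \<le> 1 * u" using na nb by simp_all
  note mab = m[OF na1 nb1]
  have "\<bar>a + b + a * b\<bar> \<le> 101/100 * u" using mab uu u by linarith
  then show nc: "\<bar>c\<bar> \<le> 11/10 * u" using q[OF c, of "101/100 * u"] assms(3) u by linarith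
  note mbc = m[OF nb1 nc]
  have "c - u = b * c - a * b" using c u by (simp add: algebra_simps)
  then show cu: "\<bar>c - u\<bar> \<le> 3 * (u * u)" using mab mbc by linarith
  have "b + c + b * c = - a + (c - u) + b * c" using u by simp
  then have "\<bar>b + c + b * c\<bar> \<le> 101/100 * u" using cu mbc na uu u by linarith
  then show nd: "\<bar>d\<bar> \<le> 11/10 * u" using q[OF d, of "101/100 * u"] nc u by linarith
  note mcd = m[OF nc nd]
  have "d - a = a * b + c * d - 2 * (b * c)" using c d by (simp add: algebra_simps)
  then show da: "\<bar>d - a\<bar> \<le> 5 * (u * u)" using mab mbc mcd uu by linarith
  have "c + d + c * d = - b + (c - u) + (d - a) + c * d" using u by simp
  then have "\<bar>c + d + c * d\<bar> \<le> 102/100 * u" using cu da mcd nb uu u by linarith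
  then show ne: "\<bar>e\<bar> \<le> 11/10 * u" using q[OF e, of "102/100 * u"] nd u by linarith
  note mde = m[OF nd ne]
  have "e - b = b * c + d * e - 2 * (c * d)" using d e by (simp add: algebra_simps)
  then show "\<bar>e - b\<bar> \<le> 6 * (u * u)" using mbc mcd mde uu by linarith
qed

lemma mean_abs: "\<bar>x\<bar> \<le> k \<Longrightarrow> \<bar>y\<bar> \<le> k \<Longrightarrow> \<bar>(x + y) / 2\<bar> \<le> k" for x y k :: real
  using mean_bound[of x 0 k y] by simp

text \<open>Two pairs with the same sum differ by a multiple t of the direction (-1, 1). To second
  order this difference is multiplied by 1 + 3 u, while the difference of the sums becomes (ma - mb)
  t, of size at most u |t|; the stated 1 + 2 u and 2 u leave room for the remainders.\<close>

lemma steps3_expand: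
  assumes s: "steps3 a b c d e" "a \<le> 0" "b \<le> 0" "u = - (a + b)"
    and s': "steps3 a' b' c' d' e'" "a' \<le> 0" "b' \<le> 0" "u = - (a' + b')"
    and u: "0 < u" "u \<le> 1/1000"
    and t: "t = (b - a) - (b' - a')"
  shows "(1 + 2 * u) * \<bar>t\<bar> \<le> \<bar>(e - d) - (e' - d')\<bar>" "\<bar>(d + e) - (d' + e')\<bar> \<le> 2 * u * \<bar>t\<bar>"
proof -
  note n = steps3_near[OF s u] and n' = steps3_near[OF s' u]
  define ma mb mc md me where "ma = (a + a') / 2" and "mb = (b + b') / 2" and "mc = (c + c') / 2"
    and "md = (d + d') / 2" and "me = (e + e') / 2"
  define T where "T = \<bar>t\<bar>"
  have uu: "0 < u * u" "u * u \<le> u / 1000" using u by (auto simp: mult_le_cancel_left)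
  have T: "0 \<le> T" "0 \<le> u * T" "u * T \<le> T / 1000" "0 \<le> u * u * T" "u * u * T \<le> u * T / 1000"
  proof -
    show T0: "0 \<le> T" by (simp add: T_def)
    show "0 \<le> u * T" "0 \<le> u * u * T" using u T0 by simp_all
    show "u * T \<le> T / 1000" using mult_right_mono[OF u(2) T0] by simp
    show "u * u * T \<le> u * T / 1000" using mult_right_mono[OF uu(2) T0] by simp
  qed
  \<comment> \<open>The linear part reproduces d - d' = -t/2 and e - e' = t/2; \<open>dd\<close> and
    \<open>de\<close> are the deviations from these values.\<close>
  define dc dd de where "dc = c - c'" and "dd = (d - d') + t / 2" and "de = (e - e') - t / 2"
  have ab: "a - a' = - t / 2" "b - b' = t / 2" using s(4) s'(4) t by simp_all
  have nm: "\<bar>ma\<bar> \<le> u" "\<bar>mb\<bar> \<le> u" "\<bar>mc\<bar> \<le> 11/10 * u" "\<bar>md\<bar> \<le> 11/10 * u" "\<bar>me\<bar> \<le> 11/10 * u"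
    unfolding ma_def mb_def mc_def md_def me_def
    by (rule mean_abs[OF n(1) n'(1)] mean_abs[OF n(2) n'(2)] mean_abs[OF n(3) n'(3)]
        mean_abs[OF n(4) n'(4)] mean_abs[OF n(5) n'(5)])+
  have nmc: "\<bar>mc - u\<bar> \<le> 3 * (u * u)" and nmd: "\<bar>md - ma\<bar> \<le> 5 * (u * u)" and nme: "\<bar>me - mb\<bar> \<le> 6 * (u * u)"
  proof -
    have "mc - u = ((c - u) + (c' - u)) / 2" "md - ma = ((d - a) + (d' - a')) / 2" "me - mb = ((e - b) + (e' - b')) / 2"
      unfolding ma_def mb_def mc_def md_def me_def by (simp_all add: field_simps)
    then show "\<bar>mc - u\<bar> \<le> 3 * (u * u)" "\<bar>md - ma\<bar> \<le> 5 * (u * u)" "\<bar>me - mb\<bar> \<le> 6 * (u * u)"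
      using mean_abs[OF n(6) n'(6)] mean_abs[OF n(7) n'(7)] mean_abs[OF n(8) n'(8)] by (simp_all only:)
  qed
  have mab: "ma + mb = - u"
  proof -
    have "2 * ma + 2 * mb = (a + b) + (a' + b')" by (simp add: ma_def mb_def field_simps)
    then show ?thesis using s(4) s'(4) by linarith
  qed
  have nt: "\<bar>t / 2\<bar> \<le> T / 2" by (simp add: T_def)
  have rep: "a = ma - t / 4" "a' = ma + t / 4" "b = mb + t / 4" "b' = mb - t / 4"
      "c = mc + dc / 2" "c' = mc - dc / 2" "d = md + dd / 2 - t / 4" "d' = md - dd / 2 + t / 4"
      "e = me + de / 2 + t / 4" "e' = me - de / 2 - t / 4"
  proof -
    have t1: "t = 2 * (a' - a)" and t2: "t = 2 * (b - b')" using ab by simp_all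
    show "a = ma - t / 4" "a' = ma + t / 4" unfolding ma_def t1 by (simp_all add: field_simps)
    show "b = mb + t / 4" "b' = mb - t / 4" unfolding mb_def t2 by (simp_all add: field_simps)
    show "c = mc + dc / 2" "c' = mc - dc / 2" "d = md + dd / 2 - t / 4" "d' = md - dd / 2 + t / 4"
      "e = me + de / 2 + t / 4" "e' = me - de / 2 - t / 4"
      unfolding mc_def md_def me_def dc_def dd_def de_def by (simp_all add: field_simps)
  qed
  note S = s(1)[unfolded steps3_def rep] and S' = s'(1)[unfolded steps3_def rep]
  have ic: "dc = mb * dc + mc * (t / 2) - ma * (t / 2) + mb * (t / 2)"
    using S[THEN conjunct1] S'[THEN conjunct1] by (simp add: algebra_simps)
  have idd: "dd = mc * dd - 2 * (mb * dc) + md * dc - 2 * (mc * (t / 2)) + ma * (t / 2) - mb * (t / 2) - mc * (t / 2)"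
    using S[THEN conjunct2, THEN conjunct1] S'[THEN conjunct2, THEN conjunct1] ic by (simp add: algebra_simps)
  have ide: "de = 2 * (mc * (t / 2)) - 2 * (mc * dd) - 2 * (md * dc) + mb * dc + mc * (t / 2)
      - me * (t / 2) + me * dd + md * (t / 2) + md * de"
    using S[THEN conjunct2, THEN conjunct2] S'[THEN conjunct2, THEN conjunct2] idd ic by (simp add: algebra_simps)
  note nm = nm[folded real_norm_def] and nt = nt[folded real_norm_def]
    and nmc = nmc[folded real_norm_def] and nmd = nmd[folded real_norm_def] and nme = nme[folded real_norm_def]
  have small: "11/10 * (u * norm x) \<le> norm x / 100" for x :: real
    using mult_right_mono[of "11/10 * u" "1/100" "norm x"] u by simp
  have un: "0 \<le> u * norm x" for x :: real using u by simp
  have "norm dc \<le> u * norm dc + 11/10 * u * (T / 2) + u * (T / 2) + u * (T / 2)"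
    by (subst ic) (intro bounds nm nt order_refl)
  then have "norm dc \<le> u * norm dc + 31/20 * (u * T)" by (simp add: mult_ac)
  then have ndc: "norm dc \<le> 2 * (u * T)" using small[of dc] un[of dc] T by linarith
  have "norm dd \<le> 11/10 * u * norm dd + 2 * (u * (2 * (u * T))) + 11/10 * u * (2 * (u * T)) + 2 * (11/10 * u * (T / 2))
      + u * (T / 2) + u * (T / 2) + 11/10 * u * (T / 2)"
    by (subst idd) (intro bounds nm nt ndc order_refl)
  then have "norm dd \<le> 11/10 * (u * norm dd) + 31/5 * (u * u * T) + 53/20 * (u * T)" by (simp add: mult_ac)
  then have ndd: "norm dd \<le> 3 * (u * T)" using small[of dd] T by linarith
  have "norm de \<le> 2 * (11/10 * u * (T / 2)) + 2 * (11/10 * u * (3 * (u * T))) + 2 * (11/10 * u * (2 * (u * T)))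
      + u * (2 * (u * T)) + 11/10 * u * (T / 2) + 11/10 * u * (T / 2) + 11/10 * u * (3 * (u * T))
      + 11/10 * u * (T / 2) + 11/10 * u * norm de"
    by (subst ide) (intro bounds nm nt ndc ndd order_refl)
  then have "norm de \<le> 11/10 * (u * norm de) + 163/10 * (u * u * T) + 11/4 * (u * T)" by (simp add: mult_ac)
  then have nde: "norm de \<le> 3 * (u * T)" using small[of de] T by linarith
  define r1 where "r1 = mc * dd - 2 * (mb * dc) + md * dc - 3 * ((mc - u) * (t / 2))"
  have r1: "dd = - (3 * u - ma + mb) * (t / 2) + r1" unfolding r1_def using idd by (simp add: algebra_simps diff_divide_distrib add_divide_distrib)
  have b3: "norm (3 * x) \<le> 3 * X" if "norm x \<le> X" for x X :: real using that by simp
  have "norm r1 \<le> 11/10 * u * (3 * (u * T)) + 2 * (u * (2 * (u * T))) + 11/10 * u * (2 * (u * T)) + 3 * (3 * (u * u) * (T / 2))"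
    unfolding r1_def by (intro bound_add bound_diff bound_2mult b3 bound_mult nm nt ndc ndd nmc)
  then have "norm r1 \<le> 14 * (u * u * T)" by (simp add: mult_ac)
  then have nr1: "norm r1 \<le> 20 * (u * u * T)" using T by linarith
  define r2 where "r2 = 3 * ((mc - u) * (t / 2)) - (me - mb) * (t / 2) + (md - ma) * (t / 2)
    - 2 * (mc * dd) - 2 * (md * dc) + mb * dc + me * dd + md * de"
  have r2: "de = (3 * u - mb + ma) * (t / 2) + r2" unfolding r2_def using ide by (simp add: algebra_simps diff_divide_distrib add_divide_distrib)
  have "norm r2 \<le> 3 * (3 * (u * u) * (T / 2)) + 6 * (u * u) * (T / 2) + 5 * (u * u) * (T / 2)
    + 2 * (11/10 * u * (3 * (u * T))) + 2 * (11/10 * u * (2 * (u * T))) + u * (2 * (u * T)) + 11/10 * u * (3 * (u * T))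
    + 11/10 * u * (3 * (u * T))"
    unfolding r2_def by (intro bound_add bound_diff bound_2mult b3 bound_mult nm nt ndc ndd nde nmc nmd nme)
  then have "norm r2 \<le> 148/5 * (u * u * T)" by (simp add: mult_ac)
  then have nr2: "norm r2 \<le> 40 * (u * u * T)" using T by linarith
  note nr1 = nr1[unfolded real_norm_def] and nr2 = nr2[unfolded real_norm_def]
  have "(e - d) - (e' - d') = de - dd + t" by (simp add: dd_def de_def)
  also have "\<dots> = (1 + 3 * u) * t + (r2 - r1)" unfolding r1 r2 by (simp add: algebra_simps diff_divide_distrib add_divide_distrib)
  finally have "\<bar>(1 + 3 * u) * t\<bar> \<le> \<bar>(e - d) - (e' - d')\<bar> + 60 * (u * u * T)" using nr1 nr2 by linarith
  moreover have "\<bar>(1 + 3 * u) * t\<bar> = T + 3 * (u * T)"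
  proof -
    have "\<bar>1 + 3 * u\<bar> = 1 + 3 * u" using u by simp
    then show ?thesis unfolding abs_mult T_def by (simp add: distrib_right)
  qed
  ultimately show "(1 + 2 * u) * \<bar>t\<bar> \<le> \<bar>(e - d) - (e' - d')\<bar>"
    using T unfolding T_def[symmetric] by (simp add: algebra_simps)
  have "(d + e) - (d' + e') = dd + de" by (simp add: dd_def de_def)
  also have "\<dots> = (ma - mb) * t + (r1 + r2)" unfolding r1 r2 by (simp add: algebra_simps diff_divide_distrib add_divide_distrib)
  finally have "\<bar>(d + e) - (d' + e')\<bar> \<le> \<bar>(ma - mb) * t\<bar> + 60 * (u * u * T)" using nr1 nr2 by linarith
  moreover have "ma \<le> 0" "mb \<le> 0" using s(2,3) s'(2,3) by (simp_all add: ma_def mb_def)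
  then have "\<bar>ma - mb\<bar> \<le> u" using mab by linarith
  then have "\<bar>(ma - mb) * t\<bar> \<le> u * T" unfolding abs_mult T_def by (intro mult_right_mono) auto
  ultimately show "\<bar>(d + e) - (d' + e')\<bar> \<le> 2 * u * \<bar>t\<bar>"
    using T unfolding T_def[symmetric] by (simp add: algebra_simps)
qed

lemma steps3_back3:
  assumes "(a, b) = back3 (d, e)" "1 + d \<noteq> 0" "1 + bk d e \<noteq> 0" "1 + b \<noteq> 0"
  shows "steps3 a b (bk d e) d e"
proof -
  define c where "c = bk d e"
  have ab: "b = bk c d" "a = bk b c" using assms(1) by (auto simp: back3_def Let_def c_def)
  show ?thesis
    using bk_eq[OF assms(2), of e] bk_eq[OF assms(3), of d] bk_eq[OF assms(4), of c]
    unfolding steps3_def c_def[symmetric] ab(1)[symmetric] ab(2)[symmetric]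
    by (simp add: algebra_simps)
qed

context stable_curve
begin

lemma steps3_curve: "0 < x \<Longrightarrow> \<exists>c. steps3 (a x) (b x) c (a (x + 3)) (b (x + 3))"
proof -
  assume x: "0 < x"
  then have r: "-1 < a (x + 3)" "a (x + 3) < 0" "-1 < b (x + 3)" "b (x + 3) < 0" "-1 < b x"
    using a_range[of "x + 3"] b_range[of "x + 3"] b_range[of x] by auto
  have "0 < bk (a (x + 3)) (b (x + 3))" by (rule bk_pos(1)[OF r(1-4) refl refl refl])
  then have "steps3 (a x) (b x) (bk (a (x + 3)) (b (x + 3))) (a (x + 3)) (b (x + 3))"
    using x r by (intro steps3_back3 ab_back3) linarith+
  then show ?thesis by blast
qed

lemma curve_to_0: "(a \<longlongrightarrow> 0) at_top" "(b \<longlongrightarrow> 0) at_top"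
proof -
  have *: "(h \<longlongrightarrow> 0) at_top" if "((\<lambda>x. x * h x) \<longlongrightarrow> -1) at_top" for h :: "real \<Rightarrow> real"
  proof -
    have "((\<lambda>x. (x * h x) / x) \<longlongrightarrow> 0) at_top"
      by (rule real_tendsto_divide_at_top[OF that filterlim_ident])
    moreover have "\<forall>\<^sub>F x in at_top. (x * h x) / x = h x"
      using eventually_gt_at_top[of 0] by eventually_elim simp
    ultimately show ?thesis using Lim_transform_eventually by blast
  qed
  show "(a \<longlongrightarrow> 0) at_top" "(b \<longlongrightarrow> 0) at_top" using * a_asymp(1) b_asymp(1) by auto
qed

text \<open>Both derivatives are asymptotic to 1/x^2, so the curve becomes tangent to the diagonal;
  tolerances of 1/10 already give the ratio 0.2/1.8 < 1/4.\<close>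

lemma slope_eventually: "\<exists>X>0. \<forall>x\<ge>X. \<bar>b' x - a' x\<bar> \<le> 1/4 * (a' x + b' x)"
proof -
  have "\<forall>\<^sub>F x in at_top. \<bar>x^2 * a' x - 1\<bar> < 1/10 \<and> \<bar>x^2 * b' x - 1\<bar> < 1/10 \<and> 0 < x"
    using tendstoD[OF a_asymp(2), of "1/10"] tendstoD[OF b_asymp(2), of "1/10"]
    by (auto simp: dist_real_def eventually_conj_iff eventually_gt_at_top)
  then have "\<forall>\<^sub>F x in at_top. \<bar>b' x - a' x\<bar> \<le> 1/4 * (a' x + b' x) \<and> 0 < x"
  proof eventually_elim
    case (elim x)
    have "x^2 * \<bar>b' x - a' x\<bar> = \<bar>x^2 * b' x - x^2 * a' x\<bar>" by (simp add: abs_mult right_diff_distrib[symmetric])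
    also have "\<dots> \<le> 1/4 * (x^2 * a' x) + 1/4 * (x^2 * b' x)"
      using elim[THEN conjunct1] elim[THEN conjunct2, THEN conjunct1] by linarith
    also have "\<dots> = x^2 * (1/4 * (a' x + b' x))" by (simp add: algebra_simps)
    finally show ?case using elim by (simp add: mult_le_cancel_left)
  qed
  then show ?thesis unfolding eventually_at_top_linorder by blast
qed

text \<open>Both (a + b)/4 + (b - a) and (a + b)/4 - (b - a) are nondecreasing. This says that b - a
  is a Lipschitz function of a + b along the curve, without inverting a + b.\<close>

lemma slope_bound:
  assumes X: "0 < X" "\<forall>x\<ge>X. \<bar>b' x - a' x\<bar> \<le> 1/4 * (a' x + b' x)" and y: "X \<le> y" "X \<le> y'"
  shows "\<bar>(b y - a y) - (b y' - a y')\<bar> \<le> 1/4 * \<bar>(a y + b y) - (a y' + b y')\<bar>"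
proof -
  have *: "\<bar>(b y - a y) - (b y' - a y')\<bar> \<le> 1/4 * ((a y' + b y') - (a y + b y))" if "X \<le> y" "y \<le> y'" for y y'
  proof -
    have "(b y - a y) + 1/4 * (a y + b y) \<le> (b y' - a y') + 1/4 * (a y' + b y')"
    proof (rule DERIV_nonneg_imp_nondecreasing[OF that(2)])
      fix x assume "y \<le> x" "x \<le> y'"
      then have x: "0 \<le> x" "X \<le> x" using that X by auto
      then show "\<exists>k. ((\<lambda>y. (b y - a y) + 1/4 * (a y + b y)) has_real_derivative k) (at x) \<and> 0 \<le> k"
      proof (intro exI conjI)
        show "((\<lambda>y. (b y - a y) + 1/4 * (a y + b y)) has_real_derivative (b' x - a' x) + 1/4 * (a' x + b' x)) (at x)"
          by (intro DERIV_add DERIV_diff DERIV_minus DERIV_cmult a_deriv b_deriv x)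
        show "0 \<le> (b' x - a' x) + 1/4 * (a' x + b' x)" using X(2)[rule_format, OF x(2)] by linarith
      qed
    qed
    moreover have "- (b y - a y) + 1/4 * (a y + b y) \<le> - (b y' - a y') + 1/4 * (a y' + b y')"
    proof (rule DERIV_nonneg_imp_nondecreasing[OF that(2)])
      fix x assume "y \<le> x" "x \<le> y'"
      then have x: "0 \<le> x" "X \<le> x" using that X by auto
      then show "\<exists>k. ((\<lambda>y. - (b y - a y) + 1/4 * (a y + b y)) has_real_derivative k) (at x) \<and> 0 \<le> k"
      proof (intro exI conjI)
        show "((\<lambda>y. - (b y - a y) + 1/4 * (a y + b y)) has_real_derivative - (b' x - a' x) + 1/4 * (a' x + b' x)) (at x)"
          by (intro DERIV_add DERIV_diff DERIV_minus DERIV_cmult a_deriv b_deriv x)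
        show "0 \<le> - (b' x - a' x) + 1/4 * (a' x + b' x)" using X(2)[rule_format, OF x(2)] by linarith
      qed
    qed
    ultimately show ?thesis unfolding distrib_left right_diff_distrib by linarith
  qed
  have **: "\<bar>(b y - a y) - (b y' - a y')\<bar> \<le> 1/4 * \<bar>(a y + b y) - (a y' + b y')\<bar>" if "X \<le> y" "y \<le> y'" for y y'
    by (rule order_trans[OF *[OF that]]) (intro mult_left_mono; simp)
  show ?thesis
  proof (cases "y \<le> y'")
    case False
    then show ?thesis using **[of y' y] y by (simp add: abs_minus_commute)
  qed (use ** y in blast)
qed

text \<open>Every pair is compared with the curve point of the same sum u, and t is the transversal
  deviation. A triple step multiplies |t| by at least 1 + 2 u; passing from the image of the curve
  point to the point with the new sum costs at most u |t| / 2 by \<open>slope_bound\<close>. So |t|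
  never decreases, although it is bounded by 2 u, which tends to 0.\<close>

theorem local_uniqueness:
  assumes neg: "\<And>k. p k < 0 \<and> q k < 0"
    and steps: "\<And>k. \<exists>c. steps3 (p k) (q k) c (p (Suc k)) (q (Suc k))"
    and lim: "p \<longlonglongrightarrow> 0" "q \<longlonglongrightarrow> 0"
  shows "\<exists>k x. 0 < x \<and> p k = a x \<and> q k = b x"
proof -
  obtain X where X: "0 < X" "\<forall>x\<ge>X. \<bar>b' x - a' x\<bar> \<le> 1/4 * (a' x + b' x)" using slope_eventually by blast
  define U where "U = (\<lambda>x. - (a x + b x))"
  define u where "u = (\<lambda>k. - (p k + q k))"
  have U0: "0 < U X" using a_range[of X] b_range[of X] X by (simp add: U_def)
  have ulim: "u \<longlonglongrightarrow> 0" unfolding u_def using tendsto_minus[OF tendsto_add[OF lim]] by simp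
  have "\<forall>\<^sub>F k in sequentially. u k < min (U X) (1/1000)" using order_tendstoD(2)[OF ulim, of "min (U X) (1/1000)"] U0 by simp
  then obtain K where "\<forall>k\<ge>K. u k < min (U X) (1/1000)"
    unfolding eventually_sequentially by blast
  then have K: "u k < U X \<and> u k < 1/1000" if "K \<le> k" for k using that by simp
  have u0: "0 < u k" for k using neg[of k] by (simp add: u_def)
  have Ulim: "(U \<longlongrightarrow> 0) at_top" unfolding U_def using tendsto_minus[OF tendsto_add[OF curve_to_0]] by simp
  have Ucont: "continuous_on {X..z} U" for z
  proof (intro continuous_at_imp_continuous_on ballI)
    fix x assume "x \<in> {X..z}"
    then have x: "0 \<le> x" using X by simp
    show "isCont U x" unfolding U_def
      by (intro isCont_minus isCont_add DERIV_isCont[OF a_deriv[OF x]] DERIV_isCont[OF b_deriv[OF x]])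
  qed
  have "\<exists>y. X \<le> y \<and> U y = u k" if k: "K \<le> k" for k
  proof -
    have "\<forall>\<^sub>F z in at_top. U z < u k" by (rule order_tendstoD(2)[OF Ulim u0])
    then have "\<forall>\<^sub>F z in at_top. U z < u k \<and> X \<le> z" using eventually_ge_at_top[of X] by (rule eventually_conj)
    then obtain z where z: "U z < u k" "X \<le> z" using eventually_happens'[OF trivial_limit_at_top_linorder] by blast
    have "u k < U X" using K[OF k] by simp
    then obtain y where "X \<le> y" "y \<le> z" "U y = u k"
      using IVT2'[of U z "u k" X, OF less_imp_le[OF z(1)] less_imp_le z(2) Ucont] by blast
    then show ?thesis by blast
  qed
  then have "\<forall>k. \<exists>y. K \<le> k \<longrightarrow> X \<le> y \<and> U y = u k" by blast
  from choice[OF this] obtain y where "\<forall>k. K \<le> k \<longrightarrow> X \<le> y k \<and> U (y k) = u k" by blast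
  then have y: "X \<le> y k \<and> U (y k) = u k" if "K \<le> k" for k using that by blast
  define t where "t = (\<lambda>k. (q k - p k) - (b (y k) - a (y k)))"
  have t_mono: "\<bar>t k\<bar> \<le> \<bar>t (Suc k)\<bar>" if k: "K \<le> k" for k
  proof -
    have yk: "X \<le> y k" "U (y k) = u k" "X \<le> y (Suc k)" "U (y (Suc k)) = u (Suc k)" using y[of k] y[of "Suc k"] k by auto
    have y0: "0 < y k" using yk X by simp
    obtain c where c: "steps3 (p k) (q k) c (p (Suc k)) (q (Suc k))" using steps by blast
    obtain c' where c': "steps3 (a (y k)) (b (y k)) c' (a (y k + 3)) (b (y k + 3))" using steps3_curve[OF y0] by blast
    have uk: "u k = - (p k + q k)" "u k = - (a (y k) + b (y k))" using yk by (simp_all add: u_def U_def)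
    have le: "p k \<le> 0" "q k \<le> 0" "a (y k) \<le> 0" "b (y k) \<le> 0"
      using neg[of k] a_range[OF y0] b_range[of "y k"] y0 by auto
    have u1: "u k \<le> 1/1000" using K[OF k] by simp
    note ex = steps3_expand[OF c le(1,2) uk(1) c' le(3,4) uk(2) u0 u1 t_def[THEN fun_cong]]
    have "\<bar>(b (y (Suc k)) - a (y (Suc k))) - (b (y k + 3) - a (y k + 3))\<bar> \<le>
        1/4 * \<bar>(a (y (Suc k)) + b (y (Suc k))) - (a (y k + 3) + b (y k + 3))\<bar>"
      using slope_bound[OF X, of "y (Suc k)" "y k + 3"] yk by simp
    also have "a (y (Suc k)) + b (y (Suc k)) = p (Suc k) + q (Suc k)"
      using yk(4) unfolding U_def u_def by linarith
    also have "1/4 * \<bar>(p (Suc k) + q (Suc k)) - (a (y k + 3) + b (y k + 3))\<bar> \<le> 1/4 * (2 * u k * \<bar>t k\<bar>)"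
      using ex(2) by (intro mult_left_mono) auto
    finally have "\<bar>(b (y (Suc k)) - a (y (Suc k))) - (b (y k + 3) - a (y k + 3))\<bar> \<le> 1/2 * (u k * \<bar>t k\<bar>)" by simp
    moreover have "0 \<le> u k * \<bar>t k\<bar>" using u0[of k] by simp
    moreover have "(1 + 2 * u k) * \<bar>t k\<bar> = \<bar>t k\<bar> + 2 * (u k * \<bar>t k\<bar>)" by (simp add: algebra_simps)
    ultimately show ?thesis using ex(1) unfolding t_def[THEN fun_cong, of "Suc k"] by linarith
  qed
  have t_ge: "\<bar>t K\<bar> \<le> \<bar>t (K + j)\<bar>" for j
  proof (induction j)
    case (Suc j)
    then show ?case using t_mono[of "K + j"] by simp
  qed simp
  have t_le: "\<bar>t (K + j)\<bar> \<le> 2 * u (K + j)" for j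
  proof -
    have yk: "X \<le> y (K + j)" "U (y (K + j)) = u (K + j)" using y[of "K + j"] by auto
    then have y0: "0 < y (K + j)" using X by simp
    have "a (y (K + j)) < 0" "b (y (K + j)) < 0" "p (K + j) < 0" "q (K + j) < 0"
      using neg[of "K + j"] a_range[OF y0] b_range[OF less_imp_le[OF y0]] by auto
    moreover have "- (a (y (K + j)) + b (y (K + j))) = u (K + j)" "u (K + j) = - (p (K + j) + q (K + j))"
      using yk(2) unfolding U_def u_def by linarith+
    ultimately show ?thesis unfolding t_def by linarith
  qed
  have L: "(\<lambda>j. 2 * u (K + j)) \<longlonglongrightarrow> 2 * 0" using LIMSEQ_ignore_initial_segment[OF ulim, of K]
    by (intro tendsto_mult tendsto_const) (simp add: add.commute)
  have "\<bar>t K\<bar> \<le> 2 * u (K + j)" for j using t_ge[of j] t_le[of j] by linarith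
  then have "\<bar>t K\<bar> \<le> 2 * 0" by (intro LIMSEQ_le_const[OF L]) blast
  then have "t K = 0" by simp
  moreover have "X \<le> y K" "U (y K) = u K" using y[of K] by auto
  ultimately have "0 < y K" "p K = a (y K)" "q K = b (y K)" using X unfolding t_def U_def u_def by linarith+
  then show ?thesis by blast
qed

end

section \<open>Bounded solutions of the recurrence\<close>

definition recurrence :: "(nat \<Rightarrow> real) \<Rightarrow> bool" where
  "recurrence v \<longleftrightarrow> (\<forall>n. v (n + 2) * (v (n + 1) - 1) = v (n + 1) + v n + v (n + 1) * v n)"

lemma recurrenceD: "recurrence v \<Longrightarrow> v (n + 2) * (v (n + 1) - 1) = v (n + 1) + v n + v (n + 1) * v n"
  by (simp add: recurrence_def)

lemma recurrence_shift: "recurrence v \<Longrightarrow> recurrence (\<lambda>n. v (n + k))"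
  unfolding recurrence_def
proof
  fix n assume v: "\<forall>n. v (n + 2) * (v (n + 1) - 1) = v (n + 1) + v n + v (n + 1) * v n"
  have i: "n + 2 + k = n + k + 2" "n + 1 + k = n + k + 1" by simp_all
  show "v (n + 2 + k) * (v (n + 1 + k) - 1) = v (n + 1 + k) + v (n + k) + v (n + 1 + k) * v (n + k)"
    using v unfolding i by blast
qed

text \<open>Two nonnegative terms are followed by the signs -, +, +, -, so the situation recurs with
  period three; meanwhile the negative terms grow in modulus by at least their square.\<close>

lemma nonneg_step:
  fixes a b c d e f :: real
  assumes c: "c * (b - 1) = b + a + b * a" and d: "d * (c - 1) = c + b + c * b"
    and e: "e * (d - 1) = d + c + d * c" and f: "f * (e - 1) = e + d + e * d"
    and nn: "0 \<le> a" "0 \<le> b" and lt: "b < 1" "d < 1" "e < 1" "-1 < c"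
  shows "c \<le> 0" "0 \<le> d" "0 \<le> e" "- c + c^2 \<le> - f"
proof -
  have ab: "0 \<le> b * a" using nn lt by simp
  have "c * (1 - b) = - (b + a + b * a)" using c by (simp add: algebra_simps)
  then have "c * (1 - b) \<le> 0" using nn ab by linarith
  then show c0: "c \<le> 0" using nn lt by (simp add: mult_le_0_iff)
  have ca: "c * (1 - b) \<le> - b" using \<open>c * (1 - b) = - (b + a + b * a)\<close> nn ab by linarith
  have bc: "b * c \<le> 0" using nn c0 by (simp add: mult_nonneg_nonpos)
  have "c + b + c * b \<le> 0" using ca bc by (simp add: algebra_simps)
  then have "0 \<le> d * (1 - c)" using d by (simp add: algebra_simps)
  then show d0: "0 \<le> d" using c0 by (simp add: zero_le_mult_iff)
  have "0 \<le> e * (1 - d)"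
  proof -
    \<comment> \<open>Eliminating d turns the quantity into a negative combination of
      squares.\<close>
    have "(d + c + d * c) * (1 - c) = c * (1 - c) - (c + b + c * b) * (1 + c)"
      using d by (simp add: algebra_simps)
    also have "\<dots> = - 2 * c^2 - b * (1 + c)^2" by (simp add: algebra_simps power2_eq_square)
    also have "\<dots> \<le> 0"
    proof -
      have "0 \<le> c^2" "0 \<le> b * (1 + c)^2" using nn by simp_all
      then show ?thesis by linarith
    qed
    finally have "d + c + d * c \<le> 0" using c0 by (simp add: mult_le_0_iff)
    then show ?thesis using e by (simp add: algebra_simps)
  qed
  then show e0: "0 \<le> e" using nn lt by (simp add: zero_le_mult_iff)
  have de: "0 \<le> d * e" "0 \<le> (- c) * d" "0 \<le> (- c) * e" using d0 e0 c0 by (auto intro: mult_nonpos_nonneg)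
  have "- f * (1 - e) = - c * (1 + d) + 2 * (d * e)" using e f by (simp add: algebra_simps)
  moreover have "0 \<le> - c * (1 + d)" using c0 d0 by (simp add: mult_nonpos_nonneg)
  ultimately have "0 \<le> - f * (1 - e)" using de by linarith
  then have f0: "0 \<le> - f" using nn lt by (simp add: zero_le_mult_iff mult_le_0_iff)
  have g: "- f = - c + (- c) * d + (- f) * e + 2 * (d * e)" using \<open>- f * (1 - e) = - c * (1 + d) + 2 * (d * e)\<close>
    by (simp add: algebra_simps)
  have fe: "0 \<le> (- f) * e" using f0 e0 by (rule mult_nonneg_nonneg)
  have "- c \<le> - f" using g de fe by linarith
  then have "(- c) * e \<le> (- f) * e" using e0 by (rule mult_right_mono)
  moreover have "- c \<le> d + e" using e de by (simp add: algebra_simps)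
  then have "(- c) * (- c) \<le> (- c) * (d + e)" using c0 by (intro mult_left_mono) auto
  then have "c^2 \<le> (- c) * d + (- c) * e" by (simp add: power2_eq_square algebra_simps)
  ultimately show "- c + c^2 \<le> - f" using g de by linarith
qed

text \<open>A sequence in [0, 1) with w_{k+1} \<ge> w_k + w_k^2 vanishes identically; then three
  nonnegative summands add up to 0.\<close>

lemma nonneg_pair_zero:
  assumes v: "recurrence v" and small: "\<And>n. \<bar>v n\<bar> < 1" and pos: "0 \<le> v 0" "0 \<le> v 1"
  shows "v 0 = 0 \<and> v 1 = 0"
proof -
  define w where "w = (\<lambda>k. - v (3 * k + 2))"
  have step: "v (3 * k + 2) \<le> 0 \<and> 0 \<le> v (3 * Suc k) \<and> 0 \<le> v (3 * Suc k + 1) \<and> w k + (w k)^2 \<le> w (Suc k)"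
    if "0 \<le> v (3 * k)" "0 \<le> v (3 * k + 1)" for k
  proof -
    note r = recurrenceD[OF v, of "3 * k"] recurrenceD[OF v, of "3 * k + 1"]
      recurrenceD[OF v, of "3 * k + 2"] recurrenceD[OF v, of "3 * k + 3"]
    have i: "3 * k + 1 + 2 = 3 * k + 3" "3 * k + 2 + 1 = 3 * k + 3" "3 * k + 2 + 2 = 3 * k + 4"
      "3 * k + 3 + 1 = 3 * k + 4" "3 * k + 3 + 2 = 3 * k + 5" "3 * k + 1 + 1 = 3 * k + 2"
      "3 * Suc k = 3 * k + 3" "3 * k + 3 + 2 = 3 * k + 5" by simp_all
    have "v (3 * k + 1) < 1" "v (3 * k + 3) < 1" "v (3 * k + 4) < 1" "-1 < v (3 * k + 2)"
      using small[of "3 * k + 1"] small[of "3 * k + 3"] small[of "3 * k + 4"] small[of "3 * k + 2"] by auto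
    from nonneg_step[OF r[unfolded i] that this] show ?thesis unfolding w_def i by simp
  qed
  have nn: "0 \<le> v (3 * k) \<and> 0 \<le> v (3 * k + 1)" for k
    by (induction k) (use pos step in auto)
  have w0: "0 \<le> w k" "w k + (w k)^2 \<le> w (Suc k)" "w k < 1" for k
    using step[of k] nn[of k] small[of "3 * k + 2"] by (auto simp: w_def)
  have mono: "w 0 \<le> w k \<and> w 0 + real k * (w 0)^2 \<le> w k" for k
  proof (induction k)
    case (Suc k)
    then have "(w 0)^2 \<le> (w k)^2" using w0(1)[of 0] by (intro power_mono) auto
    moreover have "real (Suc k) * (w 0)^2 = real k * (w 0)^2 + (w 0)^2" by (simp add: distrib_right)
    ultimately show ?case using Suc w0(2)[of k] zero_le_power2[of "w k"] by linarith
  qed simp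
  have "w 0 = 0"
  proof (rule ccontr)
    assume "w 0 \<noteq> 0"
    then have "0 < (w 0)^2" by simp
    then obtain k :: nat where k: "1 < real k * (w 0)^2" using reals_Archimedean3 by blast
    show False using mono[of k] w0(1)[of 0] w0(3)[of k] k by linarith
  qed
  then have "v 1 + v 0 + v 1 * v 0 = 0" using recurrenceD[OF v, of 0] by (simp add: w_def numeral_2_eq_2)
  moreover have "0 \<le> v 1 * v 0" using pos by simp
  ultimately show ?thesis using pos by linarith
qed

lemma recurrence_zero_back:
  assumes v: "recurrence v" and "v n = 0" "v (n + 1) = 0"
  shows "v 0 = 0 \<and> v 1 = 0"
  using assms(2,3)
proof (induction n)
  case (Suc n)
  have "v n = 0" using recurrenceD[OF v, of n] Suc.prems by simp
  then show ?case using Suc by simp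
qed simp

lemma no_nonneg_pair:
  assumes v: "recurrence v" and small: "\<And>n. \<bar>v n\<bar> < 1" and nz: "\<not> (v 0 = 0 \<and> v 1 = 0)"
  shows "v n < 0 \<or> v (n + 1) < 0"
proof (rule ccontr)
  assume "\<not> (v n < 0 \<or> v (n + 1) < 0)"
  then have "v n = 0 \<and> v (n + 1) = 0"
    using nonneg_pair_zero[OF recurrence_shift[OF v, of n]] small by (simp add: add.commute)
  then show False using recurrence_zero_back[OF v] nz by blast
qed

text \<open>The signs +, -, + would make the fourth term nonnegative as well, producing two adjacent
  nonnegative terms.\<close>

lemma no_alternation:
  assumes v: "recurrence v" and small: "\<And>n. \<bar>v n\<bar> < 1" and nz: "\<not> (v 0 = 0 \<and> v 1 = 0)"
  shows "v n < 0 \<or> 0 < v (n + 1) \<or> v (n + 2) < 0"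
proof (rule ccontr)
  assume h: "\<not> (v n < 0 \<or> 0 < v (n + 1) \<or> v (n + 2) < 0)"
  have i: "n + 1 + 1 = n + 2" "n + 1 + 2 = n + 3" "n + 2 + 1 = n + 3" by simp_all
  have r: "v (n + 2) * (v (n + 1) - 1) = v (n + 1) + v n + v (n + 1) * v n"
    "v (n + 3) * (v (n + 2) - 1) = v (n + 2) + v (n + 1) + v (n + 2) * v (n + 1)"
    using recurrenceD[OF v, of n] recurrenceD[OF v, of "n + 1"] unfolding i by blast+
  have "v (n + 3) * (1 - v (n + 2)) = v n * (1 + v (n + 1)) - 2 * (v (n + 1) * v (n + 2))"
    using r by (simp add: algebra_simps)
  moreover have "v (n + 1) * v (n + 2) \<le> 0" using h by (simp add: mult_nonpos_nonneg)
  moreover have "0 \<le> v n * (1 + v (n + 1))" using h small[of "n + 1"] by (intro mult_nonneg_nonneg) auto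
  ultimately have "0 \<le> v (n + 3) * (1 - v (n + 2))" by linarith
  moreover have "0 < 1 - v (n + 2)" using small[of "n + 2"] by linarith
  ultimately have "0 \<le> v (n + 3)" using zero_le_mult_iff[of "v (n + 3)" "1 - v (n + 2)"] by linarith
  then show False using no_nonneg_pair[OF v small nz, of "n + 2"] h unfolding i by linarith
qed

lemma no_three_neg:
  assumes v: "recurrence v" and small: "\<And>n. \<bar>v n\<bar> < 1" and "v n < 0" "v (n + 1) < 0"
  shows "0 < v (n + 2)"
proof -
  have "v (n + 2) * (1 - v (n + 1)) = - v (n + 1) + (- v n) * (1 + v (n + 1))"
    using recurrenceD[OF v, of n] by (simp add: algebra_simps)
  moreover have "0 \<le> (- v n) * (1 + v (n + 1))" using assms small[of "n + 1"] by (intro mult_nonneg_nonneg) auto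
  ultimately have "0 < v (n + 2) * (1 - v (n + 1))" using assms by linarith
  then show ?thesis using assms by (simp add: zero_less_mult_iff)
qed

text \<open>Two adjacent nonnegative terms, a single negative term between nonnegative ones, and
  three successive negative terms are all excluded; what is left is the period (+, -, -).\<close>

lemma sign_pattern:
  assumes v: "recurrence v" and small: "\<And>n. \<bar>v n\<bar> < 1" and nz: "\<not> (v 0 = 0 \<and> v 1 = 0)"
  shows "\<exists>m. \<forall>k. v (m + 3 * k) < 0 \<and> v (m + 3 * k + 1) < 0"
proof -
  have next2: "v (n + 1) < 0 \<and> v (n + 2) < 0" if "0 \<le> v n" for n
    using that no_nonneg_pair[OF v small nz, of n] no_alternation[OF v small nz, of n] by linarith
  have "\<exists>m. v m < 0 \<and> v (m + 1) < 0"
  proof (cases "0 \<le> v 0")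
    case True
    then have "v 1 < 0 \<and> v (1 + 1) < 0" using next2[of 0] by (simp add: numeral_2_eq_2)
    then show ?thesis by blast
  next
    case F: False
    show ?thesis
    proof (cases "0 \<le> v 1")
      case True
      then have "v 2 < 0 \<and> v (2 + 1) < 0" using next2[of 1] by (simp add: numeral_2_eq_2 numeral_3_eq_3)
      then show ?thesis by blast
    next
      case False
      then show ?thesis using F by (intro exI[of _ 0]) simp
    qed
  qed
  then obtain m where m: "v m < 0" "v (m + 1) < 0" by blast
  have "v (m + 3 * k) < 0 \<and> v (m + 3 * k + 1) < 0" for k
  proof (induction k)
    case (Suc k)
    have "0 < v (m + 3 * k + 2)" using no_three_neg[OF v small, of "m + 3 * k"] Suc by blast
    then have "v (m + 3 * k + 2 + 1) < 0 \<and> v (m + 3 * k + 2 + 2) < 0" using next2[of "m + 3 * k + 2"] by simp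
    moreover have "m + 3 * k + 2 + 1 = m + 3 * Suc k" "m + 3 * k + 2 + 2 = m + 3 * Suc k + 1" by simp_all
    ultimately show ?case by (simp only:)
  qed (use m in simp)
  then show ?thesis by blast
qed

section \<open>Bounded two-sided solutions vanish\<close>

definition two_sided :: "(int \<Rightarrow> real) \<Rightarrow> bool" where
  "two_sided v \<longleftrightarrow> (\<forall>n. v (n + 2) * (v (n + 1) - 1) = v (n + 1) + v n + v (n + 1) * v n) \<and>
     (\<exists>M>1. \<forall>n. \<bar>v n\<bar> \<le> M)"

text \<open>Reversing time and changing sign preserves the recurrence, so every statement about the
  future yields one about the past.\<close>

lemma two_sided_reverse:
  assumes "two_sided v"
  shows "two_sided (\<lambda>n. - v (- n))"
proof -
  have "- v (- (n + 2)) * (- v (- (n + 1)) - 1) = - v (- (n + 1)) + - v (- n) + - v (- (n + 1)) * - v (- n)" for n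
  proof -
    define m where "m = - n - 2"
    have i: "- (n + 2) = m" "- (n + 1) = m + 1" "- n = m + 2" by (simp_all add: m_def)
    have "v (m + 2) * (v (m + 1) - 1) = v (m + 1) + v m + v (m + 1) * v m"
      using assms by (simp add: two_sided_def)
    then show ?thesis unfolding i by (simp add: algebra_simps)
  qed
  moreover have "\<exists>M>1. \<forall>n. \<bar>- v (- n)\<bar> \<le> M" using assms unfolding two_sided_def by auto
  ultimately show ?thesis unfolding two_sided_def by blast
qed

text \<open>From such a pair on, v(k+2) - v(k) > 1, because (v(k+2) - v(k)) (v(k+1) - 1) = v(k+1) +
  2 v(k); this contradicts boundedness.\<close>

lemma two_sided_no_trap:
  assumes v: "two_sided v"
  shows "\<not> (0 \<le> v n \<and> 1 < v (n + 1))"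
proof
  assume h: "0 \<le> v n \<and> 1 < v (n + 1)"
  have step: "v k + 1 < v (k + 2) \<and> 0 \<le> v (k + 1) \<and> 1 < v (k + 2)" if "0 \<le> v k" "1 < v (k + 1)" for k
  proof -
    have "v (k + 2) * (v (k + 1) - 1) = v (k + 1) + v k + v (k + 1) * v k" using v by (simp add: two_sided_def)
    then have "(v (k + 2) - v k) * (v (k + 1) - 1) = v (k + 1) + 2 * v k" by (simp add: algebra_simps)
    then have "1 * (v (k + 1) - 1) < (v (k + 2) - v k) * (v (k + 1) - 1)" using that by simp
    then have "1 < v (k + 2) - v k" using that by (simp only: mult_less_cancel_right)
    then show ?thesis using that by simp
  qed
  have all: "0 \<le> v (n + int j) \<and> 1 < v (n + int j + 1)" for j
  proof (induction j)
    case (Suc j)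
    have "n + int j + 2 = n + int (Suc j) + 1" "n + int j + 1 = n + int (Suc j)" by simp_all
    then show ?case using step[of "n + int j"] Suc by (simp only:)
  qed (use h in simp)
  have gr: "real j \<le> v (n + 2 * int j)" for j
  proof (induction j)
    case (Suc j)
    have "v (n + 2 * int j) + 1 < v (n + 2 * int j + 2)"
      using step[of "n + 2 * int j"] all[of "2 * j"] by simp
    moreover have "n + 2 * int j + 2 = n + 2 * int (Suc j)" by simp
    ultimately show ?case using Suc by (simp only: of_nat_Suc)
  qed (use h in simp)
  obtain M where M: "\<And>n. \<bar>v n\<bar> \<le> M" using v by (auto simp: two_sided_def)
  obtain j :: nat where "M < real j" using reals_Archimedean2 by blast
  then show False using gr[of j] M[of "n + 2 * int j"] by linarith
qed

lemma two_sided_no_trap':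
  assumes v: "two_sided v"
  shows "\<not> (v n < -1 \<and> v (n + 1) \<le> 0)"
proof -
  have i: "- (- n - 1 + 1) = n" "- (- n - 1) = n + 1" by simp_all
  show ?thesis using two_sided_no_trap[OF two_sided_reverse[OF v], of "- n - 1"] unfolding i by linarith
qed

text \<open>After -1 the next two terms are 1/2 and 2 whatever came before, and this pair lies in
  the region excluded by \<open>two_sided_no_trap\<close>.\<close>

lemma two_sided_ne_minus1:
  assumes v: "two_sided v"
  shows "v n \<noteq> -1"
proof
  assume n: "v n = -1"
  have i: "n - 1 + 2 = n + 1" "n - 1 + 1 = n" "n + 1 + 1 = n + 2" by simp_all
  have rec: "v (m + 2) * (v (m + 1) - 1) = v (m + 1) + v m + v (m + 1) * v m" for m
    using v unfolding two_sided_def by blast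
  have "v (n + 1) = 1 / 2" using rec[of "n - 1"] n unfolding i by simp
  moreover have "v (n + 2) = 2" using rec[of n] n calculation by simp
  ultimately show False using two_sided_no_trap[OF v, of "n + 1"] unfolding i by simp
qed

lemma two_sided_ne_1: "two_sided v \<Longrightarrow> v n \<noteq> 1"
  using two_sided_ne_minus1[OF two_sided_reverse, of v "- n"] by simp

text \<open>If v n were between -1 and 0, the recurrence would push v (n - 1) below -1, and the
  time-reversed trap would be met.\<close>

lemma two_sided_large:
  assumes v: "two_sided v" and b: "1 < v (n + 1)"
  shows "v n < -1"
proof (rule ccontr)
  assume "\<not> v n < -1"
  moreover have "v n < 0" using two_sided_no_trap[OF v, of n] b by linarith
  moreover have "v n \<noteq> -1" using two_sided_ne_minus1[OF v] .
  ultimately have a: "-1 < v n" "v n < 0" by auto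
  have i: "n - 1 + 2 = n + 1" "n - 1 + 1 = n" by simp_all
  have "v (n - 1 + 2) * (v (n - 1 + 1) - 1) = v (n - 1 + 1) + v (n - 1) + v (n - 1 + 1) * v (n - 1)"
    using v unfolding two_sided_def by blast
  then have "v (n + 1) * (v n - 1) = v n + v (n - 1) + v n * v (n - 1)" unfolding i .
  then have "(v (n - 1) + 1) * (1 + v n) = v n * v (n + 1) - (v (n + 1) - 1)" by (simp add: algebra_simps)
  moreover have "v n * v (n + 1) < 0" using a b by (intro mult_neg_pos) auto
  ultimately have "(v (n - 1) + 1) * (1 + v n) < 0" using b by linarith
  then have "v (n - 1) < -1" using a by (simp add: mult_less_0_iff)
  then show False using two_sided_no_trap'[OF v, of "n - 1"] a by simp
qed

text \<open>Every second term is followed backward: the condition reproduces itself in the sharper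
  form with 2 b - 1, and from then on each double step increases the large term by at least 1 /
  M.\<close>

lemma two_sided_alternating:
  assumes v: "two_sided v"
  shows "\<not> (1 < v (n + 1) \<and> - v n < 2 * v (n + 1))"
proof
  assume h: "1 < v (n + 1) \<and> - v n < 2 * v (n + 1)"
  obtain M where M: "1 < M" "\<And>n. \<bar>v n\<bar> \<le> M" using v by (auto simp: two_sided_def)
  have rec: "v (m + 2) * (v (m + 1) - 1) = v (m + 1) + v m + v (m + 1) * v m" for m
    using v unfolding two_sided_def by blast
  have step: "v (m + 1) < v (m - 1) \<and> - v (m - 2) < 2 * v (m - 1) - 1 \<and>
      (- v m < 2 * v (m + 1) - 1 \<longrightarrow> v (m + 1) + 1 / M \<le> v (m - 1))"
    if b: "1 < v (m + 1)" "- v m < 2 * v (m + 1)" for m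
  proof -
    define \<alpha> b p \<kappa> where "\<alpha> = - v m" and "b = v (m + 1)" and "p = v (m - 1)" and "\<kappa> = - v (m - 2)"
    have a1: "1 < \<alpha>" "1 < b" "\<alpha> < 2 * b" using two_sided_large[OF v b(1)] b by (simp_all add: \<alpha>_def b_def)
    have i: "m - 1 + 2 = m + 1" "m - 1 + 1 = m" "m - 2 + 2 = m" "m - 2 + 1 = m - 1" by simp_all
    have "b * (- \<alpha> - 1) = - \<alpha> + p + - \<alpha> * p"
      using rec[of "m - 1"] unfolding i by (simp add: \<alpha>_def b_def p_def)
    then have p: "(p - b) * (\<alpha> - 1) = 2 * b - \<alpha>" by (simp add: algebra_simps)
    then have "0 < (p - b) * (\<alpha> - 1)" using a1 by simp
    then have pb: "b < p" using a1 by (simp add: zero_less_mult_iff)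
    have "- \<alpha> * (p - 1) = p - \<kappa> + p * - \<kappa>" using rec[of "m - 2"] unfolding i by (simp add: \<alpha>_def p_def \<kappa>_def)
    then have k: "(2 * p - 1 - \<kappa>) * (p + 1) = 2 * (p * p) - 1 - \<alpha> * (p - 1)" by (simp add: algebra_simps)
    have "\<alpha> * (p - 1) < 2 * p * (p - 1)" using a1 pb by (intro mult_strict_right_mono) auto
    then have "0 < (2 * p - 1 - \<kappa>) * (p + 1)" using k a1 pb by (simp add: algebra_simps)
    then have "\<kappa> < 2 * p - 1" using a1 pb by (simp add: zero_less_mult_iff)
    \<comment> \<open>Here 2 b - \<alpha> > 1, while the factor \<alpha> - 1 of p - b is less than
      M.\<close>
    moreover have "b + 1 / M \<le> p" if "\<alpha> < 2 * b - 1"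
    proof -
      have "\<alpha> \<le> M" using M(2)[of m] by (simp add: \<alpha>_def abs_le_iff)
      then have "(p - b) * (\<alpha> - 1) \<le> (p - b) * M" using pb by (intro mult_left_mono) auto
      then have "1 \<le> (p - b) * M" using p that by linarith
      then show ?thesis using M(1) by (simp add: field_simps)
    qed
    ultimately show ?thesis using pb by (simp add: \<alpha>_def b_def p_def \<kappa>_def)
  qed
  define w where "w = (\<lambda>j. v (n - 1 - 2 * int j))"
  have all: "1 < w j \<and> - v (n - 2 - 2 * int j) < 2 * w j - 1" for j
  proof (induction j)
    case 0
    then show ?case using step[of n] h by (simp add: w_def)
  next
    case (Suc j)
    have "1 < v (n - 2 - 2 * int j + 1)" "- v (n - 2 - 2 * int j) < 2 * v (n - 2 - 2 * int j + 1)"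
      using Suc by (simp_all add: w_def algebra_simps)
    from step[OF this] this(1) show ?case by (simp add: w_def algebra_simps)
  qed
  have gr: "real j / M \<le> w j" for j
  proof (induction j)
    case 0
    then show ?case using all[of 0] by simp
  next
    case (Suc j)
    have e: "n - 2 - 2 * int j + 1 = n - 1 - 2 * int j" by simp
    have "1 < v (n - 2 - 2 * int j + 1)" "- v (n - 2 - 2 * int j) < 2 * v (n - 2 - 2 * int j + 1) - 1"
      using all[of j] unfolding e by (simp_all add: w_def)
    then have "v (n - 2 - 2 * int j + 1) + 1 / M \<le> v (n - 2 - 2 * int j - 1)"
      using step[of "n - 2 - 2 * int j"] by simp
    then have "w j + 1 / M \<le> w (Suc j)" by (simp add: w_def algebra_simps)
    then show ?case using Suc by (simp add: add_divide_distrib)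
  qed
  obtain j :: nat where "M * M < real j" using reals_Archimedean2 by blast
  then have "M < real j / M" using M by (simp add: field_simps)
  then show False using gr[of j] M(2)[of "n - 1 - 2 * int j"] unfolding w_def by linarith
qed

text \<open>\<open>two_sided_alternating\<close> for v and for its reversal would require -v (n - 1)
  \<ge> 2 v n and v n \<ge> -2 v (n - 1) at once, impossible for positive numbers.\<close>

lemma two_sided_le_1:
  assumes v: "two_sided v"
  shows "v n < 1"
proof (rule ccontr)
  assume "\<not> v n < 1"
  then have b: "1 < v n" using two_sided_ne_1[OF v, of n] by linarith
  then have a: "v (n - 1) < -1" using two_sided_large[OF v, of "n - 1"] by simp
  have "\<not> - v (n - 1) < 2 * v n" using two_sided_alternating[OF v, of "n - 1"] b by simp
  moreover have "\<not> v n < 2 * (- v (n - 1))"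
    using two_sided_alternating[OF two_sided_reverse[OF v], of "- n"] a by simp
  ultimately show False using a b by linarith
qed

text \<open>Once all terms are below 1 in modulus, two adjacent nonnegative terms force 0 forward
  and two adjacent nonpositive terms force 0 by reversal; strict alternation, the only other case,
  is excluded by \<open>no_alternation\<close>.\<close>

lemma two_sided_zero:
  assumes v: "two_sided v"
  shows "v 0 = 0 \<and> v 1 = 0"
proof -
  have small: "\<bar>v n\<bar> < 1" for n
    using two_sided_le_1[OF v, of n] two_sided_le_1[OF two_sided_reverse[OF v], of "- n"] by simp
  have *: "recurrence (\<lambda>k. u (m + int k))" if "two_sided u" for m u
    unfolding recurrence_def
  proof
    fix k
    have i: "m + int (k + 2) = m + int k + 2" "m + int (k + 1) = m + int k + 1" by simp_all
    show "u (m + int (k + 2)) * (u (m + int (k + 1)) - 1) =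
        u (m + int (k + 1)) + u (m + int k) + u (m + int (k + 1)) * u (m + int k)"
      using that unfolding two_sided_def i by blast
  qed
  note rec = *[OF v] and rec' = *[OF two_sided_reverse[OF v]]
  have zero: "v n = 0 \<Longrightarrow> v (n + 1) = 0 \<Longrightarrow> v 0 = 0 \<and> v 1 = 0" for n
  proof -
    assume z: "v n = 0" "v (n + 1) = 0"
    show ?thesis
    proof (cases "0 \<le> n")
      case True
      have i: "0 + int (nat n) = n" "0 + int (nat n + 1) = n + 1" using True by simp_all
      have "v (0 + int 0) = 0 \<and> v (0 + int 1) = 0"
        by (rule recurrence_zero_back[OF rec, of _ "nat n"]) (unfold i, use z in simp_all)
      then show ?thesis by simp
    next
      case False
      have i: "- (-1 + int (nat (- n))) = n + 1" "- (-1 + int (nat (- n) + 1)) = n" using False by simp_all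
      have "- v (- (-1 + int 0)) = 0 \<and> - v (- (-1 + int 1)) = 0"
        by (rule recurrence_zero_back[OF rec', of _ "nat (- n)"]) (unfold i, use z in simp_all)
      then show ?thesis by simp
    qed
  qed
  have pp: "v 0 = 0 \<and> v 1 = 0" if "0 \<le> v n" "0 \<le> v (n + 1)" for n
  proof -
    have "v (n + int 0) = 0 \<and> v (n + int 1) = 0"
      by (rule nonneg_pair_zero[OF rec]) (use small that in simp_all)
    then show ?thesis using zero[of n] by simp
  qed
  have nn: "v 0 = 0 \<and> v 1 = 0" if "v n \<le> 0" "v (n + 1) \<le> 0" for n
  proof -
    have i: "- (- n - 1 + int 0) = n + 1" "- (- n - 1 + int 1) = n" by simp_all
    have "- v (- (- n - 1 + int 0)) = 0 \<and> - v (- (- n - 1 + int 1)) = 0"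
      by (rule nonneg_pair_zero[OF rec']) (unfold i, use small that in simp_all)
    then show ?thesis unfolding i using zero[of n] by simp
  qed
  show ?thesis
  proof (rule ccontr)
    assume c: "\<not> ?thesis"
    have p: "v n < 0 \<or> v (n + 1) < 0" and q: "0 < v n \<or> 0 < v (n + 1)" for n
      using pp[of n] nn[of n] c by linarith+
    have "\<exists>m. 0 \<le> v m \<and> v (m + 1) \<le> 0 \<and> 0 \<le> v (m + 2)"
    proof (cases "0 \<le> v 0")
      case True
      then have "v 1 < 0" using p[of 0] by simp
      moreover have "0 < v 2" using q[of 1] calculation by simp
      ultimately show ?thesis using True by (intro exI[of _ 0]) simp
    next
      case False
      then have "0 < v 1" using q[of 0] by simp
      moreover have "v 2 < 0" using p[of 1] calculation by simp
      moreover have "0 < v 3" using q[of 2] calculation by simp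
      ultimately show ?thesis by (intro exI[of _ 1]) simp
    qed
    then obtain m where m: "0 \<le> v m" "v (m + 1) \<le> 0" "0 \<le> v (m + 2)" by blast
    have nz: "\<not> (v (m + int 0) = 0 \<and> v (m + int 1) = 0)" using zero[of m] c by auto
    have "v (m + int 0) < 0 \<or> 0 < v (m + int (0 + 1)) \<or> v (m + int (0 + 2)) < 0"
      by (rule no_alternation[OF rec small nz])
    then show False using m by simp
  qed
qed

section \<open>Analytic curves in the compactified plane\<close>

lemma ranalE:
  assumes "ranal u t"
  obtains g where "g analytic_on {of_real t :: complex}" "\<forall>\<^sub>F s in nhds t. g (of_real s) = of_real (u s)"
    "g (of_real t) = of_real (u t)"
proof -
  obtain g where g: "g analytic_on {of_real t :: complex}" "\<forall>\<^sub>F s in nhds t. g (of_real s) = of_real (u s)"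
    using assms unfolding ranal_def by blast
  show ?thesis by (rule that[OF g eventually_nhds_x_imp_x[OF g(2)]])
qed

lemma ranal_const: "ranal (\<lambda>s. k) t"
  unfolding ranal_def by (intro exI[of _ "\<lambda>z. of_real k"]) auto

lemma ranal_ident: "ranal (\<lambda>s. s) t"
  unfolding ranal_def by (intro exI[of _ "\<lambda>z. z"]) auto

lemma ranal_add:
  assumes "ranal u t" "ranal v t"
  shows "ranal (\<lambda>s. u s + v s) t"
proof -
  obtain g where g: "g analytic_on {of_real t :: complex}" "\<forall>\<^sub>F s in nhds t. g (of_real s) = of_real (u s)"
    using assms(1) by (rule ranalE)
  obtain h where h: "h analytic_on {of_real t :: complex}" "\<forall>\<^sub>F s in nhds t. h (of_real s) = of_real (v s)"
    using assms(2) by (rule ranalE)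
  have "(\<lambda>z. g z + h z) analytic_on {of_real t}" by (intro analytic_intros g h)
  moreover have "\<forall>\<^sub>F s in nhds t. g (of_real s) + h (of_real s) = of_real (u s + v s)"
    using g(2) h(2) by eventually_elim simp
  ultimately show ?thesis unfolding ranal_def by blast
qed

lemma ranal_mult:
  assumes "ranal u t" "ranal v t"
  shows "ranal (\<lambda>s. u s * v s) t"
proof -
  obtain g where g: "g analytic_on {of_real t :: complex}" "\<forall>\<^sub>F s in nhds t. g (of_real s) = of_real (u s)"
    using assms(1) by (rule ranalE)
  obtain h where h: "h analytic_on {of_real t :: complex}" "\<forall>\<^sub>F s in nhds t. h (of_real s) = of_real (v s)"
    using assms(2) by (rule ranalE)
  have "(\<lambda>z. g z * h z) analytic_on {of_real t}" by (intro analytic_intros g h)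
  moreover have "\<forall>\<^sub>F s in nhds t. g (of_real s) * h (of_real s) = of_real (u s * v s)"
    using g(2) h(2) by eventually_elim simp
  ultimately show ?thesis unfolding ranal_def by blast
qed

lemma ranal_uminus: "ranal u t \<Longrightarrow> ranal (\<lambda>s. - u s) t"
  using ranal_mult[OF ranal_const[of "-1"], of u t] by simp

lemma ranal_diff: "ranal u t \<Longrightarrow> ranal v t \<Longrightarrow> ranal (\<lambda>s. u s - v s) t"
  using ranal_add[OF _ ranal_uminus, of u t v] by simp

lemma ranal_divide:
  assumes "ranal u t" "ranal v t" "v t \<noteq> 0"
  shows "ranal (\<lambda>s. u s / v s) t"
proof -
  obtain g where g: "g analytic_on {of_real t :: complex}" "\<forall>\<^sub>F s in nhds t. g (of_real s) = of_real (u s)"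
    using assms(1) by (rule ranalE)
  obtain h where h: "h analytic_on {of_real t :: complex}" "\<forall>\<^sub>F s in nhds t. h (of_real s) = of_real (v s)"
    "h (of_real t) = of_real (v t)"
    using assms(2) by (rule ranalE)
  have "(\<lambda>z. g z / h z) analytic_on {of_real t}" using h assms(3) by (intro analytic_intros g h) auto
  moreover have "\<forall>\<^sub>F s in nhds t. g (of_real s) / h (of_real s) = of_real (u s / v s)"
    using g(2) h(2) by eventually_elim simp
  ultimately show ?thesis unfolding ranal_def by blast
qed

lemma ranal_derivative:
  assumes "ranal u t"
  shows "(u has_real_derivative deriv u t) (at t)"
proof -
  obtain g where g: "g analytic_on {of_real t :: complex}" "\<forall>\<^sub>F s in nhds t. g (of_real s) = of_real (u s)"
    using assms by (rule ranalE)
  have d: "(g has_field_derivative deriv g (of_real t)) (at (of_real t))"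
    using g(1) by (simp add: analytic_on_imp_differentiable_at field_differentiable_derivI)
  have "((\<lambda>s. Re (g (of_real s))) has_real_derivative Re (deriv g (of_real t))) (at t)"
    by (rule has_field_derivative_Re[OF has_vector_derivative_real_field[OF d]])
  moreover have e: "\<forall>\<^sub>F s in nhds t. Re (g (of_real s)) = u s" using g(2) by eventually_elim simp
  ultimately have D: "(u has_real_derivative Re (deriv g (of_real t))) (at t)"
    using DERIV_cong_ev[OF refl e refl] by blast
  then show ?thesis unfolding DERIV_imp_deriv[OF D] .
qed

lemma ranal_isCont: "ranal u t \<Longrightarrow> isCont u t"
  using ranal_derivative DERIV_isCont by blast

lemma ranal_compose:
  assumes u: "ranal u (h t)" and h: "ranal h t"
  shows "ranal (\<lambda>s. u (h s)) t"
proof -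
  obtain k where k: "k analytic_on {of_real t :: complex}" "\<forall>\<^sub>F s in nhds t. k (of_real s) = of_real (h s)"
    "k (of_real t) = of_real (h t)"
    using h by (rule ranalE)
  obtain g where g: "g analytic_on {of_real (h t) :: complex}" "\<forall>\<^sub>F s in nhds (h t). g (of_real s) = of_real (u s)"
    using u by (rule ranalE)
  have "(\<lambda>z. g (k z)) analytic_on {of_real t}"
    by (rule analytic_on_compose_gen[unfolded o_def, of k _ g "{of_real (h t)}"]) (use k g in auto)
  moreover have "filterlim h (nhds (h t)) (nhds t)"
    using ranal_isCont[OF h] by (simp add: isCont_def tendsto_at_iff_tendsto_nhds)
  from eventually_compose_filterlim[OF g(2) this]
  have "\<forall>\<^sub>F s in nhds t. g (k (of_real s)) = of_real (u (h s))"
    using k(2) by eventually_elim simp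
  ultimately show ?thesis unfolding ranal_def by blast
qed

lemma ranal_imp_real_analytic_at:
  assumes "ranal u t"
  shows "real_analytic_at u t"
proof -
  obtain g where g: "g analytic_on {of_real t :: complex}" "\<forall>\<^sub>F s in nhds t. g (of_real s) = of_real (u s)"
    using assms by (rule ranalE)
  obtain r where r: "0 < r" "g holomorphic_on ball (of_real t) r"
    using g(1) by (auto simp: analytic_on_def)
  obtain r' where r': "0 < r'" "\<And>s. dist s t < r' \<Longrightarrow> g (of_real s) = of_real (u s)"
    using g(2) by (auto simp: eventually_nhds_metric)
  define k where "k = (\<lambda>n. Re ((deriv ^^ n) g (of_real t) / fact n))"
  have "(\<lambda>n. k n * (s - t) ^ n) sums u s" if s: "\<bar>s - t\<bar> < min r r'" for s
  proof -
    have "complex_of_real s \<in> ball (of_real t) r"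
      using s by (simp add: dist_commute dist_of_real dist_real_def)
    from holomorphic_power_series[OF r(2) this]
    have "(\<lambda>n. (deriv ^^ n) g (of_real t) / fact n * (of_real s - of_real t) ^ n) sums of_real (u s)"
      using r'(2)[of s] s by (simp add: dist_real_def)
    from sums_Re[OF this]
    have "(\<lambda>n. Re ((deriv ^^ n) g (of_real t) / fact n * of_real ((s - t) ^ n))) sums u s" by simp
    then show ?thesis unfolding k_def by (simp only: Re_complex_of_real times_complex.sel Im_complex_of_real mult_zero_right diff_zero)
  qed
  then show ?thesis unfolding real_analytic_at_def using r r' by (intro exI[of _ k] exI[of _ "min r r'"]) auto
qed

text \<open>The counterpart of \<open>regular_analytic_at\<close> with \<open>ranal\<close>, which
  is easy to transport through reparametrisation and the backward map.\<close>

definition regular_curve_at :: "(real \<Rightarrow> eplane) \<Rightarrow> real \<Rightarrow> bool" where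
  "regular_curve_at c t \<longleftrightarrow> (\<exists>u v. chart_rep (fst \<circ> c) t u \<and> chart_rep (snd \<circ> c) t v \<and>
     ranal u t \<and> ranal v t \<and> (deriv u t \<noteq> 0 \<or> deriv v t \<noteq> 0))"

lemma regular_curve_imp_analytic: "regular_curve_at c t \<Longrightarrow> regular_analytic_at c t"
  unfolding regular_curve_at_def regular_analytic_at_def using ranal_imp_real_analytic_at by blast

lemma chart_rep_compose:
  assumes "chart_rep z (h t) u" "isCont h t"
  shows "chart_rep (\<lambda>s. z (h s)) t (\<lambda>s. u (h s))"
proof -
  have f: "filterlim h (nhds (h t)) (nhds t)"
    using assms(2) by (simp add: isCont_def tendsto_at_iff_tendsto_nhds)
  show ?thesis using assms(1) unfolding chart_rep_def
    using eventually_compose_filterlim[OF _ f] by blast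
qed

lemma regular_curve_reparam:
  assumes "regular_curve_at c (h t)" "ranal h t" "deriv h t \<noteq> 0"
  shows "regular_curve_at (\<lambda>s. c (h s)) t"
proof -
  obtain u v where uv: "chart_rep (fst \<circ> c) (h t) u" "chart_rep (snd \<circ> c) (h t) v"
     "ranal u (h t)" "ranal v (h t)" "deriv u (h t) \<noteq> 0 \<or> deriv v (h t) \<noteq> 0"
    using assms(1) by (auto simp: regular_curve_at_def)
  have d: "deriv (\<lambda>s. w (h s)) t = deriv w (h t) * deriv h t" if "ranal w (h t)" for w
    by (rule DERIV_imp_deriv) (rule DERIV_chain2[OF ranal_derivative[OF that] ranal_derivative[OF assms(2)]])
  show ?thesis unfolding regular_curve_at_def
    using chart_rep_compose[OF uv(1) ranal_isCont[OF assms(2)]] chart_rep_compose[OF uv(2) ranal_isCont[OF assms(2)]]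
      ranal_compose[OF uv(3) assms(2)] ranal_compose[OF uv(4) assms(2)] d[OF uv(3)] d[OF uv(4)] uv(5) assms(3)
    by (intro exI[of _ "\<lambda>s. u (h s)"] exI[of _ "\<lambda>s. v (h s)"]) (simp add: o_def)
qed

lemma regular_curve_cong:
  assumes "regular_curve_at c t" "\<forall>\<^sub>F s in nhds t. c s = c' s"
  shows "regular_curve_at c' t"
proof -
  have *: "chart_rep (g \<circ> c') t u" if "chart_rep (g \<circ> c) t u" for g :: "eplane \<Rightarrow> real option" and u
  proof -
    from that consider "\<forall>\<^sub>F s in nhds t. g (c s) = Some (u s)"
      | "\<forall>\<^sub>F s in nhds t. emoebius 0 1 1 0 (g (c s)) = Some (u s)"
      unfolding chart_rep_def o_def by blast
    then show ?thesis
    proof cases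
      case 1
      then have "\<forall>\<^sub>F s in nhds t. g (c' s) = Some (u s)" using assms(2) by eventually_elim simp
      then show ?thesis by (simp add: chart_rep_def)
    next
      case 2
      then have "\<forall>\<^sub>F s in nhds t. emoebius 0 1 1 0 (g (c' s)) = Some (u s)" using assms(2) by eventually_elim simp
      then show ?thesis by (simp add: chart_rep_def)
    qed
  qed
  show ?thesis using assms(1) * unfolding regular_curve_at_def by blast
qed

text \<open>The recurrence variables: a finite point is \<open>pt p q\<close>, where q is the current and p the
  preceding term, so that x = 2 q - 1 and y = 2 p + 1.\<close>

definition pt :: "real \<Rightarrow> real \<Rightarrow> eplane" where
  "pt p q = (Some (2 * q - 1), Some (2 * p + 1))"

lemma pt_eq_iff [simp]: "pt p q = pt p' q' \<longleftrightarrow> p = p' \<and> q = q'"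
  by (auto simp: pt_def)

lemma fin_eq_pt: "fin (x, y) = pt ((y - 1) / 2) ((x + 1) / 2)"
  by (simp add: fin_def pt_def field_simps)

lemma pt_eq_fin: "pt p q = fin (2 * q - 1, 2 * p + 1)"
  by (simp add: fin_def pt_def)

lemma fin_pfix: "fin pfix = pt 0 0"
  by (simp add: pfix_def fin_def pt_def)

lemma f_pt: "q \<noteq> 1 \<Longrightarrow> f_ext (pt p q) = pt q ((q + p + q * p) / (q - 1))"
  unfolding pt_eq_fin by (subst f_ext_fin) (auto simp: fin_def field_simps)

lemma finv_pt: "p \<noteq> -1 \<Longrightarrow> finv_ext (pt p q) = pt (bk p q) p"
proof -
  assume p: "p \<noteq> -1"
  then have "1 + p \<noteq> 0" by auto
  then have "(2 * q - 1) * (2 * p + 1 - 3) / (1 + (2 * p + 1)) = 2 * bk p q + 1"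
    unfolding bk_def by (simp add: divide_simps) (simp add: algebra_simps)
  then show ?thesis using p unfolding pt_eq_fin by (subst finv_ext_fin) (auto simp: fin_def)
qed

lemma f_pt_bk: "p \<noteq> -1 \<Longrightarrow> p \<noteq> 1 \<Longrightarrow> f_ext (pt (bk p q) p) = pt p q"
proof -
  assume p: "p \<noteq> -1" "p \<noteq> 1"
  then have "1 + p \<noteq> 0" by auto
  from bk_eq[OF this, of q] have "q * (p - 1) = p + bk p q + p * bk p q" by (simp add: algebra_simps)
  then have "(p + bk p q + p * bk p q) / (p - 1) = q" using p by (simp add: divide_eq_eq)
  then show ?thesis using p by (simp add: f_pt)
qed

definition regular_pair :: "(real \<Rightarrow> real) \<Rightarrow> (real \<Rightarrow> real) \<Rightarrow> real \<Rightarrow> bool" where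
  "regular_pair u v t \<longleftrightarrow> ranal u t \<and> ranal v t \<and> (deriv u t \<noteq> 0 \<or> deriv v t \<noteq> 0)"

text \<open>If u' = 0, the new velocity is (u - 1) v' / (1 + u), which vanishes on the line u = 1:
  the inverse contracts that line to the indeterminacy point \<open>pt (-1/2) 1\<close>. A
  transversal crossing, u' \<noteq> 0, survives because u becomes the second component.\<close>

lemma regular_pair_bk:
  assumes "regular_pair u v t" "u t \<noteq> -1" "u t \<noteq> 1 \<or> deriv u t \<noteq> 0"
  shows "regular_pair (\<lambda>s. bk (u s) (v s)) u t"
proof -
  have uv: "ranal u t" "ranal v t" "deriv u t \<noteq> 0 \<or> deriv v t \<noteq> 0" using assms by (auto simp: regular_pair_def)
  have u1: "1 + u t \<noteq> 0" using assms(2) by auto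
  have "deriv (\<lambda>s. bk (u s) (v s)) t = ((v t - 1 - bk (u t) (v t)) * deriv u t + (u t - 1) * deriv v t) / (1 + u t)"
    by (rule DERIV_imp_deriv) (rule bk_has_derivative[OF ranal_derivative[OF uv(1)] ranal_derivative[OF uv(2)] u1])
  then show ?thesis unfolding regular_pair_def
    using ranal_bk[OF uv(1,2) u1] uv assms(3) u1 by (cases "deriv u t = 0") auto
qed

lemma deriv_affine: "ranal u t \<Longrightarrow> deriv (\<lambda>s. k * u s + l) t = k * deriv u t"
  by (rule DERIV_imp_deriv)
    (use DERIV_add[OF DERIV_cmult[OF ranal_derivative, of u t k] DERIV_const, of l] in simp)

lemma regular_curve_pt:
  assumes "regular_pair u v t" "\<forall>\<^sub>F s in nhds t. c s = pt (u s) (v s)"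
  shows "regular_curve_at c t"
proof -
  have uv: "ranal u t" "ranal v t" "deriv u t \<noteq> 0 \<or> deriv v t \<noteq> 0" using assms by (auto simp: regular_pair_def)
  have "regular_curve_at (\<lambda>s. pt (u s) (v s)) t" unfolding regular_curve_at_def
  proof (intro exI conjI)
    show "chart_rep (fst \<circ> (\<lambda>s. pt (u s) (v s))) t (\<lambda>s. 2 * v s + (-1))"
      "chart_rep (snd \<circ> (\<lambda>s. pt (u s) (v s))) t (\<lambda>s. 2 * u s + 1)"
      by (auto simp: chart_rep_def pt_def)
    show "ranal (\<lambda>s. 2 * v s + (-1)) t" "ranal (\<lambda>s. 2 * u s + 1) t"
      by (intro ranal_add ranal_mult ranal_const uv)+
    show "deriv (\<lambda>s. 2 * v s + (-1)) t \<noteq> 0 \<or> deriv (\<lambda>s. 2 * u s + 1) t \<noteq> 0"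
      unfolding deriv_affine[OF uv(1)] deriv_affine[OF uv(2)] using uv(3) by auto
  qed
  then show ?thesis by (rule regular_curve_cong) (use assms(2) in \<open>auto elim: eventually_mono\<close>)
qed

section \<open>Germs of curves through points at infinity\<close>

definition einv :: "real \<Rightarrow> real option" where
  "einv r = (if r = 0 then None else Some (1 / r))"

lemma chart_rep_einv: "chart_rep (\<lambda>s. einv (u s)) t u"
  unfolding chart_rep_def by (rule disjI2, rule always_eventually) (auto simp: einv_def emoebius_def)

lemma chart_rep_Some: "chart_rep (\<lambda>s. Some (u s)) t u"
  unfolding chart_rep_def by simp

text \<open>Regular germs through (-3 - 2 j, infinity), with 1/y as local coordinate;
  \<open>germ_side\<close> is the same at (infinity, -3 - 2 j) with 1/x. These points form the
  backward orbit of (-3, infinity), and a backward step leads from one kind to the other.\<close>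

definition germ_top :: "nat \<Rightarrow> (real \<Rightarrow> eplane) \<Rightarrow> real \<Rightarrow> bool" where
  "germ_top j c t \<longleftrightarrow> (\<exists>x \<eta>. regular_pair x \<eta> t \<and> x t = - 3 - 2 * real j \<and> \<eta> t = 0 \<and>
     (\<forall>\<^sub>F s in nhds t. c s = (Some (x s), einv (\<eta> s))))"

definition germ_side :: "nat \<Rightarrow> (real \<Rightarrow> eplane) \<Rightarrow> real \<Rightarrow> bool" where
  "germ_side j c t \<longleftrightarrow> (\<exists>\<xi> y. regular_pair \<xi> y t \<and> \<xi> t = 0 \<and> y t = - 3 - 2 * real j \<and>
     (\<forall>\<^sub>F s in nhds t. c s = (einv (\<xi> s), Some (y s))))"

lemma germ_top_regular: "germ_top j c t \<Longrightarrow> regular_curve_at c t"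
proof -
  assume "germ_top j c t"
  then obtain x \<eta> where h: "regular_pair x \<eta> t" "\<forall>\<^sub>F s in nhds t. c s = (Some (x s), einv (\<eta> s))"
    by (auto simp: germ_top_def)
  have "regular_curve_at (\<lambda>s. (Some (x s), einv (\<eta> s))) t" unfolding regular_curve_at_def
    using h(1) chart_rep_einv[of \<eta> t] chart_rep_Some[of x t]
    by (intro exI[of _ x] exI[of _ \<eta>]) (auto simp: o_def regular_pair_def)
  then show ?thesis by (rule regular_curve_cong) (use h(2) in \<open>auto elim: eventually_mono\<close>)
qed

lemma germ_side_regular: "germ_side j c t \<Longrightarrow> regular_curve_at c t"
proof -
  assume "germ_side j c t"
  then obtain x \<eta> where h: "regular_pair x \<eta> t" "\<forall>\<^sub>F s in nhds t. c s = (einv (x s), Some (\<eta> s))"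
    by (auto simp: germ_side_def)
  have "regular_curve_at (\<lambda>s. (einv (x s), Some (\<eta> s))) t" unfolding regular_curve_at_def
    using h(1) chart_rep_einv[of x t] chart_rep_Some[of \<eta> t]
    by (intro exI[of _ x] exI[of _ \<eta>]) (auto simp: o_def regular_pair_def)
  then show ?thesis by (rule regular_curve_cong) (use h(2) in \<open>auto elim: eventually_mono\<close>)
qed

lemma eventually_ranal_ne: "ranal u t \<Longrightarrow> u t \<noteq> k \<Longrightarrow> \<forall>\<^sub>F s in nhds t. u s \<noteq> k"
  using ranal_isCont[of u t] tendsto_imp_eventually_ne[of u "u t" "nhds t" k]
  by (simp add: isCont_def tendsto_at_iff_tendsto_nhds)

text \<open>The whole line u = -1 is sent to (-3, infinity), but in the coordinate 1/y the image is
  the smooth function \<eta> with \<eta> = 0 at t, and the first coordinate keeps the velocity 2 u'.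
  The condition v \<noteq> 1/2 avoids (0, -1), where the inverse is indeterminate.\<close>

lemma germ_top_cross:
  assumes uv: "regular_pair u v t" and u: "u t = -1" "deriv u t \<noteq> 0" and v: "v t \<noteq> 1/2"
    and c: "\<forall>\<^sub>F s in nhds t. c s = pt (u s) (v s)"
  shows "germ_top 0 (\<lambda>s. finv_ext (c s)) t"
proof -
  have r: "ranal u t" "ranal v t" using uv by (auto simp: regular_pair_def)
  define D where "D = (\<lambda>s. (2 * v s - 1) * (2 * u s - 2))"
  have rD: "ranal D t" unfolding D_def by (intro ranal_mult ranal_diff ranal_const r)
  have D0: "D t \<noteq> 0" using u v by (auto simp: D_def)
  define \<eta> where "\<eta> = (\<lambda>s. (2 + 2 * u s) / D s)"
  have r\<eta>: "ranal \<eta> t" unfolding \<eta>_def by (intro ranal_divide ranal_add ranal_mult ranal_const r rD D0)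
  have "regular_pair (\<lambda>s. 2 * u s + (-1)) \<eta> t"
    unfolding regular_pair_def deriv_affine[OF r(1)]
    using ranal_add[OF ranal_mult[OF ranal_const r(1)] ranal_const, of 2 "-1"] r\<eta> u by auto
  moreover have "\<forall>\<^sub>F s in nhds t. finv_ext (c s) = (Some (2 * u s + (-1)), einv (\<eta> s))"
    using c eventually_ranal_ne[OF rD D0]
  proof eventually_elim
    case (elim s)
    have "finv_ext (c s) = (Some (2 * u s - 1), emult (Some (2 * v s - 1)) (emoebius 1 (-3) 1 1 (Some (2 * u s + 1))))"
      unfolding elim(1) pt_def finv_ext_def by (simp add: emoebius_def)
    moreover have "emult (Some (2 * v s - 1)) (emoebius 1 (-3) 1 1 (Some (2 * u s + 1))) = einv (\<eta> s)"
      using elim(2) by (auto simp: emoebius_def emult_def einv_def \<eta>_def D_def field_simps)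
    ultimately show ?case by simp
  qed
  ultimately show ?thesis unfolding germ_top_def using u
    by (intro exI[of _ "\<lambda>s. 2 * u s + (-1)"] exI[of _ \<eta>]) (auto simp: \<eta>_def)
qed

text \<open>With \<eta> = 1/y the inverse map is (x, \<eta>) -> (\<eta>/(1 - 2 \<eta>), x (1 - 3
  \<eta>)/(1 + \<eta>)) in the chart 1/x of the image. Its differential at \<eta> = 0 is
  invertible.\<close>

lemma germ_top_finv:
  assumes "germ_top j c t"
  shows "germ_side j (\<lambda>s. finv_ext (c s)) t"
proof -
  obtain x \<eta> where h: "regular_pair x \<eta> t" "x t = - 3 - 2 * real j" "\<eta> t = 0"
      "\<forall>\<^sub>F s in nhds t. c s = (Some (x s), einv (\<eta> s))"
    using assms by (auto simp: germ_top_def)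
  have r: "ranal x t" "ranal \<eta> t" using h(1) by (auto simp: regular_pair_def)
  define \<xi> y where "\<xi> = (\<lambda>s. \<eta> s / (1 - 2 * \<eta> s))" and "y = (\<lambda>s. x s * (1 - 3 * \<eta> s) / (1 + \<eta> s))"
  have nz: "1 - 2 * \<eta> t \<noteq> 0" "1 + \<eta> t \<noteq> 0" using h by auto
  have r': "ranal \<xi> t" "ranal y t" unfolding \<xi>_def y_def
    by (intro ranal_divide ranal_diff ranal_add ranal_mult ranal_const r nz)+
  have d1: "deriv \<xi> t = deriv \<eta> t" unfolding \<xi>_def
    by (rule DERIV_imp_deriv)
      (auto intro!: derivative_eq_intros ranal_derivative[OF r(2)] simp: h(3))
  have d2: "deriv y t = deriv x t - 4 * x t * deriv \<eta> t" unfolding y_def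
    by (rule DERIV_imp_deriv)
      (auto intro!: derivative_eq_intros ranal_derivative[OF r(1)] ranal_derivative[OF r(2)] simp: h(3))
  have "regular_pair \<xi> y t" unfolding regular_pair_def d1 d2 using r' h(1) by (auto simp: regular_pair_def)
  moreover have "\<forall>\<^sub>F s in nhds t. \<eta> s \<noteq> 1/2" "\<forall>\<^sub>F s in nhds t. \<eta> s \<noteq> -1"
    by (rule eventually_ranal_ne[OF r(2)], simp add: h(3))+
  then have "\<forall>\<^sub>F s in nhds t. finv_ext (c s) = (einv (\<xi> s), Some (y s))"
    using h(4)
  proof eventually_elim
    case (elim s)
    have n: "1 - 2 * \<eta> s \<noteq> 0" "1 + \<eta> s \<noteq> 0" using elim by auto
    show ?case
    proof (cases "\<eta> s = 0")
      case True
      then show ?thesis unfolding elim(3) by (simp add: finv_ext_def einv_def emoebius_def emult_def \<xi>_def y_def)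
    next
      case False
      have "1 / \<eta> s + 1 \<noteq> 0" using False n by (simp add: field_simps)
      then have "emoebius 1 (-3) 1 1 (Some (1 / \<eta> s)) = Some ((1 - 3 * \<eta> s) / (1 + \<eta> s))"
      proof -
        have "1 / \<eta> s - 3 = (1 - 3 * \<eta> s) / \<eta> s" "1 / \<eta> s + 1 = (1 + \<eta> s) / \<eta> s"
          using False by (simp_all add: field_simps)
        then show ?thesis using False n by (simp add: emoebius_def)
      qed
      moreover have "emoebius 1 (-2) 0 1 (Some (1 / \<eta> s)) = einv (\<xi> s)"
        using False n by (simp add: emoebius_def einv_def \<xi>_def field_simps)
      ultimately show ?thesis unfolding elim(3) using False by (simp add: finv_ext_def einv_def[of "\<eta> s"] emult_def y_def)
    qed
  qed
  ultimately show ?thesis unfolding germ_side_def using h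
    by (intro exI[of _ \<xi>] exI[of _ y]) (auto simp: \<xi>_def y_def)
qed

lemma germ_side_finv:
  assumes "germ_side j c t"
  shows "germ_top (Suc j) (\<lambda>s. finv_ext (c s)) t"
proof -
  obtain \<xi> y where h: "regular_pair \<xi> y t" "\<xi> t = 0" "y t = - 3 - 2 * real j"
      "\<forall>\<^sub>F s in nhds t. c s = (einv (\<xi> s), Some (y s))"
    using assms by (auto simp: germ_side_def)
  have r: "ranal \<xi> t" "ranal y t" using h(1) by (auto simp: regular_pair_def)
  define \<eta> where "\<eta> = (\<lambda>s. \<xi> s * (1 + y s) / (y s - 3))"
  have nz: "y t \<noteq> 3" "y t \<noteq> -1" using h(3) by auto
  have r\<eta>: "ranal \<eta> t" unfolding \<eta>_def
    by (intro ranal_divide ranal_diff ranal_add ranal_mult ranal_const r) (use nz in auto)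
  have d: "deriv \<eta> t = deriv \<xi> t * (1 + y t) / (y t - 3)" unfolding \<eta>_def
    by (rule DERIV_imp_deriv)
      (use nz in \<open>auto intro!: derivative_eq_intros ranal_derivative[OF r(1)] ranal_derivative[OF r(2)] simp: h(2)\<close>)
  have dy: "deriv (\<lambda>s. 1 * y s + (-2)) t = deriv y t" unfolding deriv_affine[OF r(2)] by simp
  have "regular_pair (\<lambda>s. 1 * y s + (-2)) \<eta> t" unfolding regular_pair_def d dy
    using ranal_add[OF ranal_mult[OF ranal_const r(2)] ranal_const, of 1 "-2"] r\<eta> h(1) nz
    by (auto simp: regular_pair_def add_eq_0_iff2)
  moreover have "\<forall>\<^sub>F s in nhds t. finv_ext (c s) = (Some (1 * y s + (-2)), einv (\<eta> s))"
    using h(4) eventually_ranal_ne[OF r(2) nz(1)] eventually_ranal_ne[OF r(2) nz(2)]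
  proof eventually_elim
    case (elim s)
    have n: "y s - 3 \<noteq> 0" "1 + y s \<noteq> 0" "y s + 1 \<noteq> 0" using elim by auto
    show ?case unfolding elim(1) using n
      by (auto simp: finv_ext_def einv_def emoebius_def emult_def \<eta>_def divide_simps)
  qed
  ultimately show ?thesis unfolding germ_top_def using h
    by (intro exI[of _ "\<lambda>s. 1 * y s + (-2)"] exI[of _ \<eta>]) (auto simp: \<eta>_def)
qed

section \<open>Orbits and the recurrence\<close>

lemma limitin_circle_iff:
  "limitin circle_top g (Some l) F \<longleftrightarrow> filterlim g (nb (Some l)) F"
proof
  assume L: "limitin circle_top g (Some l) F"
  show "filterlim g (nb (Some l)) F" unfolding filterlim_iff
  proof (intro allI impI)
    fix P assume "eventually P (nb (Some l))"
    from eventually_nb_imp_openin[OF this] obtain A where A: "openin circle_top A" "Some l \<in> A" "\<forall>w\<in>A. P w" by blast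
    then have "\<forall>\<^sub>F x in F. g x \<in> A" using L by (simp add: limitin_def)
    then show "\<forall>\<^sub>F x in F. P (g x)" by eventually_elim (use A in blast)
  qed
next
  assume "filterlim g (nb (Some l)) F"
  then show "limitin circle_top g (Some l) F"
    by (auto simp: limitin_def UNIV_option_conv[symmetric] openin_circle_top filterlim_iff)
qed

lemma limitin_pt0_iff:
  "limitin eplane_top g (pt 0 0) F \<longleftrightarrow>
    filterlim (fst \<circ> g) (nb (Some (-1))) F \<and> filterlim (snd \<circ> g) (nb (Some 1)) F"
  by (simp add: limitin_pairwise limitin_circle_iff pt_def)

lemma limitin_pt0I:
  assumes "(p \<longlongrightarrow> 0) F" "(q \<longlongrightarrow> 0) F"
  shows "limitin eplane_top (\<lambda>n. pt (p n) (q n)) (pt 0 0) F"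
proof -
  have "((\<lambda>n. 2 * q n - 1) \<longlongrightarrow> 2 * 0 - 1) F" "((\<lambda>n. 2 * p n + 1) \<longlongrightarrow> 2 * 0 + 1) F"
    by (intro tendsto_intros assms)+
  then have "((\<lambda>n. 2 * q n - 1) \<longlongrightarrow> -1) F" "((\<lambda>n. 2 * p n + 1) \<longlongrightarrow> 1) F" by simp_all
  from filterlim_nb_finite[OF this(1)] filterlim_nb_finite[OF this(2)] show ?thesis
    unfolding limitin_pt0_iff by (simp add: o_def pt_def)
qed

lemma limitin_pt0D:
  assumes "limitin eplane_top g (pt 0 0) F" "0 < e"
  shows "\<forall>\<^sub>F n in F. \<exists>p q. g n = pt p q \<and> \<bar>p\<bar> < e \<and> \<bar>q\<bar> < e"
proof -
  have L: "filterlim (fst \<circ> g) (nb (Some (-1))) F" "filterlim (snd \<circ> g) (nb (Some 1)) F"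
    using assms(1) unfolding limitin_pt0_iff by blast+
  have *: "eventually (\<lambda>z. \<exists>x. z = Some x \<and> \<bar>x - l\<bar> < 2 * e) (nb (Some l))" for l
    unfolding eventually_nb_Some eventually_nhds_metric dist_real_def
    using assms(2) by (intro exI[of _ "2 * e"]) auto
  have "\<forall>\<^sub>F n in F. \<exists>x. (fst \<circ> g) n = Some x \<and> \<bar>x - (-1)\<bar> < 2 * e"
    by (rule eventually_compose_filterlim[OF * L(1)])
  moreover have "\<forall>\<^sub>F n in F. \<exists>y. (snd \<circ> g) n = Some y \<and> \<bar>y - 1\<bar> < 2 * e"
    by (rule eventually_compose_filterlim[OF * L(2)])
  ultimately have "\<forall>\<^sub>F n in F. \<exists>x. fst (g n) = Some x \<and> \<bar>x + 1\<bar> < 2 * e"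
    "\<forall>\<^sub>F n in F. \<exists>y. snd (g n) = Some y \<and> \<bar>y - 1\<bar> < 2 * e" by simp_all
  then show ?thesis
  proof eventually_elim
    case (elim n)
    then obtain x y where xy: "g n = (Some x, Some y)" "\<bar>x + 1\<bar> < 2 * e" "\<bar>y - 1\<bar> < 2 * e"
      by (cases "g n") auto
    have "g n = pt ((y - 1) / 2) ((x + 1) / 2)" unfolding xy(1) pt_def by (simp add: field_simps)
    moreover have "\<bar>(y - 1) / 2\<bar> < e" "\<bar>(x + 1) / 2\<bar> < e" using xy by simp_all
    ultimately show ?case by blast
  qed
qed

definition at_infinity_point :: "eplane \<Rightarrow> bool" where
  "at_infinity_point z \<longleftrightarrow> fst z = None \<or> snd z = None"

lemma not_at_infinity_pt [simp]: "\<not> at_infinity_point (pt p q)"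
  by (simp add: at_infinity_point_def pt_def)

lemma finite_is_pt: "\<not> at_infinity_point z \<Longrightarrow> \<exists>p q. z = pt p q"
proof -
  assume "\<not> at_infinity_point z"
  then obtain x y where "z = (Some x, Some y)" by (cases z) (auto simp: at_infinity_point_def)
  then have "z = fin (x, y)" by (simp add: fin_def)
  then show ?thesis unfolding fin_eq_pt by blast
qed

text \<open>Infinity is forward invariant off the indeterminacy points. Hence an orbit that
  converges to the fixed point is finite from the start and is described by the recurrence.\<close>

lemma f_infinity: "at_infinity_point z \<Longrightarrow> z \<notin> Ind_f \<Longrightarrow> at_infinity_point (f_ext z)"
  by (cases z) (auto simp: at_infinity_point_def f_ext_def Ind_f_def emoebius_def emult_def split: option.splits if_splits)

lemma f_pt_1: "at_infinity_point (f_ext (pt p 1))"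
  by (simp add: at_infinity_point_def f_ext_def pt_def emoebius_def emult_def)

lemma finv_pt_minus1: "at_infinity_point (finv_ext (pt (-1) q))"
  by (simp add: at_infinity_point_def finv_ext_def pt_def emoebius_def emult_def)

lemma f_pt_finite:
  assumes "\<not> at_infinity_point (f_ext (pt p q))"
  obtains r where "f_ext (pt p q) = pt q r" "q \<noteq> 1" "r * (q - 1) = q + p + q * p"
proof -
  have q: "q \<noteq> 1" using assms f_pt_1 by auto
  then show ?thesis using that[of "(q + p + q * p) / (q - 1)"] f_pt[OF q] by simp
qed

lemma finv_pt_finite:
  assumes "\<not> at_infinity_point (finv_ext (pt p q))"
  obtains r where "finv_ext (pt p q) = pt r p" "q * (p - 1) = p + r + p * r"
proof -
  have p: "p \<noteq> -1" using assms finv_pt_minus1 by auto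
  then have "1 + p \<noteq> 0" by auto
  from bk_eq[OF this, of q] show ?thesis
    by (intro that[of "bk p q"]) (simp_all add: finv_pt[OF p] algebra_simps)
qed

lemma pt_iterate_sequence:
  assumes fin: "\<And>n. \<not> at_infinity_point ((f_ext ^^ n) z)"
  obtains v where "recurrence v" "\<And>n. (f_ext ^^ n) z = pt (v n) (v (n + 1))" "\<And>n. v (n + 1) \<noteq> 1"
proof -
  have "\<forall>n. \<exists>pq. (f_ext ^^ n) z = pt (fst pq) (snd pq)" using finite_is_pt[OF fin] by auto
  from choice[OF this] obtain g where g: "\<And>n. (f_ext ^^ n) z = pt (fst (g n)) (snd (g n))" by blast
  define v where "v = (\<lambda>n. fst (g n))"
  have step: "v (n + 1) = snd (g n) \<and> v (n + 1) \<noteq> 1 \<and>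
      snd (g (n + 1)) * (snd (g n) - 1) = snd (g n) + v n + snd (g n) * v n" for n
  proof -
    have e: "(f_ext ^^ (n + 1)) z = f_ext (pt (v n) (snd (g n)))" using g[of n] by (simp add: v_def)
    then have "\<not> at_infinity_point (f_ext (pt (v n) (snd (g n))))" using fin[of "n + 1"] by metis
    then obtain r where r: "f_ext (pt (v n) (snd (g n))) = pt (snd (g n)) r" "snd (g n) \<noteq> 1"
      "r * (snd (g n) - 1) = snd (g n) + v n + snd (g n) * v n" by (rule f_pt_finite)
    have "pt (fst (g (n + 1))) (snd (g (n + 1))) = pt (snd (g n)) r" using g[of "n + 1"] e r(1) by metis
    then show ?thesis using r by (simp add: v_def)
  qed
  show ?thesis
  proof (rule that[of v])
    show "recurrence v" unfolding recurrence_def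
    proof
      fix n
      have "v (n + 2) = snd (g (n + 1))" using step[of "n + 1"] by (simp add: add.assoc)
      then show "v (n + 2) * (v (n + 1) - 1) = v (n + 1) + v n + v (n + 1) * v n" using step[of n] by simp
    qed
    show "(f_ext ^^ n) z = pt (v n) (v (n + 1))" for n using g[of n] step[of n] by (simp add: v_def)
    show "v (n + 1) \<noteq> 1" for n using step by blast
  qed
qed

text \<open>The one-sided form of the trap, without boundedness: here it serves to contradict
  convergence to 0.\<close>

lemma recurrence_trap:
  assumes v: "recurrence v" and "0 \<le> v k" "1 < v (k + 1)"
  shows "0 \<le> v (k + j) \<and> 1 < v (k + j + 1)"
proof (induction j)
  case (Suc j)
  define m where "m = k + j"
  have h: "0 \<le> v m" "1 < v (m + 1)" using Suc by (simp_all add: m_def)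
  have "(v (m + 2) - v m) * (v (m + 1) - 1) = v (m + 1) + 2 * v m"
    using recurrenceD[OF v, of m] by (simp add: algebra_simps)
  then have "1 * (v (m + 1) - 1) < (v (m + 2) - v m) * (v (m + 1) - 1)" using h by simp
  then have "1 < v (m + 2) - v m" using h by (simp only: mult_less_cancel_right)
  then show ?case using h by (simp add: m_def)
qed (use assms in simp)

lemma recurrence_minus1:
  assumes v: "recurrence v" and "v (k + 1) = -1"
  shows "1 < v (k + 3 + j)"
proof -
  have i: "k + 1 + 2 = k + 3" "k + 1 + 1 = k + 2" "k + 2 + 1 = k + 3" "k + 2 + j + 1 = k + 3 + j" by simp_all
  have y: "v (k + 2) = 1 / 2" using recurrenceD[OF v, of k] assms(2) by simp
  moreover have "v (k + 3) = 2" using recurrenceD[OF v, of "k + 1"] unfolding i y assms(2) by simp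
  ultimately show ?thesis using recurrence_trap[OF v, of "k + 2" j] unfolding i by simp
qed

text \<open>The value -1 is followed by terms that all exceed 1 from the second on, against
  convergence. With -1 excluded, each forward step can be undone by \<open>finv_ext\<close>, as
  \<open>backward_iterate\<close> requires.\<close>

lemma stable_orbit:
  assumes "z \<in> stable_set"
  obtains v where "recurrence v" "v \<longlonglongrightarrow> 0" "\<And>n. (f_ext ^^ n) z = pt (v n) (v (n + 1))"
    "\<And>n. v (n + 1) \<noteq> 1 \<and> v (n + 1) \<noteq> -1"
proof -
  have D: "\<And>n. (f_ext ^^ n) z \<notin> Ind_f" and L: "limitin eplane_top (\<lambda>n. (f_ext ^^ n) z) (pt 0 0) sequentially"
    using assms by (auto simp: stable_set_def attracted_set_def orbit_defined_def fin_pfix)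
  have fin: "\<not> at_infinity_point ((f_ext ^^ n) z)" for n
  proof
    assume inf: "at_infinity_point ((f_ext ^^ n) z)"
    have "at_infinity_point ((f_ext ^^ (n + j)) z)" for j
      by (induction j) (use inf f_infinity D in auto)
    moreover have "\<forall>\<^sub>F m in sequentially. n \<le> m \<and> \<not> at_infinity_point ((f_ext ^^ m) z)"
      using limitin_pt0D[OF L zero_less_one] eventually_ge_at_top[of n] by eventually_elim auto
    then obtain m where "n \<le> m" "\<not> at_infinity_point ((f_ext ^^ m) z)"
      by (auto simp: eventually_sequentially)
    ultimately show False by (metis le_iff_add)
  qed
  obtain v where v: "recurrence v" "\<And>n. (f_ext ^^ n) z = pt (v n) (v (n + 1))" "\<And>n. v (n + 1) \<noteq> 1"
    using pt_iterate_sequence[OF fin] by blast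
  have lim: "v \<longlonglongrightarrow> 0"
  proof (rule LIMSEQ_I)
    fix e :: real assume "0 < e"
    from limitin_pt0D[OF L this] obtain N where "\<And>n. N \<le> n \<Longrightarrow> \<bar>v n\<bar> < e"
      unfolding v(2) eventually_sequentially by auto
    then show "\<exists>N. \<forall>n\<ge>N. norm (v n - 0) < e" by auto
  qed
  have "v (k + 1) \<noteq> -1" for k
  proof
    assume "v (k + 1) = -1"
    from recurrence_minus1[OF v(1) this] have "\<And>j. 1 < v (k + 3 + j)" .
    moreover have "\<forall>\<^sub>F n in sequentially. v n < 1" using order_tendstoD(2)[OF lim] by simp
    then obtain N where "\<And>n. N \<le> n \<Longrightarrow> v n < 1" by (auto simp: eventually_sequentially)
    then have "v (k + 3 + N) < 1" by simp
    ultimately show False by (metis less_asym)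
  qed
  with v lim show ?thesis using that by blast
qed

lemma backward_iterate:
  assumes v: "recurrence v" and ne: "\<And>n. v (n + 1) \<noteq> -1"
  shows "(finv_ext ^^ n) (pt (v n) (v (n + 1))) = pt (v 0) (v 1)"
proof (induction n)
  case (Suc n)
  have "bk (v (n + 1)) (v (n + 2)) = v n"
  proof -
    have "1 + v (n + 1) \<noteq> 0" using ne[of n] by auto
    moreover have "v n * (1 + v (n + 1)) = v (n + 1) * v (n + 2) - v (n + 1) - v (n + 2)"
      using recurrenceD[OF v, of n] by (simp add: algebra_simps)
    ultimately show ?thesis by (simp add: bk_def divide_eq_eq)
  qed
  then have "finv_ext (pt (v (Suc n)) (v (Suc n + 1))) = pt (v n) (v (n + 1))"
    using finv_pt[OF ne[of n], of "v (n + 2)"] by simp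
  then show ?case using Suc by (simp add: funpow_Suc_right del: funpow.simps)
qed simp

lemma pfix_orbit: "(f_ext ^^ n) (pt 0 0) = pt 0 0" "(finv_ext ^^ n) (pt 0 0) = pt 0 0"
  by (induction n) (simp_all add: f_pt finv_pt bk_def)

section \<open>Points with bounded full orbit\<close>

lemma K_set_eq: "K_set = {pfix}"
proof
  have "pt 0 0 \<notin> Ind_f" "pt 0 0 \<notin> Ind_finv" by (simp_all add: Ind_f_def Ind_finv_def pt_def)
  then show "{pfix} \<subseteq> K_set"
  proof -
    assume I: "pt 0 0 \<notin> Ind_f" "pt 0 0 \<notin> Ind_finv"
    have o: "(f_ext ^^ n) (fin pfix) = pt 0 0" "(finv_ext ^^ n) (fin pfix) = pt 0 0" for n
      unfolding fin_pfix by (rule pfix_orbit)+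
    have "fin pfix \<in> orbit_defined f_ext Ind_f" "fin pfix \<in> orbit_defined finv_ext Ind_finv"
      unfolding orbit_defined_def using I o by simp_all
    moreover have "bounded {pfix}" "\<forall>n. (f_ext ^^ n) (fin pfix) \<in> fin ` {pfix} \<and> (finv_ext ^^ n) (fin pfix) \<in> fin ` {pfix}"
      unfolding o by (simp_all add: fin_pfix)
    ultimately show "{pfix} \<subseteq> K_set" unfolding K_set_def by blast
  qed
next
  show "K_set \<subseteq> {pfix}"
  proof
    fix z assume "z \<in> K_set"
    then have "\<exists>S. bounded S \<and> (\<forall>n. (f_ext ^^ n) (fin z) \<in> fin ` S \<and> (finv_ext ^^ n) (fin z) \<in> fin ` S)"
      by (simp add: K_set_def)
    then obtain S where S: "bounded S" "\<And>n. (f_ext ^^ n) (fin z) \<in> fin ` S" "\<And>n. (finv_ext ^^ n) (fin z) \<in> fin ` S"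
      by (elim exE conjE) (rule that, assumption, drule spec, erule conjunct1, drule spec, erule conjunct2)
    have fin_pt: "\<exists>p q. fin s = pt p q" for s
      using fin_eq_pt[of "fst s" "snd s"] by (metis prod.collapse)
    have ni: "\<not> at_infinity_point x" if "x \<in> fin ` S" for x
    proof -
      obtain s where "x = fin s" using \<open>x \<in> fin ` S\<close> by blast
      then obtain p q where "x = pt p q" using fin_pt by blast
      then show ?thesis by simp
    qed
    note nf = ni[OF S(2)] and nb = ni[OF S(3)]
    obtain v where v: "recurrence v" "\<And>n. (f_ext ^^ n) (fin z) = pt (v n) (v (n + 1))" "\<And>n. v (n + 1) \<noteq> 1"
    proof (rule pt_iterate_sequence[OF nf])
      fix v assume h: "recurrence v" "\<And>n. (f_ext ^^ n) (fin z) = pt (v n) (v (n + 1))" "\<And>n. v (n + 1) \<noteq> 1"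
      show thesis by (rule that[OF h])
    qed
    have "\<exists>pq. (finv_ext ^^ n) (fin z) = pt (fst pq) (snd pq)" for n
    proof -
      obtain p q where "(finv_ext ^^ n) (fin z) = pt p q" using finite_is_pt[OF nb] by blast
      then show ?thesis by (intro exI[of _ "(p, q)"]) simp
    qed
    then have "\<exists>g. \<forall>n. (finv_ext ^^ n) (fin z) = pt (fst (g n)) (snd (g n))" by (intro choice allI)
    then obtain g where g: "\<And>n. (finv_ext ^^ n) (fin z) = pt (fst (g n)) (snd (g n))" by (elim exE) (rule that, erule spec)
    define w where "w = (\<lambda>n. fst (g n))"
    have ws: "snd (g (Suc n)) = w n \<and> snd (g n) * (w n - 1) = w n + w (Suc n) + w n * w (Suc n)" for n
    proof -
      have e: "(finv_ext ^^ Suc n) (fin z) = finv_ext (pt (w n) (snd (g n)))" using g[of n] by (simp add: w_def)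
      have "\<not> at_infinity_point (finv_ext (pt (w n) (snd (g n))))" using nb[of "Suc n"] unfolding e .
      then obtain r where r: "finv_ext (pt (w n) (snd (g n))) = pt r (w n)"
        "snd (g n) * (w n - 1) = w n + r + w n * r" by (rule finv_pt_finite)
      have "pt (fst (g (Suc n))) (snd (g (Suc n))) = pt r (w n)" using g[of "Suc n"] unfolding e r(1) by (rule sym)
      then show ?thesis using r by (simp add: w_def)
    qed
    have w0: "w 0 = v 0" "snd (g 0) = v 1" using g[of 0] v(2)[of 0] by (simp_all add: w_def)
    obtain M where M: "\<And>s. s \<in> S \<Longrightarrow> norm s \<le> M" using S(1) by (auto simp: bounded_iff)
    have ptM: "\<bar>p\<bar> \<le> M + 2" if pq: "pt p q \<in> fin ` S" for p q
    proof -
      obtain s where s: "s \<in> S" "pt p q = fin s" using pq by blast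
      then have "snd s = 2 * p + 1" by (simp add: pt_def fin_def)
      moreover have "\<bar>snd s\<bar> \<le> M" using M[OF s(1)] norm_snd_le[of "snd s" "fst s"] unfolding prod.collapse real_norm_def by linarith
      ultimately show ?thesis by linarith
    qed
    \<comment> \<open>Forward and backward orbit glued at index 0; at n = -1 the recurrence holds
      across the seam because \<open>snd (g 0)\<close> is \<open>v 1\<close>.\<close>
    define u where "u = (\<lambda>n::int. if 0 \<le> n then v (nat n) else w (nat (- n)))"
    have "two_sided u" unfolding two_sided_def
    proof (intro conjI allI)
      fix n :: int
      consider "0 \<le> n" | "n = -1" | "n \<le> -2" by linarith
      then show "u (n + 2) * (u (n + 1) - 1) = u (n + 1) + u n + u (n + 1) * u n"
      proof cases
        case 1
        then have "nat (n + 2) = nat n + 2" "nat (n + 1) = nat n + 1" by simp_all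
        then show ?thesis using 1 recurrenceD[OF v(1), of "nat n"] by (simp add: u_def)
      next
        case 2
        then show ?thesis using ws[of 0] w0 by (simp add: u_def)
      next
        case 3
        define k where "k = nat (- n - 2)"
        have k: "n = - int (Suc (Suc k))" "n + 1 = - int (Suc k)" "n + 2 = - int k" using 3 by (simp_all add: k_def)
        have un: "u (- int l) = w l" for l
          using w0(1) by (cases "l = 0") (simp_all add: u_def)
        have "u n = w (Suc (Suc k))" "u (n + 1) = w (Suc k)" "u (n + 2) = w k" unfolding k(2,3) unfolding k(1) by (rule un)+
        moreover have "snd (g (Suc k)) = w k" using ws[of k] by blast
        ultimately show ?thesis using ws[of "Suc k"] by simp
      qed
    next
      have bd: "\<bar>u n\<bar> \<le> M + 2" for n
      proof (cases "0 \<le> n")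
        case True
        have "pt (v (nat n)) (v (nat n + 1)) \<in> fin ` S" using S(2)[of "nat n"] unfolding v(2) .
        from ptM[OF this] show ?thesis using True by (simp add: u_def)
      next
        case False
        have "pt (fst (g (nat (- n)))) (snd (g (nat (- n)))) \<in> fin ` S" using S(3)[of "nat (- n)"] unfolding g .
        from ptM[OF this] show ?thesis using False by (simp add: u_def w_def)
      qed
      have "\<bar>u n\<bar> \<le> \<bar>M\<bar> + 3" for n using bd[of n] by linarith
      moreover have "1 < \<bar>M\<bar> + 3" by linarith
      ultimately show "\<exists>M>1. \<forall>n. \<bar>u n\<bar> \<le> M" by blast
    qed
    from two_sided_zero[OF this] have "v 0 = 0" "v 1 = 0" by (simp_all add: u_def)
    then have "fin z = fin pfix" using v(2)[of 0] by (simp add: fin_pfix)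
    then have "fst z = fst pfix" "snd z = snd pfix" by (simp_all add: fin_def)
    then show "z \<in> {pfix}" by (simp add: prod_eq_iff)
  qed
qed

context stable_curve
begin

text \<open>A tail of the orbit lies in (-1, 1) and has the periodic sign pattern, so its pairs of
  negative terms satisfy \<open>local_uniqueness\<close>. One hit on the curve suffices, since the
  orbit can be run back from there.\<close>

lemma stable_on_curve:
  assumes "z \<in> stable_set"
  shows "z = pt 0 0 \<or> (\<exists>n x. 0 < x \<and> z = (finv_ext ^^ n) (pt (a x) (b x)))"
proof -
  obtain v where v: "recurrence v" and lim: "v \<longlonglongrightarrow> 0" and orb: "\<And>n. (f_ext ^^ n) z = pt (v n) (v (n + 1))"
    and ne: "\<And>n. v (n + 1) \<noteq> 1 \<and> v (n + 1) \<noteq> -1"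
    using stable_orbit[OF assms] by blast
  have z: "z = pt (v 0) (v 1)" using orb[of 0] by simp
  have "\<forall>\<^sub>F n in sequentially. \<bar>v n\<bar> < 1" using tendstoD[OF lim, of 1] by simp
  then obtain N where N: "\<And>n. N \<le> n \<Longrightarrow> \<bar>v n\<bar> < 1" by (auto simp: eventually_sequentially)
  define w where "w = (\<lambda>n. v (n + N))"
  have w: "recurrence w" "\<And>n. \<bar>w n\<bar> < 1" unfolding w_def using recurrence_shift[OF v] N by auto
  show ?thesis
  proof (cases "w 0 = 0 \<and> w 1 = 0")
    case True
    then have "v N = 0" "v (N + 1) = 0" by (simp_all add: w_def add.commute)
    from recurrence_zero_back[OF v this] show ?thesis using z by simp
  next
    case False
    from sign_pattern[OF w this] obtain m where m: "\<And>k. w (m + 3 * k) < 0 \<and> w (m + 3 * k + 1) < 0" by blast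
    define p q where "p = (\<lambda>k. w (m + 3 * k))" and "q = (\<lambda>k. w (m + 3 * k + 1))"
    have "steps3 (p k) (q k) (w (m + 3 * k + 2)) (p (Suc k)) (q (Suc k))" for k
    proof -
      have i: "m + 3 * k + 1 + 1 = m + 3 * k + 2" "m + 3 * k + 1 + 2 = m + 3 * k + 3"
        "m + 3 * k + 2 + 1 = m + 3 * k + 3" "m + 3 * k + 2 + 2 = m + 3 * k + 4"
        "m + 3 * Suc k = m + 3 * k + 3" "m + 3 * k + 3 + 1 = m + 3 * k + 4" by simp_all
      show ?thesis
        using recurrenceD[OF w(1), of "m + 3 * k"] recurrenceD[OF w(1), of "m + 3 * k + 1"] recurrenceD[OF w(1), of "m + 3 * k + 2"]
        unfolding steps3_def p_def q_def i by (simp add: mult_ac add_ac)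
    qed
    moreover have "p \<longlonglongrightarrow> 0" "q \<longlonglongrightarrow> 0"
    proof -
      have "filterlim (\<lambda>k. m + 3 * k + N) at_top sequentially" "filterlim (\<lambda>k. m + 3 * k + 1 + N) at_top sequentially"
        by (intro filterlim_subseq strict_monoI; simp)+
      from filterlim_compose[OF lim this(1)] filterlim_compose[OF lim this(2)]
      show "p \<longlonglongrightarrow> 0" "q \<longlonglongrightarrow> 0" by (simp_all add: p_def q_def w_def)
    qed
    ultimately obtain k x where kx: "0 < x" "p k = a x" "q k = b x"
      using local_uniqueness[of p q] m unfolding p_def q_def by blast
    define n where "n = m + 3 * k + N"
    have "pt (v n) (v (n + 1)) = pt (a x) (b x)"
      using kx by (simp add: p_def q_def w_def n_def)
    then have "z = (finv_ext ^^ n) (pt (a x) (b x))"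
      using backward_iterate[OF v, of n] ne z by simp
    then show ?thesis using kx(1) by blast
  qed
qed

end

section \<open>Continuation of the stable curve by backward iteration\<close>

text \<open>A backward step maps the first region into itself and exchanges the other two. In none
  of them is p equal to 1 or -1, so from here on backward iteration stays finite and is undone by
  the map.\<close>

definition back_trap :: "real \<Rightarrow> real \<Rightarrow> bool" where
  "back_trap p q \<longleftrightarrow> (p < -1 \<and> q < 0) \<or> (q < -1 \<and> - 2 * q \<le> p) \<or> (p < -1 \<and> 2 \<le> q \<and> - 2 * p - 2 \<le> q)"

lemma back_trap_bk:
  assumes "back_trap p q"
  shows "back_trap (bk p q) p"
proof -
  consider "p < -1" "q < 0" | "q < -1" "- 2 * q \<le> p" | "p < -1" "2 \<le> q" "- 2 * p - 2 \<le> q"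
    using assms unfolding back_trap_def by blast
  then show ?thesis
  proof cases
    case 1
    have "0 < q * (p - 1)" using 1 by (intro mult_neg_neg) auto
    then have "-1 * (1 + p) < p * q - p - q" by (simp add: algebra_simps)
    then have "bk p q < -1" unfolding bk_def using 1 by (subst neg_divide_less_eq) auto
    then show ?thesis using 1 by (simp add: back_trap_def)
  next
    case 2
    have p: "2 < p" "1 + p \<noteq> 0" "0 < 1 + p" using 2 by auto
    have e: "(q - bk p q) * (1 + p) = p + 2 * q" unfolding bk_def using p by (simp add: field_simps)
    then have "0 \<le> (q - bk p q) * (1 + p)" using 2 by simp
    then have k1: "bk p q \<le> q" using p by (simp add: zero_le_mult_iff)
    have "(q - bk p q) * (1 + p) \<le> 1 * (1 + p)" using e 2 by simp
    then have "q - bk p q \<le> 1" using p by (simp only: mult_le_cancel_right)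
    then show ?thesis using k1 2 p by (simp add: back_trap_def)
  next
    case 3
    define k where "k = - p"
    have k: "1 < k" "2 \<le> q" "2 * k - 2 \<le> q" using 3 by (simp_all add: k_def)
    have "2 * (k * k) - k \<le> q * (k + 1)"
    proof (cases "2 \<le> k")
      case True
      have "(2 * k - 2) * (k + 1) \<le> q * (k + 1)" using k by (intro mult_right_mono) auto
      then show ?thesis using True by (simp add: algebra_simps)
    next
      case False
      have "2 * (k + 1) \<le> q * (k + 1)" using k by (intro mult_right_mono) auto
      moreover have "(2 * k + 1) * (k - 2) \<le> 0" using False k by (intro mult_nonneg_nonpos) auto
      ultimately show ?thesis by (simp add: algebra_simps)
    qed
    then have "p * q - p - q \<le> - 2 * p * (1 + p)" by (simp add: k_def algebra_simps)
    then have "- 2 * p \<le> bk p q" unfolding bk_def using 3 by (subst neg_le_divide_eq) auto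
    then show ?thesis using 3 by (simp add: back_trap_def)
  qed
qed

lemma back_trap_ne: "back_trap p q \<Longrightarrow> p \<noteq> 1 \<and> p \<noteq> -1"
  by (auto simp: back_trap_def)

lemma back_trap_orbit:
  assumes "back_trap p q"
  shows "(\<exists>p' q'. (finv_ext ^^ k) (pt p q) = pt p' q' \<and> back_trap p' q') \<and>
    f_ext ((finv_ext ^^ Suc k) (pt p q)) = (finv_ext ^^ k) (pt p q)"
proof -
  have st: "\<exists>p' q'. (finv_ext ^^ k) (pt p q) = pt p' q' \<and> back_trap p' q'" for k
  proof (induction k)
    case 0
    then show ?case using assms by auto
  next
    case (Suc k)
    then obtain p' q' where "(finv_ext ^^ k) (pt p q) = pt p' q'" "back_trap p' q'" by blast
    then show ?case using back_trap_bk back_trap_ne finv_pt by auto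
  qed
  obtain p' q' where h: "(finv_ext ^^ k) (pt p q) = pt p' q'" "back_trap p' q'" using st by blast
  then have "f_ext (finv_ext (pt p' q')) = pt p' q'" using back_trap_ne[OF h(2)] by (simp add: finv_pt f_pt_bk)
  then show ?thesis using st[of k] h by simp
qed

text \<open>The backward orbit of the indeterminacy point (-3, infinity); it alternates between the
  two circles at infinity.\<close>

definition inf_pt :: "nat \<Rightarrow> eplane" where
  "inf_pt k = (if even k then (Some (- 3 - real k), None) else (None, Some (- 2 - real k)))"

lemma inf_pt_finv: "finv_ext (inf_pt k) = inf_pt (Suc k)"
  by (auto simp: inf_pt_def finv_ext_def emoebius_def emult_def)

lemma inf_pt_f: "f_ext (inf_pt (Suc k)) = inf_pt k"
  by (auto simp: inf_pt_def f_ext_def emoebius_def emult_def)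

lemma inf_pt_Ind: "inf_pt k \<in> Ind_f \<longleftrightarrow> k = 0"
  by (auto simp: inf_pt_def Ind_f_def odd_pos)

lemma inf_pt_infinity: "at_infinity_point (inf_pt k)"
  by (auto simp: inf_pt_def at_infinity_point_def)

lemma inf_pt_iterate: "(finv_ext ^^ k) (inf_pt 0) = inf_pt k"
  by (induction k) (simp_all add: inf_pt_finv)

lemma finv_pt_minus1_eq: "finv_ext (pt (-1) q) = inf_pt 0"
  by (simp add: inf_pt_def finv_ext_def pt_def emoebius_def emult_def)

lemma pt_Ind: "pt p q \<in> Ind_f \<longleftrightarrow> p = -1/2 \<and> q = 1"
  by (auto simp: Ind_f_def pt_def)

context stable_curve
begin

section \<open>The three terms preceding a pair of the curve\<close>

definition A :: "real \<Rightarrow> real" where "A s = bk (a s) (b s)"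
definition C :: "real \<Rightarrow> real" where "C s = bk (A s) (a s)"
definition B :: "real \<Rightarrow> real" where "B s = bk (C s) (A s)"

lemma state_range: "0 < s \<Longrightarrow> -1 < a s" "0 < s \<Longrightarrow> a s < 0" "0 < s \<Longrightarrow> -1 < b s" "0 < s \<Longrightarrow> b s < 0"
  using a_range[of s] b_range[of s] by auto

lemma A_pos: "0 < s \<Longrightarrow> 0 < A s"
  using bk_pos(1)[OF state_range A_def C_def B_def] .

lemma C_neg: "0 < s \<Longrightarrow> C s < 0"
  using bk2_neg[OF state_range A_def C_def B_def] .

lemma
  assumes s: "0 < s"
  shows A_ranal: "ranal A s" and A_deriv: "deriv A s < 0"
    and C_ranal: "ranal C s" and C_deriv: "0 < deriv C s"
    and B_ranal: "-1 < C s \<Longrightarrow> ranal B s" and B_deriv: "-1 < C s \<Longrightarrow> 0 < deriv B s"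
proof -
  have rab: "ranal a s" "ranal b s" using ab_ranal s by auto
  have A1: "1 + A s \<noteq> 0" "1 + a s \<noteq> 0" using A_pos[OF s] state_range[OF s] by auto
  have dA: "(A has_real_derivative ((b s - 1 - A s) * a' s + (a s - 1) * b' s) / (1 + a s)) (at s)"
    using bk_has_derivative[OF a_deriv b_deriv, of s] A1 s unfolding A_def[symmetric] by simp
  have dC: "(C has_real_derivative ((a s - 1 - C s) * (((b s - 1 - A s) * a' s + (a s - 1) * b' s) / (1 + a s)) + (A s - 1) * a' s) / (1 + A s)) (at s)"
    using bk_has_derivative[OF dA a_deriv, of] A1 s unfolding C_def[symmetric] by simp
  have pos: "0 < a' s" "0 < b' s" using ab'_pos[of s] s by auto
  note cone = state_range[OF s] A_def C_def B_def pos refl refl refl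
  show "deriv A s < 0" using cone_c(1)[OF cone] unfolding DERIV_imp_deriv[OF dA] .
  show "0 < deriv C s" using cone_b[OF cone] unfolding DERIV_imp_deriv[OF dC] .
  have "ranal (\<lambda>s. bk (a s) (b s)) s" by (rule ranal_bk[OF rab A1(2)])
  then show rA: "ranal A s" unfolding A_def[abs_def] .
  have "ranal (\<lambda>s. bk (A s) (a s)) s" by (rule ranal_bk[OF rA rab(1) A1(1)])
  then show rC: "ranal C s" unfolding C_def[abs_def] .
  assume C1: "-1 < C s"
  then have C0: "1 + C s \<noteq> 0" by auto
  have "ranal (\<lambda>s. bk (C s) (A s)) s" by (rule ranal_bk[OF rC rA C0])
  then show "ranal B s" unfolding B_def[abs_def] .
  have dB: "(B has_real_derivative ((A s - 1 - B s) * (((a s - 1 - C s) * (((b s - 1 - A s) * a' s + (a s - 1) * b' s) / (1 + a s)) + (A s - 1) * a' s) / (1 + A s))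
      + (C s - 1) * (((b s - 1 - A s) * a' s + (a s - 1) * b' s) / (1 + a s))) / (1 + C s)) (at s)"
    using bk_has_derivative[OF dC dA C0] unfolding B_def[symmetric] .
  show "0 < deriv B s" using cone_a[OF cone C1] unfolding DERIV_imp_deriv[OF dB] .
qed

lemma a_mono:
  assumes "0 \<le> s" "s < t"
  shows "a s < a t"
proof (rule DERIV_pos_imp_increasing[OF assms(2)])
  fix x assume "s \<le> x" "x \<le> t"
  then have "0 \<le> x" using assms by simp
  then show "\<exists>y. (a has_real_derivative y) (at x) \<and> 0 < y" using a_deriv ab'_pos by blast
qed

lemma A_mono:
  assumes "0 < s" "s < t"
  shows "A t < A s"
proof (rule DERIV_neg_imp_decreasing[OF assms(2)])
  fix x assume "s \<le> x" "x \<le> t"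
  then have "0 < x" using assms by simp
  then show "\<exists>y. (A has_real_derivative y) (at x) \<and> y < 0" using ranal_derivative[OF A_ranal] A_deriv by blast
qed

lemma C_mono:
  assumes "0 < s" "s < t"
  shows "C s < C t"
proof (rule DERIV_pos_imp_increasing[OF assms(2)])
  fix x assume "s \<le> x" "x \<le> t"
  then have "0 < x" using assms by simp
  then show "\<exists>y. (C has_real_derivative y) (at x) \<and> 0 < y" using ranal_derivative[OF C_ranal] C_deriv by blast
qed

lemma B_mono:
  assumes "0 < s" "s < t" "-1 < C s"
  shows "B s < B t"
proof (rule DERIV_pos_imp_increasing[OF assms(2)])
  fix x assume "s \<le> x" "x \<le> t"
  then have x: "0 < x" "-1 < C x" using assms C_mono[of s x] by (auto simp: le_less)
  then show "\<exists>y. (B has_real_derivative y) (at x) \<and> 0 < y"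
    using ranal_derivative[OF B_ranal[OF x]] B_deriv[OF x] by blast
qed

text \<open>For s \<ge> 3 the pair (B, C) merely repeats the curve at s - 3; the continuation beyond
  the end point of the local curve comes from 0 < s < 3.\<close>

lemma CB_shift: "0 \<le> s \<Longrightarrow> C (s + 3) = b s" "0 \<le> s \<Longrightarrow> B (s + 3) = a s"
  using ab_back3[of s] by (simp_all add: A_def B_def C_def back3_def Let_def)

lemma C_gt: "3 \<le> s \<Longrightarrow> -1 < C s"
  using CB_shift(1)[of "s - 3"] b_range[of "s - 3"] by simp

text \<open>The normalisation B 3 = a 0 = -1 reads A 3 (1 - b 0) = 1 with b 0 < 0, and A
  decreases.\<close>

lemma A_less_1: "3 \<le> s \<Longrightarrow> A s < 1"
proof -
  assume s: "3 \<le> s"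
  have bC: "C 3 = b 0" "B 3 = -1" using CB_shift[of 0] a0 by simp_all
  have b0: "-1 < b 0" "b 0 < 0" using b_range[of 0] by auto
  have "A 3 * (1 - b 0) = 1" using bC b0 unfolding B_def bk_def by (simp add: divide_eq_eq algebra_simps)
  moreover have "0 < A 3 * (- b 0)" using A_pos[of 3] b0 by (intro mult_pos_pos) auto
  ultimately have "A 3 < 1" by (simp add: algebra_simps)
  then show ?thesis using A_mono[of 3 s] s by (cases "s = 3") auto
qed

text \<open>C \<le> -1 amounts to (-a)(A - 1) \<ge> 1, and -a < 1 then forces A > 2. So C meets -1
  away from the critical values A = 1 and A = 1/2.\<close>

lemma C_large:
  assumes s: "0 < s" and C1: "C s \<le> -1"
  shows "2 < A s" "-2 < C s"
proof -
  have A0: "0 < 1 + A s" using A_pos[OF s] by simp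
  have e: "C s * (1 + A s) = A s * a s - A s - a s" unfolding C_def bk_def using A0 by simp
  have "C s * (1 + A s) \<le> -1 * (1 + A s)" using C1 A0 by (intro mult_right_mono) auto
  then have h: "1 \<le> (- a s) * (A s - 1)" using e by (simp add: algebra_simps)
  then have "0 < (- a s) * (A s - 1)" by simp
  then have "0 < A s - 1" by (rule zero_less_mult_pos) (use state_range[OF s] in simp)
  then have "(- a s) * (A s - 1) < 1 * (A s - 1)" using state_range[OF s] by (intro mult_strict_right_mono) auto
  then show "2 < A s" using h by simp
  have "0 < A s * (1 + a s)" using A_pos[OF s] state_range[OF s] by simp
  then have "-2 * (1 + A s) < C s * (1 + A s)" using e state_range[OF s] A_pos[OF s] by (simp add: algebra_simps)
  then show "-2 < C s" using A0 by (simp only: mult_less_cancel_right_pos)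
qed

text \<open>If C > -1, then B lies below its value -1 at parameter 3, which is the first region; if
  C < -1, then A > 2 yields B \<ge> -2 C, the second region.\<close>

lemma trap_BC:
  assumes s: "0 < s" "s < 3" and C1: "C s \<noteq> -1"
  shows "back_trap (B s) (C s)"
proof (cases "-1 < C s")
  case True
  have "B 3 = -1" using CB_shift(2)[of 0] a0 by simp
  then have "B s < -1" using B_mono[OF s True] by simp
  then show ?thesis using C_neg[OF s(1)] by (simp add: back_trap_def)
next
  case False
  then have C: "C s < -1" "-2 < C s" "2 < A s" using C_large[OF s(1)] C1 by auto
  have "(- C s + 1) * 2 \<le> (- C s + 1) * A s" using C by (intro mult_left_mono) auto
  moreover have "(- 2 * C s + 1) * (- C s - 2) \<le> 0" using C by (intro mult_nonneg_nonpos) auto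
  ultimately have "C s * A s - C s - A s \<le> - 2 * C s * (1 + C s)" by (simp add: algebra_simps)
  then have "- 2 * C s \<le> B s" unfolding B_def bk_def using C by (subst neg_le_divide_eq) auto
  then show ?thesis using C by (simp add: back_trap_def)
qed

section \<open>Backward images of the curve: regularity and critical crossings\<close>

definition H :: "nat \<Rightarrow> real \<Rightarrow> eplane" where
  "H m s = (finv_ext ^^ m) (pt (a s) (b s))"

lemma H_Suc: "H (Suc m) s = finv_ext (H m s)"
  by (simp add: H_def)

lemma H_add: "H (m + k) s = (finv_ext ^^ k) (H m s)"
  unfolding H_def by (subst add.commute) (simp add: funpow_add)

lemma H_0: "H 0 s = pt (a s) (b s)"
  by (simp add: H_def)

lemma H_1: "0 < s \<Longrightarrow> H 1 s = pt (A s) (a s)"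
  using state_range(1)[of s] by (simp add: H_def finv_pt A_def)

lemma H_2: "0 < s \<Longrightarrow> H 2 s = pt (C s) (A s)"
  using H_Suc[of 1 s] H_1[of s] A_pos[of s] by (simp add: finv_pt C_def numeral_2_eq_2)

lemma H_3: "0 < s \<Longrightarrow> C s \<noteq> -1 \<Longrightarrow> H 3 s = pt (B s) (C s)"
  using H_Suc[of 2 s] H_2[of s] by (simp add: finv_pt B_def numeral_3_eq_3 numeral_2_eq_2)

lemma H_shift: "0 \<le> s \<Longrightarrow> H (m + 3) (s + 3) = H m s"
proof -
  assume s: "0 \<le> s"
  then have "H 3 (s + 3) = H 0 s" using H_3[of "s + 3"] CB_shift[OF s] b_range[OF s] by (simp add: H_0)
  then show ?thesis using H_add[of 3 m "s + 3"] H_add[of 0 m s] by (simp add: add.commute)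
qed

lemma H_shift_n: "0 \<le> s \<Longrightarrow> H (m + 3 * n) (s + 3 * real n) = H m s"
proof (induction n)
  case (Suc n)
  have "H (m + 3 * n + 3) (s + 3 * real n + 3) = H (m + 3 * n) (s + 3 * real n)" by (rule H_shift) (use Suc in simp)
  then show ?case using Suc by (simp add: algebra_simps)
qed simp

definition pair_germ :: "(real \<Rightarrow> real) \<Rightarrow> (real \<Rightarrow> real) \<Rightarrow> nat \<Rightarrow> real \<Rightarrow> bool" where
  "pair_germ u v m s \<longleftrightarrow> regular_pair u v s \<and> (\<forall>\<^sub>F t in nhds s. H m t = pt (u t) (v t))"

lemma pair_germ_step:
  assumes "pair_germ u v m s" "u s \<noteq> -1" "u s \<noteq> 1 \<or> deriv u s \<noteq> 0"
  shows "pair_germ (\<lambda>t. bk (u t) (v t)) u (Suc m) s"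
proof -
  have r: "regular_pair u v s" "ranal u s" using assms(1) by (auto simp: pair_germ_def regular_pair_def)
  have e: "\<forall>\<^sub>F t in nhds s. H m t = pt (u t) (v t)" using assms(1) by (simp add: pair_germ_def)
  have "\<forall>\<^sub>F t in nhds s. H (Suc m) t = pt (bk (u t) (v t)) (u t)"
    using e eventually_ranal_ne[OF r(2) assms(2)] by eventually_elim (simp add: H_Suc finv_pt)
  then show ?thesis using regular_pair_bk[OF r(1) assms(2,3)] by (simp add: pair_germ_def)
qed

lemma pair_germ_0: "0 < s \<Longrightarrow> pair_germ a b 0 s"
  unfolding pair_germ_def regular_pair_def using ab_ranal[of s] ab'_pos[of s] DERIV_imp_deriv[OF a_deriv[of s]]
  by (auto simp: H_0)

lemma pair_germ_1: "0 < s \<Longrightarrow> pair_germ A a 1 s"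
proof -
  assume s: "0 < s"
  then have "a s \<noteq> -1" "a s \<noteq> 1" using state_range[OF s] by auto
  then show ?thesis using pair_germ_step[OF pair_germ_0[OF s]] unfolding A_def[abs_def] by simp
qed

lemma pair_germ_2: "0 < s \<Longrightarrow> pair_germ C A 2 s"
proof -
  assume s: "0 < s"
  have "A s \<noteq> -1" "deriv A s \<noteq> 0" using A_pos[OF s] A_deriv[OF s] by auto
  then show ?thesis using pair_germ_step[OF pair_germ_1[OF s]] unfolding C_def[abs_def] by (simp add: numeral_2_eq_2)
qed

lemma pair_germ_3: "0 < s \<Longrightarrow> C s \<noteq> -1 \<Longrightarrow> pair_germ B C 3 s"
proof -
  assume s: "0 < s" "C s \<noteq> -1"
  have "C s \<noteq> 1" using C_neg[OF s(1)] by auto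
  then show ?thesis using pair_germ_step[OF pair_germ_2[OF s(1)] s(2)] unfolding B_def[abs_def]
    by (simp add: numeral_2_eq_2 numeral_3_eq_3)
qed

lemma pair_germ_trap:
  assumes "pair_germ u v m s" "back_trap (u s) (v s)"
  shows "\<exists>u' v'. pair_germ u' v' (m + k) s \<and> back_trap (u' s) (v' s)"
proof (induction k)
  case (Suc k)
  then obtain u' v' where h: "pair_germ u' v' (m + k) s" "back_trap (u' s) (v' s)" by blast
  then have "pair_germ (\<lambda>t. bk (u' t) (v' t)) u' (Suc (m + k)) s"
    using pair_germ_step[OF h(1)] back_trap_ne[OF h(2)] by blast
  then show ?case using back_trap_bk[OF h(2)] by (intro exI conjI) auto
qed (use assms in auto)

lemma pair_germ_regular: "pair_germ u v m s \<Longrightarrow> regular_curve_at (H m) s"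
  using regular_curve_pt unfolding pair_germ_def by blast

lemma pair_germ_cross:
  assumes "pair_germ u v m s" "u s = -1" "deriv u s \<noteq> 0" "v s \<noteq> 1/2"
  shows "regular_curve_at (H (Suc m + k)) s"
proof -
  have "germ_top 0 (\<lambda>t. finv_ext (H m t)) s"
    by (rule germ_top_cross[of u v]) (use assms in \<open>auto simp: pair_germ_def\<close>)
  then have g0: "germ_top 0 (H (Suc m)) s" by (simp add: H_Suc[abs_def])
  have "\<exists>j. germ_top j (H (Suc m + k)) s \<or> germ_side j (H (Suc m + k)) s"
  proof (induction k)
    case 0
    then show ?case using g0 by auto
  next
    case (Suc k)
    have e: "H (Suc m + Suc k) = (\<lambda>t. finv_ext (H (Suc m + k) t))" by (rule ext) (simp add: H_Suc)
    show ?case using Suc germ_top_finv germ_side_finv unfolding e by blast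
  qed
  then show ?thesis using germ_top_regular germ_side_regular by blast
qed

text \<open>By the shift relation every point of the continued curves has a representation with s
  \<le> 3 or m \<le> 2. Then either C or B passes through -1, transversally, and the germs at
  infinity take over, or (B, C) is in the trap.\<close>

lemma H_regular:
  assumes s: "0 < s" and m: "s \<le> 3 \<or> m \<le> 2"
  shows "regular_curve_at (H m) s"
proof (cases "m \<le> 2")
  case True
  then consider "m = 0" | "m = 1" | "m = 2" by linarith
  then show ?thesis
    using pair_germ_regular[OF pair_germ_0[OF s]] pair_germ_regular[OF pair_germ_1[OF s]] pair_germ_regular[OF pair_germ_2[OF s]]
    by cases simp_all
next
  case False
  then have s3: "s \<le> 3" and m3: "m = 3 + (m - 3)" using m by auto
  consider "C s = -1" | "C s \<noteq> -1" "s < 3" | "s = 3" using s3 by linarith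
  then show ?thesis
  proof cases
    case 1
    have "regular_curve_at (H (Suc 2 + (m - 3))) s"
      by (rule pair_germ_cross[OF pair_germ_2[OF s]]) (use 1 C_deriv[OF s] C_large[OF s] in auto)
    then show ?thesis using m3 by simp
  next
    case 2
    from pair_germ_trap[OF pair_germ_3[OF s 2(1)] trap_BC[OF s 2(2,1)], of "m - 3"]
    show ?thesis using pair_germ_regular m3 by metis
  next
    case 3
    have C3: "-1 < C 3" "C 3 < 0" "B 3 = -1" using C_gt[of 3] C_neg[of 3] CB_shift(2)[of 0] a0 by auto
    have g: "pair_germ B C 3 s" using pair_germ_3[OF s] C3 3 by auto
    show ?thesis
    proof (cases "m = 3")
      case True
      then show ?thesis using pair_germ_regular[OF g] by simp
    next
      case F: False
      have "regular_curve_at (H (Suc 3 + (m - 4))) s"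
        by (rule pair_germ_cross[OF g]) (use 3 C3 B_deriv[of 3] in auto)
      moreover have "Suc 3 + (m - 4) = m" using F m3 by simp
      ultimately show ?thesis by simp
    qed
  qed
qed

text \<open>\<open>j\<close> is the number of backward steps after which the curve point has become
  an indeterminacy point: (1, 0) for A = 1, and (-3, infinity) for C = -1 and for s = 3, where B =
  -1. The values 2, 3, 4 represent all residues modulo 3.\<close>

definition crossing :: "nat \<Rightarrow> real \<Rightarrow> bool" where
  "crossing j s \<longleftrightarrow> (j = 2 \<and> A s = 1) \<or> (j = 3 \<and> C s = -1) \<or> (j = 4 \<and> s = 3)"

lemma H_f_small:
  assumes s: "0 < s"
  shows "f_ext (H 1 s) = H 0 s" "A s \<noteq> 1 \<Longrightarrow> f_ext (H 2 s) = H 1 s" "C s \<noteq> -1 \<Longrightarrow> f_ext (H 3 s) = H 2 s"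
proof -
  have n: "a s \<noteq> -1" "a s \<noteq> 1" "A s \<noteq> -1" "C s \<noteq> 1" using state_range[OF s] A_pos[OF s] C_neg[OF s] by auto
  show "f_ext (H 1 s) = H 0 s" using f_pt_bk[OF n(1,2)] by (simp only: H_1[OF s] H_0 A_def)
  show "f_ext (H 2 s) = H 1 s" if "A s \<noteq> 1" using f_pt_bk[OF n(3) that] by (simp only: H_2[OF s] H_1[OF s] C_def)
  show "f_ext (H 3 s) = H 2 s" if "C s \<noteq> -1" using f_pt_bk[OF that n(4)] by (simp only: H_3[OF s that] H_2[OF s] B_def)
qed

lemma trap_H:
  assumes s: "0 < s" "s < 3" "C s \<noteq> -1"
  shows "\<exists>p q. H (3 + k) s = pt p q \<and> back_trap p q" "f_ext (H (Suc (3 + k)) s) = H (3 + k) s"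
proof -
  have "H (3 + k) s = (finv_ext ^^ k) (pt (B s) (C s))" for k
    using H_add[of 3 k s] H_3[OF s(1,3)] by simp
  from this[of k] this[of "Suc k"] back_trap_orbit[OF trap_BC[OF s], of k]
  show "\<exists>p q. H (3 + k) s = pt p q \<and> back_trap p q" "f_ext (H (Suc (3 + k)) s) = H (3 + k) s" by simp_all
qed

lemma crossing_inf:
  assumes s: "0 < s" and "crossing j s" "j \<noteq> 2"
  shows "H (j + k) s = inf_pt k"
proof -
  have "H j s = inf_pt 0"
  proof (cases "j = 3")
    case True
    then have "C s = -1" using assms by (auto simp: crossing_def)
    then show ?thesis using True H_Suc[of 2 s] H_2[OF s] by (simp add: finv_pt_minus1_eq numeral_3_eq_3 numeral_2_eq_2)
  next
    case False
    then have j: "j = 4" "s = 3" using assms by (auto simp: crossing_def)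
    have "H 3 3 = pt (-1) (C 3)" using H_3[of 3] C_gt[of 3] CB_shift(2)[of 0] a0 by simp
    moreover have "H 4 3 = finv_ext (H 3 3)" using H_Suc[of 3 3] by simp
    ultimately show ?thesis using j by (simp add: finv_pt_minus1_eq)
  qed
  then show ?thesis using H_add[of j k s] by (simp add: inf_pt_iterate)
qed

text \<open>This crossing happens in the finite plane: A = 1 gives C = -1/2 independently of a, and
  the next backward step enters the trap.\<close>

lemma crossing_2:
  assumes s: "0 < s" and A1: "A s = 1"
  shows "H 2 s = pt (-1/2) 1" "s < 3" "-1 < C s"
proof -
  have "C s = -1/2" using A1 by (simp add: C_def bk_def)
  then show "H 2 s = pt (-1/2) 1" "-1 < C s" using H_2[OF s] A1 by simp_all
  show "s < 3" using A_less_1[of s] A1 by (rule_tac ccontr) simp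
qed

lemma crossing_Ind:
  assumes s: "0 < s" and c: "crossing j s"
  shows "H (j + k) s \<in> Ind_f \<longleftrightarrow> k = 0" "f_ext (H (Suc (j + k)) s) = H (j + k) s"
    "at_infinity_point (H (j + k) s) \<longleftrightarrow> j \<noteq> 2"
proof -
  have *: "(H (j + k) s \<in> Ind_f \<longleftrightarrow> k = 0) \<and> f_ext (H (Suc (j + k)) s) = H (j + k) s \<and>
    (at_infinity_point (H (j + k) s) \<longleftrightarrow> j \<noteq> 2)"
  proof (cases "j = 2")
    case False
    then show ?thesis using crossing_inf[OF s c False, of k] crossing_inf[OF s c False, of "Suc k"]
      by (simp add: inf_pt_f inf_pt_Ind inf_pt_infinity)
  next
    case True
    then have A1: "A s = 1" using c by (auto simp: crossing_def)
    note c2 = crossing_2[OF s A1]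
    have C1: "C s \<noteq> -1" using c2 by auto
    show ?thesis
    proof (cases k)
      case 0
      then show ?thesis using True c2(1) H_f_small(3)[OF s C1] by (simp add: pt_Ind)
    next
      case (Suc l)
      obtain p q where pq: "H (3 + l) s = pt p q" "back_trap p q" using trap_H(1)[OF s c2(2) C1] by blast
      have "p \<noteq> - 1 / 2 \<or> q \<noteq> 1" using pq(2) by (auto simp: back_trap_def)
      then have "pt p q \<notin> Ind_f" by (simp add: pt_Ind)
      moreover have jk: "j + k = 3 + l" using True Suc by simp
      moreover have "f_ext (H (Suc (3 + l)) s) = H (3 + l) s" by (rule trap_H(2)[OF s c2(2) C1])
      ultimately show ?thesis unfolding jk using True Suc pq(1) by (simp only:) simp
    qed
  qed
  then show "H (j + k) s \<in> Ind_f \<longleftrightarrow> k = 0" "f_ext (H (Suc (j + k)) s) = H (j + k) s"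
    "at_infinity_point (H (j + k) s) \<longleftrightarrow> j \<noteq> 2" by blast+
qed

lemma no_crossing:
  assumes s: "0 < s" and m: "s \<le> 3 \<or> m \<le> 2" and nc: "\<And>j. j \<le> m \<Longrightarrow> \<not> crossing j s"
  shows "k < m \<Longrightarrow> f_ext (H (Suc k) s) = H k s" "k \<le> m \<Longrightarrow> \<not> at_infinity_point (H k s)"
proof -
  have fin3: "\<not> at_infinity_point (H k s)" if k2: "k \<le> 2" for k
  proof -
    consider "k = 0" | "k = 1" | "k = 2" using k2 by linarith
    then show ?thesis using H_0[of s] H_1[OF s] H_2[OF s] by cases simp_all
  qed
  have A1: "A s \<noteq> 1" if "2 \<le> m" using nc[of 2] that by (auto simp: crossing_def)
  have C1: "C s \<noteq> -1" if "3 \<le> m" using nc[of 3] that by (auto simp: crossing_def)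
  have s3: "s < 3" if "4 \<le> m" using nc[of 4] that m by (auto simp: crossing_def)
  show "f_ext (H (Suc k) s) = H k s" if k: "k < m"
  proof -
    consider "k = 0" | "k = 1" | "k = 2" | "3 \<le> k" by linarith
    then show ?thesis
    proof cases
      case 4
      then have "k = 3 + (k - 3)" by simp
      have m4: "4 \<le> m" "3 \<le> m" using 4 k by simp_all
      have "f_ext (H (Suc (3 + (k - 3))) s) = H (3 + (k - 3)) s" by (rule trap_H(2)[OF s s3[OF m4(1)] C1[OF m4(2)]])
      then show ?thesis using \<open>k = 3 + (k - 3)\<close> by simp
    qed (use H_f_small[OF s] A1 C1 k in \<open>auto simp: numeral_2_eq_2 numeral_3_eq_3\<close>)
  qed
  show "\<not> at_infinity_point (H k s)" if k: "k \<le> m"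
  proof -
    consider "k \<le> 2" | "k = 3" | "4 \<le> k" by linarith
    then show ?thesis
    proof cases
      case 2
      then show ?thesis using H_3[OF s C1] k by simp
    next
      case 3
      then have "k = 3 + (k - 3)" by simp
      have m4: "4 \<le> m" "3 \<le> m" using 3 k by simp_all
      obtain p q where "H (3 + (k - 3)) s = pt p q" using trap_H(1)[OF s s3[OF m4(1)] C1[OF m4(2)]] by blast
      then show ?thesis using \<open>k = 3 + (k - 3)\<close> by simp
    qed (use fin3 in blast)
  qed
qed

end

lemma attracted_step:
  assumes "g z \<in> attracted_set g I q" "z \<notin> I"
  shows "z \<in> attracted_set g I q"
proof -
  have D: "(g ^^ n) z \<notin> I" for n
  proof (cases n)
    case (Suc k)
    then show ?thesis using assms(1) by (simp add: attracted_set_def orbit_defined_def funpow_swap1)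
  qed (use assms in simp)
  have "limitin eplane_top (\<lambda>n. (g ^^ n) (g z)) q sequentially" using assms(1) by (simp add: attracted_set_def)
  then have "limitin eplane_top (\<lambda>n. (g ^^ (n + 1)) z) q sequentially" by (simp add: funpow_swap1)
  then have "limitin eplane_top (\<lambda>n. (g ^^ n) z) q sequentially" by (rule limitin_sequentially_offset_rev)
  then show ?thesis using D by (simp add: attracted_set_def orbit_defined_def)
qed

context stable_curve
begin

lemma H_forward:
  assumes s: "0 < s"
  shows "f_ext (H 0 s) = H 2 (s + 3)" "f_ext (H 2 (s + 3)) = H 1 (s + 3)" "f_ext (H 1 (s + 3)) = H 0 (s + 3)"
proof -
  have s3: "0 < s + 3" using s by simp
  have n: "A (s + 3) \<noteq> 1" "C (s + 3) \<noteq> -1" using A_less_1[of "s + 3"] C_gt[of "s + 3"] s by auto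
  have "H 3 (s + 3) = H 0 s" using H_shift[of s 0] s by simp
  then show "f_ext (H 0 s) = H 2 (s + 3)" using H_f_small(3)[OF s3 n(2)] by simp
  show "f_ext (H 2 (s + 3)) = H 1 (s + 3)" "f_ext (H 1 (s + 3)) = H 0 (s + 3)"
    using H_f_small(1,2)[OF s3] n by auto
qed

lemma H_forward3: "0 < s \<Longrightarrow> (f_ext ^^ (3 * k)) (H 0 s) = H 0 (s + 3 * real k)"
proof (induction k)
  case (Suc k)
  have "(f_ext ^^ (3 * Suc k)) (H 0 s) = f_ext (f_ext (f_ext ((f_ext ^^ (3 * k)) (H 0 s))))"
    by (simp add: eval_nat_numeral)
  then show ?case using Suc H_forward[of "s + 3 * real k"] by (simp add: algebra_simps)
qed simp

lemma coords_to_0: "(A \<longlongrightarrow> 0) at_top" "(C \<longlongrightarrow> 0) at_top"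
proof -
  have "((\<lambda>s. (a s * b s - a s - b s) / (1 + a s)) \<longlongrightarrow> (0 * 0 - 0 - 0) / (1 + 0)) at_top"
    by (intro tendsto_intros curve_to_0) simp
  then show A: "(A \<longlongrightarrow> 0) at_top" unfolding A_def[abs_def] bk_def by simp
  have "((\<lambda>s. (A s * a s - A s - a s) / (1 + A s)) \<longlongrightarrow> (0 * 0 - 0 - 0) / (1 + 0)) at_top"
    by (intro tendsto_intros curve_to_0 A) simp
  then show "(C \<longlongrightarrow> 0) at_top" unfolding C_def[abs_def] bk_def by simp
qed

lemma local_stable:
  assumes s: "0 < s"
  shows "H 0 s \<in> stable_set"
proof -
  \<comment> \<open>\<open>(n + 2) div 3\<close> is n/3 rounded up: the first forward step from the
    pair at s already lands on the pair (C, A) of parameter s + 3.\<close>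
  define y where "y = (\<lambda>n::nat. s + 3 * real ((n + 2) div 3))"
  define p where "p = (\<lambda>n::nat. if n mod 3 = 0 then a (y n) else if n mod 3 = 1 then C (y n) else A (y n))"
  define q where "q = (\<lambda>n::nat. if n mod 3 = 0 then b (y n) else if n mod 3 = 1 then A (y n) else a (y n))"
  have y3: "0 < y n" "n mod 3 \<noteq> 0 \<Longrightarrow> 3 < y n" for n
  proof -
    show "0 < y n" using s by (simp add: y_def add_pos_nonneg)
    assume "n mod 3 \<noteq> 0"
    then have "1 \<le> (n + 2) div 3" by presburger
    then have "1 \<le> real ((n + 2) div 3)" by linarith
    then show "3 < y n" using s by (simp add: y_def)
  qed
  have orb: "(f_ext ^^ n) (H 0 s) = pt (p n) (q n)" for n
  proof -
    define k where "k = n div 3"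
    have pos: "0 < s + 3 * real k" "0 < s + 3 * real k + 3" using s by (simp_all add: add_pos_nonneg)
    have "n = 3 * k \<or> n = Suc (3 * k) \<or> n = Suc (Suc (3 * k))" unfolding k_def by presburger
    then consider "n = 3 * k" | "n = Suc (3 * k)" | "n = Suc (Suc (3 * k))" by blast
    then show ?thesis
    proof cases
      case 1
      then have "y n = s + 3 * real k" "n mod 3 = 0" by (simp_all add: y_def)
      then show ?thesis using H_forward3[OF s, of k] 1 by (simp add: p_def q_def H_0)
    next
      case 2
      then have "(n + 2) div 3 = Suc k" "n mod 3 = 1" by presburger+
      then have "y n = s + 3 * real k + 3" "n mod 3 = 1" by (simp_all add: y_def)
      then show ?thesis using H_forward3[OF s, of k] 2 H_forward(1)[OF pos(1)] H_2[OF pos(2)] by (simp add: p_def q_def)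
    next
      case 3
      then have "(n + 2) div 3 = Suc k" "n mod 3 = 2" by presburger+
      then have "y n = s + 3 * real k + 3" "n mod 3 = 2" by (simp_all add: y_def)
      then show ?thesis using H_forward3[OF s, of k] 3 H_forward(1,2)[OF pos(1)] H_1[OF pos(2)] by (simp add: p_def q_def)
    qed
  qed
  have "q n \<noteq> 1" for n
    using state_range[OF y3(1)[of n]] A_less_1[of "y n"] y3(2)[of n] by (auto simp: q_def)
  then have D: "(f_ext ^^ n) (H 0 s) \<notin> Ind_f" for n unfolding orb pt_Ind by blast
  have yt: "filterlim y at_top sequentially"
  proof (rule filterlim_at_top_mono[OF filterlim_real_sequentially])
    show "\<forall>\<^sub>F n in sequentially. real n \<le> y n"
    proof (intro always_eventually allI)
      fix n :: nat
      have "n \<le> 3 * ((n + 2) div 3)" by presburger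
      then have "real n \<le> 3 * real ((n + 2) div 3)" by linarith
      then show "real n \<le> y n" using s by (simp add: y_def)
    qed
  qed
  note l = filterlim_compose[OF curve_to_0(1) yt] filterlim_compose[OF curve_to_0(2) yt]
    filterlim_compose[OF coords_to_0(1) yt] filterlim_compose[OF coords_to_0(2) yt]
  have "p \<longlonglongrightarrow> 0"
  proof (rule Lim_null_comparison[where g = "\<lambda>n. \<bar>a (y n)\<bar> + \<bar>C (y n)\<bar> + \<bar>A (y n)\<bar>"])
    show "(\<lambda>n. \<bar>a (y n)\<bar> + \<bar>C (y n)\<bar> + \<bar>A (y n)\<bar>) \<longlonglongrightarrow> 0"
      using tendsto_add[OF tendsto_add[OF tendsto_rabs[OF l(1)] tendsto_rabs[OF l(4)]] tendsto_rabs[OF l(3)]] by simp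
  qed (auto simp: p_def)
  moreover have "q \<longlonglongrightarrow> 0"
  proof (rule Lim_null_comparison[where g = "\<lambda>n. \<bar>b (y n)\<bar> + \<bar>A (y n)\<bar> + \<bar>a (y n)\<bar>"])
    show "(\<lambda>n. \<bar>b (y n)\<bar> + \<bar>A (y n)\<bar> + \<bar>a (y n)\<bar>) \<longlonglongrightarrow> 0"
      using tendsto_add[OF tendsto_add[OF tendsto_rabs[OF l(2)] tendsto_rabs[OF l(3)]] tendsto_rabs[OF l(1)]] by simp
  qed (auto simp: q_def)
  ultimately have "limitin eplane_top (\<lambda>n. (f_ext ^^ n) (H 0 s)) (pt 0 0) sequentially"
    unfolding orb by (rule limitin_pt0I)
  then show ?thesis using D by (simp add: stable_set_def attracted_set_def orbit_defined_def fin_pfix)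
qed

lemma origin_stable: "pt 0 0 \<in> stable_set"
proof -
  have "limitin eplane_top (\<lambda>n. (f_ext ^^ n) (pt 0 0)) (pt 0 0) sequentially"
    unfolding pfix_orbit using limitin_pt0I[of "\<lambda>_. 0" sequentially "\<lambda>_. 0"] by simp
  then show ?thesis by (simp add: stable_set_def attracted_set_def orbit_defined_def fin_pfix pfix_orbit pt_Ind)
qed

section \<open>The three global curves over the whole parameter line\<close>

definition curve :: "nat \<Rightarrow> real \<Rightarrow> eplane" where
  "curve i z = (let n = nat \<lceil>\<bar>z\<bar>\<rceil> in H (3 * n + i) (z + 3 * real n))"

text \<open>By the shift relation any n that makes the parameter nonnegative gives the same point;
  the ceiling in the definition is one such choice, and near a given z one n serves a whole
  neighbourhood.\<close>

lemma curve_eq: "0 \<le> z + 3 * real n \<Longrightarrow> curve i z = H (3 * n + i) (z + 3 * real n)"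
proof -
  assume n: "0 \<le> z + 3 * real n"
  have *: "H (3 * m + i) (z + 3 * real m) = H (3 * l + i) (z + 3 * real l)" if "0 \<le> z + 3 * real l" "l \<le> m" for l m
  proof -
    have m: "m = l + (m - l)" using that by simp
    have "H (3 * l + i + 3 * (m - l)) (z + 3 * real l + 3 * real (m - l)) = H (3 * l + i) (z + 3 * real l)"
      by (rule H_shift_n[OF that(1)])
    moreover have "3 * l + i + 3 * (m - l) = 3 * m + i" "z + 3 * real l + 3 * real (m - l) = z + 3 * real m"
      using that by (simp_all add: of_nat_diff)
    ultimately show ?thesis by simp
  qed
  define k where "k = nat \<lceil>\<bar>z\<bar>\<rceil>"
  have "\<bar>z\<bar> \<le> real k" by (simp add: k_def real_nat_ceiling_ge)
  then have k: "0 \<le> z + 3 * real k" by linarith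
  show ?thesis unfolding curve_def Let_def k_def[symmetric]
    using *[OF n, of k] *[OF k, of n] by (cases "n \<le> k") auto
qed

lemma rep_exists: "\<exists>n. 0 < z + 3 * real n \<and> (z + 3 * real n \<le> 3 \<or> n = 0)"
proof (cases "3 < z")
  case False
  define n where "n = nat \<lfloor>(3 - z) / 3\<rfloor>"
  have "0 \<le> \<lfloor>(3 - z) / 3\<rfloor>" using False by simp
  then have n: "real n = of_int \<lfloor>(3 - z) / 3\<rfloor>" by (simp add: n_def)
  have "of_int \<lfloor>(3 - z) / 3\<rfloor> \<le> (3 - z) / 3" "(3 - z) / 3 < of_int \<lfloor>(3 - z) / 3\<rfloor> + 1" by linarith+
  then have "real n \<le> (3 - z) / 3" "(3 - z) / 3 < real n + 1" unfolding n by blast+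
  then show ?thesis by (intro exI[of _ n]) (auto simp: field_simps)
qed (intro exI[of _ 0], simp)

lemma curve_regular:
  assumes i: "i < 3"
  shows "regular_curve_at (curve i) z"
proof -
  obtain n where n: "0 < z + 3 * real n" "z + 3 * real n \<le> 3 \<or> n = 0" using rep_exists by blast
  have "regular_curve_at (H (3 * n + i)) (z + 3 * real n)" by (rule H_regular) (use n i in auto)
  then have "regular_curve_at (\<lambda>w. H (3 * n + i) (w + 3 * real n)) z"
  proof (rule regular_curve_reparam)
    show "ranal (\<lambda>w. w + 3 * real n) z" by (intro ranal_add ranal_ident ranal_const)
    have "deriv (\<lambda>w. w + 3 * real n) z = 1" by (rule DERIV_imp_deriv) (auto intro!: derivative_eq_intros)
    then show "deriv (\<lambda>w. w + 3 * real n) z \<noteq> 0" by simp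
  qed
  moreover have "\<forall>\<^sub>F w in nhds z. - 3 * real n < w"
    using eventually_nhds_in_open[of "{- 3 * real n<..}" z] n by simp
  then have "\<forall>\<^sub>F w in nhds z. H (3 * n + i) (w + 3 * real n) = curve i w"
    by eventually_elim (rule curve_eq[symmetric], simp)
  ultimately show ?thesis by (rule regular_curve_cong)
qed

text \<open>Either the forward orbit reaches the local curve with a known phase, or it hits an
  indeterminacy point for the first time after k steps. In both cases the forward orbit of the point
  records enough data to recover its parameter.\<close>

lemma curve_orbit:
  assumes i: "i < 3"
  obtains (good) n where "0 < z + 3 * real n" "curve i z \<in> stable_set"
      "\<And>N. n \<le> N \<Longrightarrow> (f_ext ^^ (3 * N + i)) (curve i z) = H 0 (z + 3 * real N)"
  | (bad) n j k where "0 < z + 3 * real n" "j + k = 3 * n + i" "crossing j (z + 3 * real n)"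
      "(f_ext ^^ k) (curve i z) = H j (z + 3 * real n)" "H j (z + 3 * real n) \<in> Ind_f"
      "\<And>l. l < k \<Longrightarrow> (f_ext ^^ l) (curve i z) \<notin> Ind_f"
      "at_infinity_point (curve i z) \<longleftrightarrow> j \<noteq> 2"
proof -
  obtain n where n: "0 < z + 3 * real n" "z + 3 * real n \<le> 3 \<or> n = 0" using rep_exists by blast
  define m s where "m = 3 * n + i" and "s = z + 3 * real n"
  have s: "0 < s" and m: "s \<le> 3 \<or> m \<le> 2" using n i by (auto simp: m_def s_def)
  have p: "curve i z = H m s" unfolding m_def s_def by (rule curve_eq) (use n in simp)
  have bck: "(f_ext ^^ l) (H (r + l) s) = H r s" if "\<And>k. r \<le> k \<Longrightarrow> k < r + l \<Longrightarrow> f_ext (H (Suc k) s) = H k s" for r l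
    using that by (induction l) (simp_all add: funpow_Suc_right del: funpow.simps)
  show ?thesis
  proof (cases "\<exists>j\<le>m. crossing j s")
    case True
    then obtain j where j: "j \<le> m" "crossing j s" by blast
    define k where "k = m - j"
    have mk: "m = j + k" using j by (simp add: k_def)
    note cI = crossing_Ind[OF s j(2)]
    have stp: "f_ext (H (Suc l) s) = H l s" if "j \<le> l" for l using cI(2)[of "l - j"] that by simp
    have hk: "(f_ext ^^ k) (curve i z) = H j s" unfolding p mk by (rule bck) (use stp in blast)
    have notI: "(f_ext ^^ l) (curve i z) \<notin> Ind_f" if l: "l < k" for l
    proof -
      have "m = (j + (k - l)) + l" using mk l by simp
      then have "(f_ext ^^ l) (curve i z) = H (j + (k - l)) s" unfolding p
        using bck[of "j + (k - l)" l] stp by simp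
      then show ?thesis using cI(1)[of "k - l"] l by simp
    qed
    have "H j s \<in> Ind_f" using cI(1)[of 0] by simp
    moreover have "at_infinity_point (curve i z) \<longleftrightarrow> j \<noteq> 2" unfolding p mk by (rule cI(3))
    ultimately show ?thesis using bad[of n j k] n(1) mk j(2) hk notI by (simp add: m_def s_def)
  next
    case False
    then have nc: "\<And>j. j \<le> m \<Longrightarrow> \<not> crossing j s" by blast
    have nx: "k < m \<Longrightarrow> f_ext (H (Suc k) s) = H k s" "k \<le> m \<Longrightarrow> \<not> at_infinity_point (H k s)" for k
      by (rule no_crossing[OF s m]; use nc in blast)+
    have h0: "(f_ext ^^ l) (H l s) = H 0 s" if "l \<le> m" for l
      using bck[of 0 l] nx(1) that by simp
    have st: "l \<le> m \<Longrightarrow> H l s \<in> stable_set" for l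
    proof (induction l)
      case 0
      then show ?case using local_stable[OF s] by simp
    next
      case (Suc l)
      have e: "f_ext (H (Suc l) s) = H l s" using nx(1) Suc.prems by simp
      have "H (Suc l) s \<notin> Ind_f"
      proof
        assume I: "H (Suc l) s \<in> Ind_f"
        obtain p' q' where pq: "H (Suc l) s = pt p' q'" using finite_is_pt[OF nx(2)[OF Suc.prems]] by blast
        then have "q' = 1" using I by (simp add: pt_Ind)
        then have "at_infinity_point (H l s)" using e pq f_pt_1 by metis
        then show False using nx(2)[of l] Suc.prems by simp
      qed
      then show ?case using Suc e attracted_step[of f_ext "H (Suc l) s"] unfolding stable_set_def by simp
    qed
    have "(f_ext ^^ (3 * N + i)) (curve i z) = H 0 (z + 3 * real N)" if N: "n \<le> N" for N
    proof -
      have "3 * N + i = 3 * (N - n) + m" using N by (simp add: m_def)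
      then have "(f_ext ^^ (3 * N + i)) (curve i z) = (f_ext ^^ (3 * (N - n))) ((f_ext ^^ m) (H m s))"
        unfolding p by (simp add: funpow_add)
      also have "\<dots> = H 0 (s + 3 * real (N - n))" using h0[of m] H_forward3[OF s] by simp
      also have "s + 3 * real (N - n) = z + 3 * real N" using N by (simp add: s_def of_nat_diff)
      finally show ?thesis .
    qed
    then show ?thesis using good[of n] n(1) st[of m] p by simp
  qed
qed

text \<open>For defined orbits a phase difference of 1 or 2 would equate a pair of negative terms
  with a pair containing A > 0; equal phases give equal parameters as a is increasing. For undefined
  orbits the first hitting time k is determined by the point, and A and C are monotone. Different
  curves may meet at infinity, where both j = 3 and j = 4 lead to (-3, infinity); hence the last
  hypothesis.\<close>

lemma curve_inj_ordered:
  assumes i: "i < 3" "i' < 3" "i \<le> i'" and eq: "curve i z = curve i' z'" and ni: "\<not> at_infinity_point (curve i z) \<or> i = i'"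
  shows "i = i' \<and> z = z'"
proof (rule curve_orbit[OF i(1), of z]; rule curve_orbit[OF i(2), of z'])
  fix n n'
  assume n: "0 < z + 3 * real n" "\<And>N. n \<le> N \<Longrightarrow> (f_ext ^^ (3 * N + i)) (curve i z) = H 0 (z + 3 * real N)"
    and n': "0 < z' + 3 * real n'" "\<And>N. n' \<le> N \<Longrightarrow> (f_ext ^^ (3 * N + i')) (curve i' z') = H 0 (z' + 3 * real N)"
  define N where "N = max n n'"
  define s s' where "s = z + 3 * real N" and "s' = z' + 3 * real N"
  have le: "real n \<le> real N" "real n' \<le> real N" by (simp_all add: N_def)
  have s: "0 < s" "0 < s'" using n(1) n'(1) le unfolding s_def s'_def by linarith+
  have h: "(f_ext ^^ (3 * N + i)) (curve i z) = H 0 s" "(f_ext ^^ (3 * N + i')) (curve i z) = H 0 s'"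
    unfolding s_def s'_def eq using n(2)[of N] n'(2)[of N] eq by (simp_all add: N_def)
  have "3 * N + i' = (i' - i) + (3 * N + i)" using i by simp
  then have "(f_ext ^^ (3 * N + i')) (curve i z) = (f_ext ^^ (i' - i)) ((f_ext ^^ (3 * N + i)) (curve i z))"
    by (simp only: funpow_add o_apply)
  then have d: "(f_ext ^^ (i' - i)) (H 0 s) = H 0 s'" unfolding h by (rule sym)
  consider "i' - i = 0" | "i' - i = 1" | "i' - i = 2" using i by linarith
  then show ?thesis
  proof cases
    case 1
    then have "a s = a s'" using d by (simp add: H_0)
    then have "s = s'" using a_mono[of s s'] a_mono[of s' s] s by (cases s s' rule: linorder_cases) auto
    then show ?thesis using 1 i by (simp add: s_def s'_def)
  next
    case 2
    then have "pt (C (s + 3)) (A (s + 3)) = pt (a s') (b s')"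
      using d H_forward(1)[OF s(1)] H_2[of "s + 3"] s by (simp add: H_0)
    then show ?thesis using A_pos[of "s + 3"] state_range[OF s(2)] s by simp
  next
    case 3
    then have "pt (A (s + 3)) (a (s + 3)) = pt (a s') (b s')"
      using d H_forward(1,2)[OF s(1)] H_1[of "s + 3"] s by (simp add: H_0 numeral_2_eq_2)
    then show ?thesis using A_pos[of "s + 3"] state_range[OF s(2)] s by simp
  qed
next
  fix k x assume "curve i z \<in> stable_set" "(f_ext ^^ k) (curve i' z') = x" "x \<in> Ind_f"
  then show ?thesis using eq by (auto simp: stable_set_def attracted_set_def orbit_defined_def)
next
  fix k x assume "(f_ext ^^ k) (curve i z) = x" "x \<in> Ind_f" "curve i' z' \<in> stable_set"
  then show ?thesis using eq by (auto simp: stable_set_def attracted_set_def orbit_defined_def)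
next
  fix n j k n' j' k'
  assume 1: "0 < z + 3 * real n" "j + k = 3 * n + i" "crossing j (z + 3 * real n)"
      "(f_ext ^^ k) (curve i z) = H j (z + 3 * real n)" "H j (z + 3 * real n) \<in> Ind_f"
      "\<And>l. l < k \<Longrightarrow> (f_ext ^^ l) (curve i z) \<notin> Ind_f" "at_infinity_point (curve i z) = (j \<noteq> 2)"
    and 2: "0 < z' + 3 * real n'" "j' + k' = 3 * n' + i'" "crossing j' (z' + 3 * real n')"
      "(f_ext ^^ k') (curve i' z') = H j' (z' + 3 * real n')" "H j' (z' + 3 * real n') \<in> Ind_f"
      "\<And>l. l < k' \<Longrightarrow> (f_ext ^^ l) (curve i' z') \<notin> Ind_f" "at_infinity_point (curve i' z') = (j' \<noteq> 2)"
  have "\<not> k < k'" using 2(6)[of k] 1(4,5) eq by auto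
  moreover have "\<not> k' < k" using 1(6)[of k'] 2(4,5) eq by auto
  ultimately have kk: "k = k'" by simp
  have j2: "j = 2 \<longleftrightarrow> j' = 2" using 1(7) 2(7) eq by simp
  have jr: "j = 2 \<or> j = 3 \<or> j = 4" "j' = 2 \<or> j' = 3 \<or> j' = 4" using 1(3) 2(3) by (auto simp: crossing_def)
  have ii: "j \<noteq> 2 \<Longrightarrow> i = i'" using ni 1(7) by blast
  \<comment> \<open>Finiteness separates j = 2 from the rest; for 3 against 4 the indices i agree,
    and j + k modulo 3 decides.\<close>
  have jj: "j = j'"
  proof (rule ccontr)
    assume "j \<noteq> j'"
    then have "j \<noteq> 2" "(j = 3 \<and> j' = 4) \<or> (j = 4 \<and> j' = 3)" using j2 jr by auto
    moreover then have "i = i'" using ii by blast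
    ultimately show False using 1(2) 2(2) kk by presburger
  qed
  have "3 * n + i = 3 * n' + i'" using 1(2) 2(2) kk jj by simp
  then have ni': "n = n'" "i = i'" using i by presburger+
  define s s' where "s = z + 3 * real n" and "s' = z' + 3 * real n'"
  have sp: "0 < s" "0 < s'" "crossing j s" "crossing j s'" using 1 2 jj by (auto simp: s_def s'_def)
  have "s = s'"
  proof (cases s s' rule: linorder_cases)
    case less
    then show ?thesis using sp A_mono[OF sp(1) less] C_mono[OF sp(1) less] by (auto simp: crossing_def)
  next
    case greater
    then show ?thesis using sp A_mono[OF sp(2) greater] C_mono[OF sp(2) greater] by (auto simp: crossing_def)
  qed
  then show ?thesis using ni' by (simp add: s_def s'_def)
qed

lemma curve_inj:
  assumes "i < 3" "i' < 3" "curve i z = curve i' z'" "\<not> at_infinity_point (curve i z) \<or> i = i'"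
  shows "i = i' \<and> z = z'"
  using curve_inj_ordered[of i i' z z'] curve_inj_ordered[of i' i z' z] assms by (cases "i \<le> i'") auto

lemma curve_ne_origin:
  assumes "i < 3"
  shows "curve i z \<noteq> pt 0 0"
proof
  assume e: "curve i z = pt 0 0"
  show False
  proof (rule curve_orbit[OF assms, of z])
    fix n assume n: "0 < z + 3 * real n" "\<And>N. n \<le> N \<Longrightarrow> (f_ext ^^ (3 * N + i)) (curve i z) = H 0 (z + 3 * real N)"
    then have "pt 0 0 = pt (a (z + 3 * real n)) (b (z + 3 * real n))"
      using n(2)[of n] unfolding e pfix_orbit H_0 by simp
    then show False using state_range[OF n(1)] by simp
  next
    fix k x assume "(f_ext ^^ k) (curve i z) = x" "x \<in> Ind_f"
    then show False unfolding e pfix_orbit by (auto simp: pt_Ind)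
  qed
qed

lemma curve_stable: "i < 3 \<Longrightarrow> curve i z \<in> orbit_defined f_ext Ind_f \<Longrightarrow> curve i z \<in> stable_set"
proof -
  assume i: "i < 3" and D: "curve i z \<in> orbit_defined f_ext Ind_f"
  show ?thesis
  proof (rule curve_orbit[OF i, of z])
    fix k x assume "(f_ext ^^ k) (curve i z) = x" "x \<in> Ind_f"
    then show ?thesis using D by (auto simp: orbit_defined_def)
  qed
qed

lemma stable_in_curves:
  assumes "z \<in> stable_set" "z \<noteq> pt 0 0"
  shows "\<exists>i<3. \<exists>x. z = curve i x"
proof -
  obtain m s where ms: "0 < s" "z = H m s" using stable_on_curve[OF assms(1)] assms(2) by (auto simp: H_def)
  have "curve (m mod 3) (s - 3 * real (m div 3)) = H (3 * (m div 3) + m mod 3) (s - 3 * real (m div 3) + 3 * real (m div 3))"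
    by (rule curve_eq) (use ms in simp)
  then have "z = curve (m mod 3) (s - 3 * real (m div 3))" using ms by simp
  moreover have "m mod 3 < 3" by simp
  ultimately show ?thesis by blast
qed

end

section \<open>Half-branches at the fixed point\<close>

lemma ranal_deriv_isCont:
  assumes "ranal u t"
  shows "isCont (deriv u) t"
proof -
  obtain g where g: "g analytic_on {of_real t :: complex}" "\<forall>\<^sub>F s in nhds t. g (of_real s) = of_real (u s)"
    using assms by (rule ranalE)
  obtain S where S: "open S" "of_real t \<in> S" "g holomorphic_on S" using g(1) by (auto simp: analytic_at)
  have "\<forall>\<^sub>F s in nhds t. of_real s \<in> S"
    by (rule eventually_compose_filterlim[OF eventually_nhds_in_open[OF S(1,2)]]) (intro tendsto_intros filterlim_ident)
  moreover have "\<forall>\<^sub>F s in nhds t. \<forall>\<^sub>F r in nhds s. g (of_real r) = of_real (u r)"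
    using g(2) by (simp add: eventually_eventually)
  ultimately have e: "\<forall>\<^sub>F s in nhds t. Re (deriv g (of_real s)) = deriv u s"
  proof eventually_elim
    case (elim s)
    have d: "(g has_field_derivative deriv g (of_real s)) (at (of_real s))"
      using holomorphic_derivI[OF S(3,1) elim(1)] .
    have "((\<lambda>s. Re (g (of_real s))) has_real_derivative Re (deriv g (of_real s))) (at s)"
      by (rule has_field_derivative_Re[OF has_vector_derivative_real_field[OF d]])
    moreover have ev: "\<forall>\<^sub>F r in nhds s. Re (g (of_real r)) = u r" using elim(2) by eventually_elim simp
    ultimately have "(u has_real_derivative Re (deriv g (of_real s))) (at s)"
      using DERIV_cong_ev[OF refl ev refl] by blast
    then show ?case by (rule DERIV_imp_deriv[symmetric])
  qed
  have "deriv g holomorphic_on S" by (rule holomorphic_deriv[OF S(3,1)])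
  then have "isCont (deriv g) (of_real t)"
    using S(1,2) holomorphic_on_imp_continuous_on continuous_on_eq_continuous_at by blast
  then have "isCont (\<lambda>s. Re (deriv g (of_real s))) t"
    by (intro continuous_intros isCont_o2[of _ complex_of_real]) auto
  then show ?thesis using isCont_cong[OF e] by blast
qed

definition C1 :: "(real \<Rightarrow> real) \<Rightarrow> (real \<Rightarrow> real) \<Rightarrow> bool" where
  "C1 u u' \<longleftrightarrow> (\<forall>s\<in>{0..<1/2}. (u has_real_derivative u' s) (at s within {0..<1/2})) \<and> continuous_on {0..<1/2} u'"

lemma C1_bk:
  assumes p: "C1 p p'" and q: "C1 q q'" and ne: "\<And>s. s \<in> {0..<1/2} \<Longrightarrow> 1 + p s \<noteq> 0"
  shows "C1 (\<lambda>s. bk (p s) (q s)) (\<lambda>s. ((q s - 1 - bk (p s) (q s)) * p' s + (p s - 1) * q' s) / (1 + p s))"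
proof -
  have "continuous_on {0..<1/2} p" "continuous_on {0..<1/2} q"
    using p q DERIV_continuous_on[of "{0..<1/2}"] unfolding C1_def by blast+
  note cpq = this
  show ?thesis unfolding C1_def
  proof (intro conjI ballI)
    show "((\<lambda>s. bk (p s) (q s)) has_real_derivative ((q s - 1 - bk (p s) (q s)) * p' s + (p s - 1) * q' s) / (1 + p s))
        (at s within {0..<1/2})" if "s \<in> {0..<1/2}" for s
      using p q that ne[OF that] unfolding C1_def by (intro bk_has_derivative) blast+
    show "continuous_on {0..<1/2} (\<lambda>s. ((q s - 1 - bk (p s) (q s)) * p' s + (p s - 1) * q' s) / (1 + p s))"
      unfolding bk_def using p q ne cpq unfolding C1_def by (intro continuous_intros) auto
  qed
qed

text \<open>With x = 1/t - t, x is close to 1/t near t = 0, so x g(x) -> -1 gives the one-sided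
  derivative -1 at 0, and x^2 g'(x) -> 1 makes the derivative continuous there. On (0, 1/2) the
  argument 1/t - t is positive.\<close>

lemma C1_tail:
  fixes g g' :: "real \<Rightarrow> real"
  assumes d: "\<And>x. 0 < x \<Longrightarrow> (g has_real_derivative g' x) (at x)" and c: "\<And>x. 0 < x \<Longrightarrow> isCont g' x"
    and l: "((\<lambda>x. x * g x) \<longlongrightarrow> -1) at_top" "((\<lambda>x. x^2 * g' x) \<longlongrightarrow> 1) at_top"
  shows "C1 (\<lambda>t. if t \<le> 0 then 0 else g (1 / t - t)) (\<lambda>t. if t \<le> 0 then -1 else g' (1 / t - t) * (- 1 / t^2 - 1))"
    (is "C1 ?u ?u'")
proof -
  have top: "filterlim (\<lambda>t::real. 1 / t - t) at_top (at_right 0)" by real_asymp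
  have within: "at 0 within {0..<1/2} = (at_right (0::real))"
    by (rule at_within_nhd[of _ "{-1<..<1/2}"]) auto
  have ev: "\<forall>\<^sub>F t::real in at_right 0. 0 < t \<and> t < 1"
    unfolding eventually_at_right_field by (intro exI[of _ 1]) auto
  have pos: "0 < 1 / t - t" if "0 < t" "t < 1" for t :: real
  proof -
    have "t * t < 1 * 1" using that by (intro mult_strict_mono) auto
    then show ?thesis using that by (simp add: field_simps)
  qed
  have at0: "(?u has_real_derivative -1) (at 0 within {0..<1/2})"
  proof -
    have "((\<lambda>t. (1 / t - t) * g (1 / t - t) * (1 / (1 - t^2))) \<longlongrightarrow> -1 * (1 / (1 - 0^2))) (at_right 0)"
      by (intro tendsto_mult filterlim_compose[OF l(1) top]) (auto intro!: tendsto_eq_intros)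
    moreover have "\<forall>\<^sub>F t in at_right 0. (1 / t - t) * g (1 / t - t) * (1 / (1 - t^2)) = (?u t - ?u 0) / (t - 0)"
      using ev
    proof eventually_elim
      case (elim t)
      have "t^2 < 1" using elim by (simp add: power_less_one_iff abs_square_less_1)
      then have "1 - t^2 \<noteq> 0" by simp
      moreover have "1 / t - t = (1 - t^2) / t" using elim by (simp add: field_simps power2_eq_square)
      ultimately show ?case using elim by simp
    qed
    ultimately show ?thesis unfolding has_field_derivative_iff within using Lim_transform_eventually by force
  qed
  have at0': "(?u' \<longlongrightarrow> -1) (at_right 0)"
  proof -
    have "((\<lambda>t. (1 / t - t)^2 * g' (1 / t - t) * (- (1 + t^2) / (1 - t^2)^2)) \<longlongrightarrow> 1 * (- (1 + 0^2) / (1 - 0^2)^2)) (at_right 0)"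
      by (intro tendsto_mult filterlim_compose[OF l(2) top]) (auto intro!: tendsto_eq_intros)
    moreover have "\<forall>\<^sub>F t in at_right 0. (1 / t - t)^2 * g' (1 / t - t) * (- (1 + t^2) / (1 - t^2)^2) = ?u' t"
      using ev
    proof eventually_elim
      case (elim t)
      have "t^2 < 1" using elim by (simp add: power_less_one_iff abs_square_less_1)
      then have n: "1 - t^2 \<noteq> 0" by simp
      have "1 / t - t = (1 - t^2) / t" using elim by (simp add: field_simps power2_eq_square)
      then have "(1 / t - t)^2 * (- (1 + t^2) / (1 - t^2)^2) = - (1 + t^2) / t^2"
        using n elim by (simp add: power_divide)
      also have "\<dots> = - 1 / t^2 - 1" using elim by (simp add: field_simps)
      finally have E: "(1 / t - t)^2 * (- (1 + t^2) / (1 - t^2)^2) = - 1 / t^2 - 1" .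
      have "(1 / t - t)^2 * g' (1 / t - t) * (- (1 + t^2) / (1 - t^2)^2) =
          g' (1 / t - t) * ((1 / t - t)^2 * (- (1 + t^2) / (1 - t^2)^2))" by (simp only: mult_ac)
      then show ?case unfolding E using elim by simp
    qed
    ultimately show ?thesis using Lim_transform_eventually by force
  qed
  have "(?u has_real_derivative ?u' s) (at s within {0..<1/2}) \<and> continuous (at s within {0..<1/2}) ?u'" if s: "s \<in> {0..<1/2}" for s
  proof (cases "s = 0")
    case True
    then show ?thesis using at0 at0' by (simp add: continuous_within within)
  next
    case False
    then have s0: "0 < s" "s < 1" using s by auto
    have evs: "\<forall>\<^sub>F t in nhds s. 0 < t" using eventually_nhds_in_open[of "{0<..}" s] s0 by simp
    have dh: "((\<lambda>t. 1 / t - t) has_real_derivative (- 1 / s^2 - 1)) (at s)"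
      using s0 by (auto intro!: derivative_eq_intros simp: power2_eq_square)
    have "((\<lambda>t. g (1 / t - t)) has_real_derivative g' (1 / s - s) * (- 1 / s^2 - 1)) (at s)"
      by (rule DERIV_chain2[OF d[OF pos[OF s0]] dh])
    moreover have e1: "\<forall>\<^sub>F t in nhds s. g (1 / t - t) = ?u t" using evs by eventually_elim simp
    ultimately have "(?u has_real_derivative g' (1 / s - s) * (- 1 / s^2 - 1)) (at s)"
      using DERIV_cong_ev[OF refl e1 refl] by blast
    then have 1: "(?u has_real_derivative ?u' s) (at s within {0..<1/2})"
      using s0 by (simp add: has_field_derivative_at_within)
    have "isCont (\<lambda>t. g' (1 / t - t) * (- 1 / t^2 - 1)) s"
      using s0 by (intro continuous_intros isCont_o2[OF DERIV_isCont[OF dh] c[OF pos[OF s0]]]) auto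
    moreover have e2: "\<forall>\<^sub>F t in nhds s. g' (1 / t - t) * (- 1 / t^2 - 1) = ?u' t" using evs by eventually_elim simp
    ultimately have "isCont ?u' s" using isCont_cong[OF e2] by blast
    then show ?thesis using 1 continuous_at_imp_continuous_at_within by blast
  qed
  then show ?thesis unfolding C1_def continuous_on_eq_continuous_within by blast
qed

lemma initial_velocity_pt:
  assumes "C1 p p'" "C1 q q'" "\<And>s. s \<in> {0..<1/2} \<Longrightarrow> c s = pt (p s) (q s)" "w = (2 * q' 0, 2 * p' 0)"
  shows "initial_velocity c w"
  unfolding initial_velocity_def
proof (intro exI conjI ballI)
  show "(0::real) < 1/2" by simp
  show "continuous_on {0..<1/2} (\<lambda>s. (2 * q' s, 2 * p' s))" using assms(1,2) unfolding C1_def by (intro continuous_intros) auto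
  show "(\<lambda>s. (2 * q' s, 2 * p' s)) 0 = w" using assms(4) by simp
  fix s :: real assume s: "s \<in> {0..<1/2}"
  show "c s = fin ((\<lambda>s. (2 * q s - 1, 2 * p s + 1)) s)" using assms(3)[OF s] by (simp add: pt_eq_fin)
  have "((\<lambda>s. 2 * q s - 1) has_real_derivative 2 * q' s) (at s within {0..<1/2})"
    "((\<lambda>s. 2 * p s + 1) has_real_derivative 2 * p' s) (at s within {0..<1/2})"
    using assms(1,2) s unfolding C1_def by (auto intro!: derivative_eq_intros)
  then show "((\<lambda>s. (2 * q s - 1, 2 * p s + 1)) has_vector_derivative (\<lambda>s. (2 * q' s, 2 * p' s)) s) (at s within {0..<1/2})"
    by (simp add: has_vector_derivative_Pair has_real_derivative_iff_has_vector_derivative)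
qed

text \<open>The target property with explicit witnesses and transversality written as determinants,
  a form that can be carried over by the involution; nonzero tangent vectors follow from the
  determinants.\<close>

definition three_regular_curves :: "eplane set \<Rightarrow> eplane set \<Rightarrow> (nat \<Rightarrow> real \<Rightarrow> eplane) \<Rightarrow> (nat \<Rightarrow> real \<times> real) \<Rightarrow> bool" where
  "three_regular_curves W D c w \<longleftrightarrow>
    (\<forall>i<3. c i 0 = fin pfix \<and> inj_on (c i) {0..} \<and> (\<forall>t>0. regular_curve_at (c i) t) \<and> initial_velocity (c i) (w i)) \<and>
    W = D \<inter> (\<Union>i<3. c i ` {0..}) \<and>
    (\<forall>i<3. \<forall>j<3. i \<noteq> j \<longrightarrow> fst (w i) * snd (w j) - snd (w i) * fst (w j) \<noteq> 0 \<and>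
       c i ` {0..} \<inter> c j ` {0..} \<inter> range fin = {fin pfix})"

lemma span_pair_UNIV:
  fixes u v :: "real \<times> real"
  assumes "fst u * snd v - snd u * fst v \<noteq> 0"
  shows "span {u, v} = UNIV"
proof -
  define d where "d = fst u * snd v - snd u * fst v"
  have "x \<in> span {u, v}" for x
  proof -
    have "x = ((fst x * snd v - snd x * fst v) / d) *\<^sub>R u + ((fst u * snd x - snd u * fst x) / d) *\<^sub>R v"
    proof (rule prod_eqI)
      have "(fst x * snd v - snd x * fst v) * fst u + (fst u * snd x - snd u * fst x) * fst v = fst x * d"
        "(fst x * snd v - snd x * fst v) * snd u + (fst u * snd x - snd u * fst x) * snd v = snd x * d"
        by (simp_all add: d_def algebra_simps)
      then have "((fst x * snd v - snd x * fst v) * fst u + (fst u * snd x - snd u * fst x) * fst v) / d = fst x"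
        "((fst x * snd v - snd x * fst v) * snd u + (fst u * snd x - snd u * fst x) * snd v) / d = snd x"
        using assms by (simp_all add: d_def)
      then show "fst x = fst (((fst x * snd v - snd x * fst v) / d) *\<^sub>R u + ((fst u * snd x - snd u * fst x) / d) *\<^sub>R v)"
        "snd x = snd (((fst x * snd v - snd x * fst v) / d) *\<^sub>R u + ((fst u * snd x - snd u * fst x) / d) *\<^sub>R v)"
        by (simp_all add: add_divide_distrib)
    qed
    moreover have "\<dots> \<in> span {u, v}" by (intro span_add span_scale span_base) auto
    ultimately show ?thesis by simp
  qed
  then show ?thesis by blast
qed

lemma three_regular_imp_transverse:
  assumes "three_regular_curves W D c w"
  shows "three_transverse_curves W D pfix"
proof -
  have w0: "w i \<noteq> 0" if "i < 3" for i
  proof -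
    obtain j :: nat where "j < 3" "i \<noteq> j" by (cases "i = 0") (use that[of 1] that[of 0] in auto)
    then have "fst (w i) * snd (w j) - snd (w i) * fst (w j) \<noteq> 0"
      using assms \<open>i < 3\<close> unfolding three_regular_curves_def by blast
    then show ?thesis by auto
  qed
  have h: "\<And>i. i < 3 \<Longrightarrow> c i 0 = fin pfix" "\<And>i. i < 3 \<Longrightarrow> inj_on (c i) {0..}"
    "\<And>i t. i < 3 \<Longrightarrow> 0 < t \<Longrightarrow> regular_curve_at (c i) t" "\<And>i. i < 3 \<Longrightarrow> initial_velocity (c i) (w i)"
    "W = D \<inter> (\<Union>i<3. c i ` {0..})"
    "\<And>i j. i < 3 \<Longrightarrow> j < 3 \<Longrightarrow> i \<noteq> j \<Longrightarrow> fst (w i) * snd (w j) - snd (w i) * fst (w j) \<noteq> 0"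
    "\<And>i j. i < 3 \<Longrightarrow> j < 3 \<Longrightarrow> i \<noteq> j \<Longrightarrow> c i ` {0..} \<inter> c j ` {0..} \<inter> range fin = {fin pfix}"
    using assms unfolding three_regular_curves_def by blast+
  have "analytic_curve_from pfix (c i) (w i)" if "i < 3" for i
    unfolding analytic_curve_from_def using h(1,2,4)[OF that] w0[OF that] regular_curve_imp_analytic[OF h(3)[OF that]] by simp
  then show ?thesis unfolding three_transverse_curves_def
    using h(5,7) span_pair_UNIV[OF h(6)] by (intro exI[of _ c] exI[of _ w] conjI allI impI) assumption+
qed

context stable_curve
begin

text \<open>t -> 1/t - t is an analytic decreasing bijection from the positive reals onto the real
  line with nonvanishing derivative. It places the end of the curve at the fixed point at t = 0 and
  gives a finite nonzero velocity there.\<close>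

definition branch :: "nat \<Rightarrow> real \<Rightarrow> eplane" where
  "branch i t = (if t \<le> 0 then pt 0 0 else curve i (1 / t - t))"

lemma branch_param_inj: "0 < t \<Longrightarrow> 0 < t' \<Longrightarrow> 1 / t - t = 1 / t' - t' \<Longrightarrow> t = t'" for t t' :: real
proof -
  assume t: "0 < t" "0 < t'" "1 / t - t = 1 / t' - t'"
  have "(t' - t) * (1 + t * t') = ((1 / t - t) - (1 / t' - t')) * (t * t')"
    using t(1,2) by (simp add: field_simps)
  also have "\<dots> = 0" using t(3) by simp
  finally have "t' - t = 0 \<or> 1 + t * t' = 0" by (simp only: mult_eq_0_iff)
  moreover have "0 < t * t'" using t by simp
  ultimately show "t = t'" by linarith
qed

lemma branch_param_surj: "\<exists>t>0. 1 / t - t = z" for z :: real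
proof -
  define r where "r = sqrt (z^2 + 4)"
  have r2: "r * r = z^2 + 4" by (simp add: r_def)
  have "\<bar>z\<bar> < r" unfolding r_def by (rule real_less_rsqrt) simp
  then have t: "0 < (r - z) / 2" by simp
  have "(r - z) * (r + z) = 4" using r2 by (simp add: algebra_simps power2_eq_square)
  then have "(r + z) / 2 * ((r - z) / 2) = 1" by (simp add: mult.commute)
  then have "1 / ((r - z) / 2) = (r + z) / 2" using t by (metis divide_eq_eq less_irrefl)
  moreover have "(r + z) / 2 - (r - z) / 2 = z" by (simp add: diff_divide_distrib[symmetric])
  ultimately have "1 / ((r - z) / 2) - (r - z) / 2 = z" by (simp only:)
  then show ?thesis using t by blast
qed

lemma branch_regular: "i < 3 \<Longrightarrow> 0 < t \<Longrightarrow> regular_curve_at (branch i) t"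
proof -
  assume i: "i < 3" and t: "0 < t"
  have D: "deriv (\<lambda>t. 1 / t - t) t = - (1 / t^2) - 1"
    by (rule DERIV_imp_deriv) (use t in \<open>auto intro!: derivative_eq_intros simp: power2_eq_square\<close>)
  have "0 < 1 / t^2" using t by simp
  then have "deriv (\<lambda>t. 1 / t - t) t \<noteq> 0" unfolding D by linarith
  moreover have "ranal (\<lambda>t. 1 / t - t) t" by (intro ranal_diff ranal_divide ranal_const ranal_ident) (use t in simp)
  ultimately have "regular_curve_at (\<lambda>t. curve i (1 / t - t)) t"
    using regular_curve_reparam[OF curve_regular[OF i]] by blast
  moreover have "\<forall>\<^sub>F s in nhds t. curve i (1 / s - s) = branch i s"
    using eventually_nhds_in_open[of "{0<..}" t] t by (auto simp: branch_def elim: eventually_mono)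
  ultimately show ?thesis by (rule regular_curve_cong)
qed

lemma branch_inj: "i < 3 \<Longrightarrow> inj_on (branch i) {0..}"
proof (rule inj_onI)
  fix t t' :: real assume i: "i < 3" and h: "t \<in> {0..}" "t' \<in> {0..}" "branch i t = branch i t'"
  consider "t = 0" "t' = 0" | "0 < t" "0 < t'" | "t = 0 \<and> 0 < t' \<or> 0 < t \<and> t' = 0" using h(1,2) by force
  then show "t = t'"
  proof cases
    case 2
    then have "curve i (1 / t - t) = curve i (1 / t' - t')" using h(3) by (simp add: branch_def)
    then show ?thesis using curve_inj[OF i i] branch_param_inj[OF 2] by blast
  next
    case 3
    then show ?thesis using h(3) curve_ne_origin[OF i] by (auto simp: branch_def split: if_splits dest: sym)
  qed simp
qed

lemma branch_image: "branch i ` {0..} = insert (pt 0 0) (range (curve i))"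
proof
  show "branch i ` {0..} \<subseteq> insert (pt 0 0) (range (curve i))" by (auto simp: branch_def)
  show "insert (pt 0 0) (range (curve i)) \<subseteq> branch i ` {0..}"
  proof
    fix x assume "x \<in> insert (pt 0 0) (range (curve i))"
    then consider "x = pt 0 0" | z where "x = curve i z" by blast
    then show "x \<in> branch i ` {0..}"
    proof cases
      case 1
      then show ?thesis by (intro image_eqI[of _ _ 0]) (auto simp: branch_def)
    next
      case 2
      obtain t where "0 < t" "1 / t - t = z" using branch_param_surj by blast
      then show ?thesis using 2 by (intro image_eqI[of _ _ t]) (auto simp: branch_def)
    qed
  qed
qed

text \<open>The derivatives -1, -1 of a and b give 2 for A and -1 for C, by the linear part of
  \<open>bk\<close>; \<open>pt\<close> doubles the values and exchanges the components.\<close>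

lemma branch_initial_velocity:
  "initial_velocity (branch 0) (-2, -2)" "initial_velocity (branch 1) (-2, 4)" "initial_velocity (branch 2) (4, -2)"
proof -
  define \<alpha> \<alpha>' where "\<alpha> = (\<lambda>t. if t \<le> 0 then 0 else a (1 / t - t))"
    and "\<alpha>' = (\<lambda>t. if t \<le> 0 then -1 else a' (1 / t - t) * (- 1 / t^2 - 1))"
  define \<beta> \<beta>' where "\<beta> = (\<lambda>t. if t \<le> 0 then 0 else b (1 / t - t))"
    and "\<beta>' = (\<lambda>t. if t \<le> 0 then -1 else b' (1 / t - t) * (- 1 / t^2 - 1))"
  have ca: "isCont a' x" "isCont b' x" if x: "0 < x" for x
  proof -
    have ev: "\<forall>\<^sub>F s in nhds x. 0 < s" using eventually_nhds_in_open[of "{0<..}" x] x by simp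
    have e: "\<forall>\<^sub>F s in nhds x. deriv a s = a' s" "\<forall>\<^sub>F s in nhds x. deriv b s = b' s"
      using ev by (eventually_elim, simp add: DERIV_imp_deriv[OF a_deriv] DERIV_imp_deriv[OF b_deriv])+
    have r: "ranal a x" "ranal b x" using ab_ranal[of x] x by auto
    show "isCont a' x" using isCont_cong[OF e(1)] ranal_deriv_isCont[OF r(1)] by blast
    show "isCont b' x" using isCont_cong[OF e(2)] ranal_deriv_isCont[OF r(2)] by blast
  qed
  have c\<alpha>: "C1 \<alpha> \<alpha>'" unfolding \<alpha>_def \<alpha>'_def
    by (rule C1_tail) (auto intro: a_deriv ca a_asymp)
  have c\<beta>: "C1 \<beta> \<beta>'" unfolding \<beta>_def \<beta>'_def
    by (rule C1_tail) (auto intro: b_deriv ca b_asymp)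
  have pos: "0 < 1 / t - t" if "0 < t" "t < 1/2" for t :: real
  proof -
    have "t * t < 1 * 1" using that by (intro mult_strict_mono) auto
    then show ?thesis using that by (simp add: field_simps)
  qed
  have al: "1 + \<alpha> s \<noteq> 0" if "s \<in> {0..<1/2}" for s
    using that state_range(1)[OF pos, of s] by (auto simp: \<alpha>_def)
  define A1 A1' where "A1 = (\<lambda>s. bk (\<alpha> s) (\<beta> s))"
    and "A1' = (\<lambda>s. ((\<beta> s - 1 - bk (\<alpha> s) (\<beta> s)) * \<alpha>' s + (\<alpha> s - 1) * \<beta>' s) / (1 + \<alpha> s))"
  have cA: "C1 A1 A1'" unfolding A1_def A1'_def by (rule C1_bk[OF c\<alpha> c\<beta> al])
  have A1e: "A1 s = (if s \<le> 0 then 0 else A (1 / s - s))" for s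
    by (simp add: A1_def \<alpha>_def \<beta>_def A_def bk_def)
  have Al: "1 + A1 s \<noteq> 0" if "s \<in> {0..<1/2}" for s
    using that A_pos[OF pos, of s] by (auto simp: A1e)
  define G G' where "G = (\<lambda>s. bk (A1 s) (\<alpha> s))"
    and "G' = (\<lambda>s. ((\<alpha> s - 1 - bk (A1 s) (\<alpha> s)) * A1' s + (A1 s - 1) * \<alpha>' s) / (1 + A1 s))"
  have cG: "C1 G G'" unfolding G_def G'_def by (rule C1_bk[OF cA c\<alpha> Al])
  have Ge: "G s = (if s \<le> 0 then 0 else C (1 / s - s))" for s
    by (simp add: G_def A1e \<alpha>_def C_def bk_def)
  have v: "\<alpha>' 0 = -1" "\<beta>' 0 = -1" "A1' 0 = 2" "G' 0 = -1"
    by (simp_all add: \<alpha>'_def \<beta>'_def A1'_def G'_def \<alpha>_def \<beta>_def A1_def bk_def)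
  have br: "branch i s = (if s = 0 then pt 0 0 else H i (1 / s - s))" if "s \<in> {0..<1/2}" for i s
    using that curve_eq[of "1 / s - s" 0 i] pos[of s] by (auto simp: branch_def)
  show "initial_velocity (branch 0) (-2, -2)"
    by (rule initial_velocity_pt[OF c\<alpha> c\<beta>]) (auto simp: br v H_0 \<alpha>_def \<beta>_def)
  show "initial_velocity (branch 1) (-2, 4)"
    by (rule initial_velocity_pt[OF cA c\<alpha>]) (use H_1[OF pos] in \<open>auto simp: br v A1e \<alpha>_def\<close>)
  show "initial_velocity (branch 2) (4, -2)"
    by (rule initial_velocity_pt[OF cG cA]) (use H_2[OF pos] in \<open>auto simp: br v Ge A1e\<close>)
qed

definition velocity :: "nat \<Rightarrow> real \<times> real" where
  "velocity i = (if i = 0 then (-2, -2) else if i = 1 then (-2, 4) else (4, -2))"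

lemma stable_regular_curves:
  "three_regular_curves stable_set (orbit_defined f_ext Ind_f) branch velocity"
  unfolding three_regular_curves_def
proof (intro conjI allI impI)
  fix i :: nat assume i: "i < 3"
  show "branch i 0 = fin pfix" by (simp add: branch_def fin_pfix)
  show "inj_on (branch i) {0..}" by (rule branch_inj[OF i])
  show "regular_curve_at (branch i) t" if "0 < t" for t by (rule branch_regular[OF i that])
  consider "i = 0" | "i = 1" | "i = 2" using i by linarith
  then show "initial_velocity (branch i) (velocity i)"
  proof cases
    case 1
    then show ?thesis using branch_initial_velocity(1) by (simp only: velocity_def if_True refl)
  next
    case 2
    then show ?thesis using branch_initial_velocity(2) by (simp add: velocity_def)
  next
    case 3
    then show ?thesis using branch_initial_velocity(3) by (simp add: velocity_def)
  qed
next
  show "stable_set = orbit_defined f_ext Ind_f \<inter> (\<Union>i<3. branch i ` {0..})"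
  proof
    show "stable_set \<subseteq> orbit_defined f_ext Ind_f \<inter> (\<Union>i<3. branch i ` {0..})"
    proof
      fix z assume z: "z \<in> stable_set"
      have "\<exists>i<3. z \<in> branch i ` {0..}"
      proof (cases "z = pt 0 0")
        case True
        then show ?thesis unfolding branch_image by (intro exI[of _ 0]) simp
      next
        case False
        then show ?thesis unfolding branch_image using stable_in_curves[OF z] by blast
      qed
      then have "z \<in> (\<Union>i<3. branch i ` {0..})" by blast
      then show "z \<in> orbit_defined f_ext Ind_f \<inter> (\<Union>i<3. branch i ` {0..})"
        using z by (simp add: stable_set_def attracted_set_def)
    qed
    show "orbit_defined f_ext Ind_f \<inter> (\<Union>i<3. branch i ` {0..}) \<subseteq> stable_set"
    proof
      fix z assume "z \<in> orbit_defined f_ext Ind_f \<inter> (\<Union>i<3. branch i ` {0..})"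
      then obtain i where "i < 3" "z \<in> insert (pt 0 0) (range (curve i))" and D: "z \<in> orbit_defined f_ext Ind_f"
        unfolding branch_image by blast
      then consider "z = pt 0 0" | x where "i < 3" "z = curve i x" by blast
      then show "z \<in> stable_set"
      proof cases
        case 1
        then show ?thesis using origin_stable by (simp only:)
      next
        case 2
        then show ?thesis using curve_stable[OF 2(1), of x] D by (simp only:)
      qed
    qed
  qed
next
  fix i j :: nat assume ij: "i < 3" "j < 3" "i \<noteq> j"
  show "fst (velocity i) * snd (velocity j) - snd (velocity i) * fst (velocity j) \<noteq> 0"
  proof -
    have "i = 0 \<or> i = 1 \<or> i = 2" "j = 0 \<or> j = 1 \<or> j = 2" using ij by linarith+
    then show ?thesis using ij(3) by (elim disjE) (simp_all add: velocity_def)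
  qed
  have "x = pt 0 0" if x: "x \<in> insert (pt 0 0) (range (curve i))" "x \<in> insert (pt 0 0) (range (curve j))" "x \<in> range fin" for x
  proof (rule ccontr)
    assume "x \<noteq> pt 0 0"
    then obtain z z' where z: "x = curve i z" "x = curve j z'" using x(1,2) by blast
    have "\<not> at_infinity_point x" using x(3) by (auto simp: at_infinity_point_def fin_def)
    then show False using curve_inj[OF ij(1,2), of z z'] z ij(3) by simp
  qed
  moreover have "pt 0 0 \<in> range fin" unfolding fin_pfix[symmetric] by (rule rangeI)
  ultimately show "branch i ` {0..} \<inter> branch j ` {0..} \<inter> range fin = {fin pfix}"
    unfolding branch_image fin_pfix by (intro equalityI subsetI) (blast, simp)
qed

end

text \<open>The involution \<open>(x, y) \<mapsto> (-y, -x)\<close> conjugates the map with its inverse.\<close>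

definition flip :: "eplane \<Rightarrow> eplane" where
  "flip z = (map_option uminus (snd z), map_option uminus (fst z))"

lemma flip_flip [simp]: "flip (flip z) = z"
  by (cases z) (simp add: flip_def option.map_comp o_def option.map_ident)

lemma flip_image_iff: "z \<in> flip ` S \<longleftrightarrow> flip z \<in> S"
  by (metis flip_flip image_iff)

lemma flip_pt: "flip (pt p q) = pt (- q) (- p)"
  by (simp add: flip_def pt_def)

lemma finv_flip: "finv_ext (flip z) = flip (f_ext z)"
proof (cases z)
  case (Pair z1 z2)
  have m1: "emoebius 1 (-2) 0 1 (map_option uminus z1) = map_option uminus (emoebius 1 2 0 1 z1)"
    by (cases z1) (simp_all add: emoebius_def)
  have "emoebius 1 (-3) 1 1 (map_option uminus z1) = emoebius 1 3 1 (-1) z1"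
  proof (cases z1)
    case (Some x)
    have "(- x - 3) / (1 - x) = (x + 3) / (x - 1)"
      using minus_divide_divide[of "x + 3" "x - 1"] by simp
    then show ?thesis using Some by (simp add: emoebius_def)
  qed (simp add: emoebius_def)
  moreover have "emult (map_option uminus z2) u = map_option uminus (emult z2 u)" for u
    by (cases z2; cases u) (simp_all add: emult_def)
  ultimately show ?thesis using m1 unfolding Pair by (simp add: finv_ext_def f_ext_def flip_def)
qed

lemma finv_iterate_flip: "(finv_ext ^^ n) (flip z) = flip ((f_ext ^^ n) z)"
  by (induction n) (simp_all add: finv_flip)

lemma flip_Ind: "flip z \<in> Ind_finv \<longleftrightarrow> z \<in> Ind_f"
  by (cases z) (auto simp: flip_def Ind_finv_def Ind_f_def)

lemma flip_orbit_defined: "orbit_defined finv_ext Ind_finv = flip ` orbit_defined f_ext Ind_f"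
proof (rule set_eqI)
  fix z
  have "(finv_ext ^^ n) z \<in> Ind_finv \<longleftrightarrow> (f_ext ^^ n) (flip z) \<in> Ind_f" for n
    using finv_iterate_flip[of n "flip z"] flip_Ind by simp
  then show "z \<in> orbit_defined finv_ext Ind_finv \<longleftrightarrow> z \<in> flip ` orbit_defined f_ext Ind_f"
    by (simp add: flip_image_iff orbit_defined_def)
qed

lemma flip_limitin:
  assumes "limitin eplane_top g (pt 0 0) F"
  shows "limitin eplane_top (\<lambda>n. flip (g n)) (pt 0 0) F"
proof -
  have m: "filterlim (map_option uminus) (nb (Some (- l))) (nb (Some l))" for l :: real
  proof -
    have "((\<lambda>s. - s) \<longlongrightarrow> - l) (nhds l)" by (intro tendsto_intros filterlim_ident)
    from filterlim_nb_finite[OF this] show ?thesis unfolding filterlim_nb_at_Some by simp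
  qed
  have L: "filterlim (fst \<circ> g) (nb (Some (-1))) F" "filterlim (snd \<circ> g) (nb (Some 1)) F"
    using assms unfolding limitin_pt0_iff by blast+
  from filterlim_compose[OF m L(1)] filterlim_compose[OF m L(2)] show ?thesis
    unfolding limitin_pt0_iff by (simp add: o_def flip_def)
qed

lemma flip_unstable: "unstable_set = flip ` stable_set"
proof (rule set_eqI)
  fix z
  have e: "(finv_ext ^^ n) z = flip ((f_ext ^^ n) (flip z))" for n using finv_iterate_flip[of n "flip z"] by simp
  have "limitin eplane_top (\<lambda>n. (finv_ext ^^ n) z) (pt 0 0) sequentially \<longleftrightarrow>
      limitin eplane_top (\<lambda>n. (f_ext ^^ n) (flip z)) (pt 0 0) sequentially"
    using flip_limitin[of "\<lambda>n. (f_ext ^^ n) (flip z)"] flip_limitin[of "\<lambda>n. (finv_ext ^^ n) z"] unfolding e by auto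
  then show "z \<in> unstable_set \<longleftrightarrow> z \<in> flip ` stable_set"
    by (simp add: unstable_set_def stable_set_def attracted_set_def fin_pfix flip_image_iff flip_orbit_defined)
qed

lemma chart_rep_flip: "chart_rep z t u \<Longrightarrow> chart_rep (\<lambda>s. map_option uminus (z s)) t (\<lambda>s. - u s)"
proof -
  assume "chart_rep z t u"
  then consider "\<forall>\<^sub>F s in nhds t. z s = Some (u s)" | "\<forall>\<^sub>F s in nhds t. emoebius 0 1 1 0 (z s) = Some (u s)"
    unfolding chart_rep_def by blast
  then show ?thesis
  proof cases
    case 1
    then have "\<forall>\<^sub>F s in nhds t. map_option uminus (z s) = Some (- u s)" by eventually_elim simp
    then show ?thesis by (simp add: chart_rep_def)
  next
    case 2
    then have "\<forall>\<^sub>F s in nhds t. emoebius 0 1 1 0 (map_option uminus (z s)) = Some (- u s)"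
    proof eventually_elim
      case (elim s)
      then show ?case by (cases "z s") (auto simp: emoebius_def split: if_splits)
    qed
    then show ?thesis by (simp add: chart_rep_def)
  qed
qed

lemma regular_curve_flip: "regular_curve_at c t \<Longrightarrow> regular_curve_at (\<lambda>s. flip (c s)) t"
proof -
  assume "regular_curve_at c t"
  then obtain u v where uv: "chart_rep (fst \<circ> c) t u" "chart_rep (snd \<circ> c) t v" "ranal u t" "ranal v t"
    "deriv u t \<noteq> 0 \<or> deriv v t \<noteq> 0" by (auto simp: regular_curve_at_def)
  have d: "deriv (\<lambda>s. - x s) t = - deriv x t" if "ranal x t" for x
    using DERIV_imp_deriv[OF DERIV_minus[OF ranal_derivative[OF that]]] .
  show ?thesis unfolding regular_curve_at_def
    using chart_rep_flip[OF uv(1)] chart_rep_flip[OF uv(2)] ranal_uminus[OF uv(3)] ranal_uminus[OF uv(4)] uv(5)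
      d[OF uv(3)] d[OF uv(4)]
    by (intro exI[of _ "\<lambda>s. - v s"] exI[of _ "\<lambda>s. - u s"]) (auto simp: o_def flip_def)
qed

lemma flip_fin: "flip (fin p) = fin (- snd p, - fst p)"
  by (simp add: flip_def fin_def)

lemma initial_velocity_flip:
  assumes "initial_velocity c w"
  shows "initial_velocity (\<lambda>s. flip (c s)) (- snd w, - fst w)"
proof -
  obtain \<epsilon> \<gamma> \<gamma>' where h: "0 < \<epsilon>" "\<forall>s\<in>{0..<\<epsilon>}. c s = fin (\<gamma> s) \<and> (\<gamma> has_vector_derivative \<gamma>' s) (at s within {0..<\<epsilon>})"
    "continuous_on {0..<\<epsilon>} \<gamma>'" "\<gamma>' 0 = w" using assms unfolding initial_velocity_def by blast
  have bl: "bounded_linear (\<lambda>p::real \<times> real. (- snd p, - fst p))"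
    by (intro bounded_linear_Pair bounded_linear_minus bounded_linear_fst bounded_linear_snd)
  show ?thesis unfolding initial_velocity_def
  proof (intro exI conjI ballI)
    show "0 < \<epsilon>" by (rule h(1))
    show "continuous_on {0..<\<epsilon>} (\<lambda>s. (- snd (\<gamma>' s), - fst (\<gamma>' s)))" by (intro continuous_intros h(3))
    show "(\<lambda>s. (- snd (\<gamma>' s), - fst (\<gamma>' s))) 0 = (- snd w, - fst w)" using h(4) by simp
    fix s assume s: "s \<in> {0..<\<epsilon>}"
    show "flip (c s) = fin ((\<lambda>s. (- snd (\<gamma> s), - fst (\<gamma> s))) s)" using h(2) s by (simp add: flip_fin)
    show "((\<lambda>s. (- snd (\<gamma> s), - fst (\<gamma> s))) has_vector_derivative (\<lambda>s. (- snd (\<gamma>' s), - fst (\<gamma>' s))) s) (at s within {0..<\<epsilon>})"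
      using bounded_linear.has_vector_derivative[OF bl] h(2) s by blast
  qed
qed

text \<open>The involution acts linearly on the finite plane and changes the determinants only in
  sign; in the charts 1/x and 1/y it is again a change of sign.\<close>

lemma three_regular_flip:
  assumes "three_regular_curves W D c w"
  shows "three_regular_curves (flip ` W) (flip ` D) (\<lambda>i s. flip (c i s)) (\<lambda>i. (- snd (w i), - fst (w i)))"
proof -
  have h: "\<And>i. i < 3 \<Longrightarrow> c i 0 = fin pfix" "\<And>i. i < 3 \<Longrightarrow> inj_on (c i) {0..}"
    "\<And>i t. i < 3 \<Longrightarrow> 0 < t \<Longrightarrow> regular_curve_at (c i) t" "\<And>i. i < 3 \<Longrightarrow> initial_velocity (c i) (w i)"
    "W = D \<inter> (\<Union>i<3. c i ` {0..})"
    "\<And>i j. i < 3 \<Longrightarrow> j < 3 \<Longrightarrow> i \<noteq> j \<Longrightarrow> fst (w i) * snd (w j) - snd (w i) * fst (w j) \<noteq> 0"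
    "\<And>i j. i < 3 \<Longrightarrow> j < 3 \<Longrightarrow> i \<noteq> j \<Longrightarrow> c i ` {0..} \<inter> c j ` {0..} \<inter> range fin = {fin pfix}"
    using assms unfolding three_regular_curves_def by blast+
  have inj: "inj flip" by (metis flip_flip injI)
  have fp: "flip (fin pfix) = fin pfix" by (simp add: fin_pfix flip_pt)
  have im: "(\<lambda>s. flip (c i s)) ` {0..} = flip ` (c i ` {0..})" for i by (simp add: image_image)
  have rf: "range fin = flip ` range fin"
  proof (rule set_eqI)
    fix z
    have "z \<in> range fin \<longleftrightarrow> \<not> at_infinity_point z" for z
    proof
      show "z \<in> range fin \<Longrightarrow> \<not> at_infinity_point z" by (auto simp: at_infinity_point_def fin_def)
      show "\<not> at_infinity_point z \<Longrightarrow> z \<in> range fin" using finite_is_pt[of z] by (auto simp: pt_eq_fin)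
    qed
    moreover have "at_infinity_point (flip z) \<longleftrightarrow> at_infinity_point z" by (auto simp: at_infinity_point_def flip_def)
    ultimately show "z \<in> range fin \<longleftrightarrow> z \<in> flip ` range fin" by (simp add: flip_image_iff)
  qed
  show ?thesis unfolding three_regular_curves_def
  proof (intro conjI allI impI)
    fix i :: nat assume i: "i < 3"
    show "flip (c i 0) = fin pfix" using h(1)[OF i] fp by simp
    show "inj_on (\<lambda>s. flip (c i s)) {0..}" using h(2)[OF i] by (metis (no_types, lifting) flip_flip inj_on_def)
    show "regular_curve_at (\<lambda>s. flip (c i s)) t" if "0 < t" for t by (rule regular_curve_flip[OF h(3)[OF i that]])
    show "initial_velocity (\<lambda>s. flip (c i s)) (- snd (w i), - fst (w i))" by (rule initial_velocity_flip[OF h(4)[OF i]])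
  next
    show "flip ` W = flip ` D \<inter> (\<Union>i<3. (\<lambda>s. flip (c i s)) ` {0..})"
      unfolding h(5) im by (simp add: image_Int[OF inj] image_UN)
  next
    fix i j :: nat assume ij: "i < 3" "j < 3" "i \<noteq> j"
    show "fst (- snd (w i), - fst (w i)) * snd (- snd (w j), - fst (w j)) -
        snd (- snd (w i), - fst (w i)) * fst (- snd (w j), - fst (w j)) \<noteq> 0"
      using h(6)[OF ij] by (simp add: algebra_simps)
    have "flip ` (c i ` {0..}) \<inter> flip ` (c j ` {0..}) \<inter> flip ` range fin = flip ` {fin pfix}"
      unfolding h(7)[OF ij, symmetric] by (simp only: image_Int[OF inj])
    then show "(\<lambda>s. flip (c i s)) ` {0..} \<inter> (\<lambda>s. flip (c j s)) ` {0..} \<inter> range fin = {fin pfix}"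
      unfolding im rf[symmetric] using fp by simp
  qed
qed

theorem theorem1p2:
  shows "K_set = {pfix}
    \<and> three_transverse_curves stable_set (orbit_defined f_ext Ind_f) pfix
    \<and> three_transverse_curves unstable_set (orbit_defined finv_ext Ind_finv) pfix"
proof -
  obtain a b a' b' where "stable_curve a b a' b'" using stable_curve_exists by blast
  then interpret stable_curve a b a' b' .
  show ?thesis
    using K_set_eq three_regular_imp_transverse[OF stable_regular_curves]
      three_regular_imp_transverse[OF three_regular_flip[OF stable_regular_curves]]
    unfolding flip_unstable flip_orbit_defined by blast
qed

end
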